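(* Let $C$ be the unique solution in $(0,\infty)$ of $C = 2 e^{-C^2/2}\int_0^C e^{u^2/2}\,du$, let $c(t)=C\sqrt{1-t}$ for $t\in[0,1]$, and for $(t,x)\in[0,1)\times[0,\infty)$ define $$V^{*}(t,x)=\begin{cases} C^{2}\left(\int_{0}^{C}e^{u^{2}/2}\,du\right)^{-1}\left(\dfrac{1-t}{x}\right)\displaystyle\int_{0}^{x/\sqrt{1-t}}e^{u^{2}/2}\,du & \text{if } x<c(t),\\[2mm] x & \text{if } x\geq c(t),\end{cases}$$ where at $x=0$ the first line is understood as its limit as $x\downarrow 0$. Let $V(t,x)=\sup_{t\le\tau\le 1}\mathbb{E}_{t,x}[X_\tau]$ be the value function of the optimal stopping problem for the Brownian excursion $X$ started at time $t$ from $x$ with the identity payoff. Then $V^{*}(t,x)=V(t,x)$ for all $(t,x)\in[0,1)\times[0,\infty)$. Moreover, the stopping time $$\tau^{*}=\inf\{s\ge t: X_s\ge c(s)\}$$ is optimal, i.e. $\mathbb{E}_{t,x}[X_{\tau^*}]=V(t,x)$.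
   Context: Let $W$ be a standard Brownian motion. For $(t,x)\in[0,1)\times[0,\infty)$, the (scaled) Brownian excursion started at $(t,x)$ is the non-negative continuous process $X=(X_s)_{t\le s\le 1}$ with $X_t=x$ satisfying the SDE $$dX_s=\left(\frac{1}{X_s}-\frac{X_s}{1-s}\right)ds+dW_s,\qquad t<s<1;$$ it satisfies $X_1=0$. (For $t=0$, $x=0$ this is the Brownian excursion on $[0,1]$, equivalently the 3-dimensional Bessel bridge from $0$ to $0$.) $\mathbb{E}_{t,x}$ denotes expectation for the process started from $X_t=x$, and the supremum defining $V$ is over all stopping times $\tau$ with values in $[t,1]$ (with respect to the underlying filtration, for which $W$ is a Brownian motion). The equation $C = 2 e^{-C^2/2}\int_0^C e^{u^2/2}\,du$ has exactly one solution in $(0,\infty)$ (it lies in $(1,2)$). Note that $c(1)=0=X_1$, so $\tau^*\le 1$. *)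

theory Defs
  imports "HOL-Probability.Probability"
begin

section \<open>The Brownian excursion\<close>

text \<open>Time ranges over \<open>[0, \<infinity>)\<close>; since the library's filtrations are indexed by a whole type, the
  index type is \<^typ>\<open>real\<close>, and the \<open>\<sigma>\<close>-algebras at negative times play no role. The filtration
  is an arbitrary one, not necessarily complete, right-continuous or generated by \<open>W\<close>.\<close>

locale filtered_brownian_motion = prob_space M + filtration "space M" F
  for M :: "'a measure" and F :: "real \<Rightarrow> 'a measure" +
  fixes W :: "real \<Rightarrow> 'a \<Rightarrow> real"
  assumes subalgebra_F: "\<And>s. 0 \<le> s \<Longrightarrow> subalgebra M (F s)"
    and adapted_W: "\<And>s. 0 \<le> s \<Longrightarrow> W s \<in> borel_measurable (F s)"
    and W_start: "AE \<omega> in M. W 0 \<omega> = 0"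
    and W_continuous: "AE \<omega> in M. continuous_on {0..} (\<lambda>s. W s \<omega>)"
    and W_normal: "\<And>r s. 0 \<le> r \<Longrightarrow> r < s \<Longrightarrow>
      distributed M lborel (\<lambda>\<omega>. W s \<omega> - W r \<omega>) (normal_density 0 (sqrt (s - r)))"
    and W_indep: "\<And>r s. 0 \<le> r \<Longrightarrow> r < s \<Longrightarrow>
      indep_set (sets (F r)) {(\<lambda>\<omega>. W s \<omega> - W r \<omega>) -` A \<inter> space M | A. A \<in> sets borel}"

text \<open>A Brownian excursion started at \<open>(t, x)\<close>: a process with non-negative continuous paths on
  \<open>[t, 1]\<close> solving \<open>dX = (1 / X - X / (1 - s)) ds + dW\<close> on \<open>(t, 1)\<close>. The noise is additive, so the
  integrated equation holds pathwise and needs no stochastic integral. In HOL \<open>1 / 0 = 0\<close> on the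
  reals, so the existence of \<open>\<integral> 1 / X dr\<close> is stated in \<^typ>\<open>ennreal\<close>, where \<open>1 / 0 = \<infinity>\<close>. The other
  drift term is bounded on \<open>[t, s]\<close>, and hence the Lebesgue integral in the equation exists. Since
  \<open>s < 1\<close> in the equation, \<open>X 1 = 0\<close> is not part of the definition.\<close>

locale brownian_excursion = filtered_brownian_motion M F W
  for M :: "'a measure" and F :: "real \<Rightarrow> 'a measure" and W :: "real \<Rightarrow> 'a \<Rightarrow> real" +
  fixes t x :: real and X :: "real \<Rightarrow> 'a \<Rightarrow> real"
  assumes t_range: "0 \<le> t" "t < 1"
    and x_nonneg: "0 \<le> x"
    and adapted_X: "\<And>s. s \<in> {t..1} \<Longrightarrow> X s \<in> borel_measurable (F s)"
    and X_continuous: "\<And>\<omega>. \<omega> \<in> space M \<Longrightarrow> continuous_on {t..1} (\<lambda>s. X s \<omega>)"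
    and X_nonneg: "\<And>\<omega> s. \<omega> \<in> space M \<Longrightarrow> s \<in> {t..1} \<Longrightarrow> 0 \<le> X s \<omega>"
    and X_start: "AE \<omega> in M. X t \<omega> = x"
    and X_sde: "AE \<omega> in M. \<forall>s\<in>{t..<1}.
      (\<integral>\<^sup>+r\<in>{t..s}. 1 / ennreal (X r \<omega>) \<partial>lborel) < \<infinity> \<and>
      X s \<omega> = X t \<omega> + (LBINT r:{t..s}. 1 / X r \<omega> - X r \<omega> / (1 - r)) + (W s \<omega> - W t \<omega>)"

section \<open>The optimal stopping problem\<close>

definition stopping_times :: "'a measure \<Rightarrow> (real \<Rightarrow> 'a measure) \<Rightarrow> real \<Rightarrow> ('a \<Rightarrow> real) set" where
  "stopping_times M F t = {\<tau>. stopping_time F \<tau> \<and> (\<forall>\<omega>\<in>space M. \<tau> \<omega> \<in> {t..1})}"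

text \<open>The payoff is non-negative, so its expectation is taken in \<open>[0, \<infinity>]\<close>; thus neither
  integrability nor boundedness of the supremum is presupposed.\<close>

definition expected_payoff :: "'a measure \<Rightarrow> (real \<Rightarrow> 'a \<Rightarrow> real) \<Rightarrow> ('a \<Rightarrow> real) \<Rightarrow> ennreal" where
  "expected_payoff M X \<tau> = (\<integral>\<^sup>+\<omega>. ennreal (X (\<tau> \<omega>) \<omega>) \<partial>M)"

definition value_fun :: "'a measure \<Rightarrow> (real \<Rightarrow> 'a measure) \<Rightarrow> (real \<Rightarrow> 'a \<Rightarrow> real) \<Rightarrow> real \<Rightarrow> ennreal" where
  "value_fun M F X t = (SUP \<tau>\<in>stopping_times M F t. expected_payoff M X \<tau>)"

section \<open>The candidate solution\<close>

definition excursion_C :: real where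
  "excursion_C = (THE C. 0 < C \<and>
     C = 2 * exp (- (C\<^sup>2) / 2) * integral {0..C} (\<lambda>u. exp (u\<^sup>2 / 2)))"

definition boundary :: "real \<Rightarrow> real" where
  "boundary t = excursion_C * sqrt (1 - t)"

definition V_below :: "real \<Rightarrow> real \<Rightarrow> real" where
  "V_below t x = excursion_C\<^sup>2 * inverse (integral {0..excursion_C} (\<lambda>u. exp (u\<^sup>2 / 2))) *
     ((1 - t) / x) * integral {0..x / sqrt (1 - t)} (\<lambda>u. exp (u\<^sup>2 / 2))"

definition V_star :: "real \<Rightarrow> real \<Rightarrow> real" where
  "V_star t x =
     (if x < boundary t then (if x = 0 then Lim (at_right 0) (V_below t) else V_below t x) else x)"

text \<open>The set is non-empty, as \<open>boundary 1 = 0\<close> and the paths of \<open>X\<close> are non-negative.\<close>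

definition tau_star :: "(real \<Rightarrow> 'a \<Rightarrow> real) \<Rightarrow> real \<Rightarrow> 'a \<Rightarrow> real" where
  "tau_star X t \<omega> = Inf {s \<in> {t..1}. boundary s \<le> X s \<omega>}"

end

theory Submission
  imports Defs
begin

text \<open>Write \<open>z = y / \<surd>(1 - s)\<close>. The formula for \<open>V*\<close> below the boundary has the form
  \<open>U(s, y) = \<surd>(1 - s) \<cdot> \<phi>(z)\<close> with an entire even function \<open>\<phi>\<close> (\<open>profile\<close>), so it makes sense on the
  whole strip, and there it solves the backward equation
  \<open>U\<^sub>s + U\<^sub>y\<^sub>y / 2 + (1 / y - y / (1 - s)) U\<^sub>y = 0\<close> (\<open>profile_ode\<close>). The equation for \<open>C\<close> says that the graph
  of \<open>\<phi>\<close> is tangent to the diagonal at \<open>C\<close>; since \<open>\<phi>\<close> is convex, \<open>U \<ge> y\<close> everywhere (\<open>profile_ge\<close>).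
  Hence, for a start below the boundary, one can compare with the single smooth function \<open>U\<close>:
  \<open>U(s, X\<^sub>s)\<close> is a non-negative local martingale, and \<open>E X\<^sub>\<tau> \<le> E U(\<tau>, X\<^sub>\<tau>) \<le> U(t, x)\<close>.

  If the start lies above the boundary, the drift \<open>1 / X - X / (1 - s)\<close> is negative until \<open>X\<close> hits the
  boundary, because \<open>C \<ge> 1\<close>. So \<open>X\<close> is a supermartingale up to that time \<open>\<sigma>\<close>; at \<open>\<sigma>\<close> one has
  \<open>U = X\<close>, and after \<open>\<sigma>\<close> the gain \<open>X\<^sub>\<tau> - X\<^sub>\<sigma>\<close> is at most \<open>U(\<tau>, X\<^sub>\<tau>) - U(\<sigma>, X\<^sub>\<sigma>)\<close>, which has
  expectation zero after localisation (\<open>expected_payoff_le_start\<close>). Conversely, for a start below the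
  boundary, the process \<open>U(s, X\<^sub>s)\<close> is up to \<open>\<tau>*\<close> bounded by \<open>C \<surd>(1 - s)\<close>, so the local martingale property passes to the limit and
  \<open>E X\<^bsub>\<tau>*\<^esub> = U(t, x)\<close> (\<open>expected_payoff_tau_star_below\<close>).

  The stochastic calculus behind these statements is \<open>dynkin_inequality\<close>. It is proved without
  stochastic integrals: the noise is additive, so \<open>X\<close> is the Brownian motion plus an absolutely
  continuous path. On a fine grid an increment of \<open>f(s, X\<^sub>s)\<close> is split into a part in which only the
  Brownian motion moves and a remainder. The first part is computed by Taylor expansion and the
  independence of the Brownian increment (\<open>expected_increment_test_function\<close>); the remainder
  converges path by path to an ordinary integral against the drift (\<open>path_grid_limit\<close>). Both passages
  to the limit are dominated: Doob's inequality makes \<open>sup |W|\<close> integrable, and a path argument bounds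
  \<open>X\<close> and \<open>\<integral> 1 / X\<close> by it (\<open>X_bound\<close>, \<open>drift_abs_bound\<close>). As \<open>U\<close> grows too fast for this, it is
  replaced outside a compact set by a function with bounded derivatives (\<open>cutoff_extension\<close>), and
  the process is stopped before it leaves that set; Fatou's lemma removes the localisation.\<close>

section \<open>The self-similar solution and the constant C\<close>

text \<open>The substitution \<open>u = z v\<close> turns \<open>(1 / z) \<integral> exp(u\<^sup>2 / 2) du\<close> over \<open>[0, z]\<close> into the moment with \<open>a = 0\<close>,
  which is smooth at \<open>z = 0\<close> too. The higher moments are there because they express the derivatives.\<close>

definition gauss_moment :: "nat \<Rightarrow> real \<Rightarrow> real" where
  "gauss_moment a z = integral {0..1} (\<lambda>v. v ^ a * exp (z\<^sup>2 * v\<^sup>2 / 2))"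

lemma gauss_moment_integrable: "(\<lambda>v. v ^ a * exp (z\<^sup>2 * v\<^sup>2 / 2)) integrable_on {0..1::real}"
  by (intro integrable_continuous_real continuous_intros) auto

lemma gauss_moment_deriv:
  "(gauss_moment a has_real_derivative z * gauss_moment (a + 2) z) (at z)"
proof -
  have "((\<lambda>z. integral (cbox 0 1) (\<lambda>v::real. v ^ a * exp (z\<^sup>2 * v\<^sup>2 / 2))) has_field_derivative
      integral (cbox 0 1) (\<lambda>v. z * (v ^ (a + 2) * exp (z\<^sup>2 * v\<^sup>2 / 2)))) (at z within UNIV)"
  proof (rule leibniz_rule_field_derivative)
    show "((\<lambda>z. v ^ a * exp (z\<^sup>2 * v\<^sup>2 / 2)) has_real_derivative
        z * (v ^ (a + 2) * exp (z\<^sup>2 * v\<^sup>2 / 2))) (at z within UNIV)" for z v :: real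
      by (auto intro!: derivative_eq_intros simp: power_add power2_eq_square)
    show "continuous_on (UNIV \<times> cbox 0 1) (\<lambda>(z, v). z * (v ^ (a + 2) * exp (z\<^sup>2 * v\<^sup>2 / 2 :: real)))"
      by (auto intro!: continuous_intros simp: case_prod_unfold)
  qed (use gauss_moment_integrable in \<open>auto simp: cbox_interval\<close>)
  then show ?thesis
    by (simp add: gauss_moment_def[abs_def] cbox_interval)
qed

lemma gauss_moment_deriv_chain [derivative_intros]:
  assumes "(f has_real_derivative f') (at z within S)"
  shows "((\<lambda>z. gauss_moment a (f z)) has_real_derivative f z * gauss_moment (a + 2) (f z) * f') (at z within S)"
  using DERIV_chain2[OF gauss_moment_deriv assms] .

lemma continuous_gauss_moment [continuous_intros]:
  "continuous_on S f \<Longrightarrow> continuous_on S (\<lambda>z. gauss_moment a (f z))"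
  by (rule continuous_on_compose2[of UNIV "gauss_moment a"])
     (auto intro!: DERIV_continuous_on gauss_moment_deriv[THEN DERIV_subset])

text \<open>Integration by parts: the left side is the integral over \<open>[0, 1]\<close> of the derivative of
  \<open>v\<^bsup>a + 1\<^esup> exp(z\<^sup>2 v\<^sup>2 / 2)\<close>. This recursion between the moments contains both the formula for
  \<open>\<integral> exp(u\<^sup>2 / 2)\<close> and the differential equation of the profile.\<close>

lemma gauss_moment_parts:
  "real (a + 1) * gauss_moment a z + z\<^sup>2 * gauss_moment (a + 2) z = exp (z\<^sup>2 / 2)"
proof -
  have "((\<lambda>v::real. real (a + 1) * (v ^ a * exp (z\<^sup>2 * v\<^sup>2 / 2)) + z\<^sup>2 * (v ^ (a + 2) * exp (z\<^sup>2 * v\<^sup>2 / 2)))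
      has_integral (1 ^ (a + 1) * exp (z\<^sup>2 * 1\<^sup>2 / 2) - 0 ^ (a + 1) * exp (z\<^sup>2 * 0\<^sup>2 / 2))) {0..1}"
  proof (rule fundamental_theorem_of_calculus)
    fix v :: real assume "v \<in> {0..1}"
    have "((\<lambda>v. v ^ (a + 1) * exp (z\<^sup>2 * v\<^sup>2 / 2)) has_real_derivative
       real (a + 1) * (v ^ a * exp (z\<^sup>2 * v\<^sup>2 / 2)) + z\<^sup>2 * (v ^ (a + 2) * exp (z\<^sup>2 * v\<^sup>2 / 2))) (at v within {0..1})"
      by (auto intro!: derivative_eq_intros simp: power2_eq_square algebra_simps)
         (cases a; simp)+
    then show "((\<lambda>v. v ^ (a + 1) * exp (z\<^sup>2 * v\<^sup>2 / 2)) has_vector_derivative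
       real (a + 1) * (v ^ a * exp (z\<^sup>2 * v\<^sup>2 / 2)) + z\<^sup>2 * (v ^ (a + 2) * exp (z\<^sup>2 * v\<^sup>2 / 2))) (at v within {0..1})"
      by (simp add: has_real_derivative_iff_has_vector_derivative)
  qed auto
  moreover have "((\<lambda>v::real. real (a + 1) * (v ^ a * exp (z\<^sup>2 * v\<^sup>2 / 2)) + z\<^sup>2 * (v ^ (a + 2) * exp (z\<^sup>2 * v\<^sup>2 / 2)))
      has_integral real (a + 1) * gauss_moment a z + z\<^sup>2 * gauss_moment (a + 2) z) {0..1}"
    unfolding gauss_moment_def
    by (intro has_integral_add has_integral_mult_right integrable_integral gauss_moment_integrable)
  ultimately show ?thesis
    by (auto dest: has_integral_unique)
qed

lemma integral_exp_eq_gauss_moment: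
  assumes "0 \<le> z" shows "integral {0..z} (\<lambda>u. exp (u\<^sup>2 / 2)) = z * gauss_moment 0 z"
proof -
  have "((\<lambda>u. exp (u\<^sup>2 / 2)) has_integral (z * gauss_moment 0 z - 0 * gauss_moment 0 0)) {0..z}"
  proof (rule fundamental_theorem_of_calculus)
    fix u :: real
    have "((\<lambda>z. z * gauss_moment 0 z) has_real_derivative gauss_moment 0 u + u\<^sup>2 * gauss_moment 2 u) (at u within {0..z})"
      by (auto intro!: derivative_eq_intros simp: power2_eq_square numeral_2_eq_2)
    then show "((\<lambda>z. z * gauss_moment 0 z) has_vector_derivative exp (u\<^sup>2 / 2)) (at u within {0..z})"
      using gauss_moment_parts[of 0 u] by (simp add: has_real_derivative_iff_has_vector_derivative numeral_2_eq_2)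
  qed (use assms in auto)
  then show ?thesis by (simp add: integral_unique)
qed

lemma gauss_moment_ge: "1 / real (a + 1) \<le> gauss_moment a z"
proof -
  have "((\<lambda>v::real. v ^ a) has_integral (1 ^ (a + 1) / real (a + 1) - 0 ^ (a + 1) / real (a + 1))) {0..1}"
  proof (rule fundamental_theorem_of_calculus)
    show "((\<lambda>v. v ^ (a + 1) / real (a + 1)) has_vector_derivative v ^ a) (at v within {0..1})" for v :: real
      unfolding has_real_derivative_iff_has_vector_derivative[symmetric]
      using DERIV_cdivide[OF DERIV_pow[of "a + 1" v "{0..1}"], of "real (a + 1)"] by simp
  qed simp
  then have "((\<lambda>v::real. v ^ a) has_integral (1 / real (a + 1))) {0..1}" by simp
  moreover have "((\<lambda>v::real. v ^ a * exp (z\<^sup>2 * v\<^sup>2 / 2)) has_integral gauss_moment a z) {0..1}"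
    unfolding gauss_moment_def by (intro integrable_integral gauss_moment_integrable)
  moreover have "v ^ a \<le> v ^ a * exp (z\<^sup>2 * v\<^sup>2 / 2)" if "v \<in> {0..1}" for v :: real
    using that by (intro mult_le_cancel_left1[THEN iffD2]) (auto simp: not_less)
  ultimately show ?thesis by (rule has_integral_le)
qed

lemma gauss_moment_pos: "0 < gauss_moment a z"
  using gauss_moment_ge[of a z] by (rule less_le_trans[rotated]) simp

text \<open>With \<open>\<phi>\<close> the moment of order 0, the function here is \<open>z \<phi>'(z) - \<phi>(z)\<close>, whose zeros are the points
  where the tangent to the graph of \<open>\<phi>\<close> passes through the origin. Its derivative is \<open>z \<phi>''(z) > 0\<close>.\<close>

lemma tangency_strict_mono:
  assumes "0 \<le> y" "y < z"
  shows "y\<^sup>2 * gauss_moment 2 y - gauss_moment 0 y < z\<^sup>2 * gauss_moment 2 z - gauss_moment 0 z"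
proof (rule DERIV_pos_imp_increasing_open[OF assms(2)])
  fix u assume "y < u" "u < z"
  then have u: "0 < u" using assms by simp
  have "((\<lambda>z. z\<^sup>2 * gauss_moment 2 z - gauss_moment 0 z) has_real_derivative
      u * gauss_moment 2 u + u ^ 3 * gauss_moment 4 u) (at u)"
    by (auto intro!: derivative_eq_intros simp: power2_eq_square power3_eq_cube numeral_2_eq_2 numeral_eq_Suc algebra_simps)
  moreover have "0 < u * gauss_moment 2 u + u ^ 3 * gauss_moment 4 u"
    using u gauss_moment_pos by (intro add_pos_pos mult_pos_pos) auto
  ultimately show "\<exists>D. ((\<lambda>z. z\<^sup>2 * gauss_moment 2 z - gauss_moment 0 z) has_real_derivative D) (at u) \<and> 0 < D"
    by blast
qed (auto intro!: continuous_intros)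

lemma tangency_at_1: "gauss_moment 2 1 \<le> gauss_moment 0 1"
  unfolding gauss_moment_def
  by (intro integral_le gauss_moment_integrable) (auto simp: power_le_one)

text \<open>The integrand \<open>(4 v\<^sup>2 - 1) exp(2 v\<^sup>2)\<close> changes sign at \<open>v = 1 / 2\<close>, where the increasing weight is
  \<open>exp(1 / 2)\<close>; replacing the weight by this constant only decreases the integral.\<close>

lemma tangency_at_2: "gauss_moment 0 2 \<le> 2\<^sup>2 * gauss_moment 2 2"
proof -
  have "((\<lambda>v::real. exp (1 / 2) * (4 * v ^ 2 - 1)) has_integral
      (exp (1 / 2) * (4 * 1 ^ 3 / 3 - 1) - exp (1 / 2) * (4 * 0 ^ 3 / 3 - 0))) {0..1}"
    by (rule fundamental_theorem_of_calculus)
       (auto intro!: derivative_eq_intros simp: has_real_derivative_iff_has_vector_derivative[symmetric])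
  moreover have "((\<lambda>v::real. 4 * (v ^ 2 * exp (2\<^sup>2 * v\<^sup>2 / 2)) - v ^ 0 * exp (2\<^sup>2 * v\<^sup>2 / 2)) has_integral
      (4 * gauss_moment 2 2 - gauss_moment 0 2)) {0..1}"
    unfolding gauss_moment_def
    by (intro has_integral_diff has_integral_mult_right integrable_integral gauss_moment_integrable)
  moreover have "exp (1 / 2) * (4 * v ^ 2 - 1) \<le> 4 * (v ^ 2 * exp (2\<^sup>2 * v\<^sup>2 / 2)) - v ^ 0 * exp (2\<^sup>2 * v\<^sup>2 / 2)" for v :: real
  proof -
    have "0 \<le> (exp (2 * v\<^sup>2) - exp (1 / 2)) * (4 * v ^ 2 - 1)"
      by (cases "1 / 2 \<le> 2 * v\<^sup>2") (auto intro!: mult_nonneg_nonneg mult_nonpos_nonpos)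
    then show ?thesis by (simp add: algebra_simps)
  qed
  ultimately have "exp (1 / 2) * (4 * 1 ^ 3 / 3 - 1) - exp (1 / 2) * (4 * 0 ^ 3 / 3 - 0) \<le> 4 * gauss_moment 2 2 - gauss_moment 0 (2::real)"
    by (rule has_integral_le)
  moreover have "(0::real) \<le> exp (1 / 2) * (4 * 1 ^ 3 / 3 - 1) - exp (1 / 2) * (4 * 0 ^ 3 / 3 - 0)"
    by simp
  ultimately have "0 \<le> 4 * gauss_moment 2 2 - gauss_moment 0 (2::real)" by (rule order_trans[rotated])
  then show ?thesis by simp
qed

text \<open>The case \<open>a = 0\<close> of integration by parts turns \<open>exp(c\<^sup>2 / 2)\<close> into moments, so the defining
  equation of \<open>C\<close> becomes the tangency condition.\<close>

lemma excursion_C_equation_iff: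
  assumes "0 < c"
  shows "c = 2 * exp (- (c\<^sup>2) / 2) * integral {0..c} (\<lambda>u. exp (u\<^sup>2 / 2)) \<longleftrightarrow>
    c\<^sup>2 * gauss_moment 2 c = gauss_moment 0 c"
proof -
  have "c = 2 * exp (- (c\<^sup>2) / 2) * integral {0..c} (\<lambda>u. exp (u\<^sup>2 / 2)) \<longleftrightarrow>
      exp (c\<^sup>2 / 2) = 2 * gauss_moment 0 c"
    using assms by (auto simp: integral_exp_eq_gauss_moment exp_minus field_simps)
  also have "\<dots> \<longleftrightarrow> c\<^sup>2 * gauss_moment 2 c = gauss_moment 0 c"
    using gauss_moment_parts[of 0 c] by (auto simp: numeral_2_eq_2)
  finally show ?thesis .
qed

lemma excursion_C_props:
  shows excursion_C_ge_1: "1 \<le> excursion_C"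
    and excursion_C_tangency: "excursion_C\<^sup>2 * gauss_moment 2 excursion_C = gauss_moment 0 excursion_C"
proof -
  have "\<exists>c\<ge>1. c \<le> 2 \<and> c\<^sup>2 * gauss_moment 2 c - gauss_moment 0 c = 0"
    using tangency_at_1 tangency_at_2 by (intro IVT') (auto intro!: continuous_intros)
  then obtain c where c: "1 \<le> c" "c\<^sup>2 * gauss_moment 2 c = gauss_moment 0 c" by auto
  have "excursion_C = c"
    unfolding excursion_C_def
  proof (rule the_equality)
    show "0 < c \<and> c = 2 * exp (- (c\<^sup>2) / 2) * integral {0..c} (\<lambda>u. exp (u\<^sup>2 / 2))"
      using c excursion_C_equation_iff[of c] by simp
  next
    fix d :: real assume d: "0 < d \<and> d = 2 * exp (- (d\<^sup>2) / 2) * integral {0..d} (\<lambda>u. exp (u\<^sup>2 / 2))"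
    then have "d\<^sup>2 * gauss_moment 2 d = gauss_moment 0 d"
      using excursion_C_equation_iff[of d] by blast
    then show "d = c"
      using c d tangency_strict_mono[of c d] tangency_strict_mono[of d c] by (cases d c rule: linorder_cases) auto
  qed
  then show "1 \<le> excursion_C" "excursion_C\<^sup>2 * gauss_moment 2 excursion_C = gauss_moment 0 excursion_C"
    using c by simp_all
qed

text \<open>The scale makes the profile equal to the identity at \<open>C\<close>; by tangency the slope there is 1.\<close>

definition profile_scale :: real where
  "profile_scale = excursion_C / gauss_moment 0 excursion_C"

definition profile :: "real \<Rightarrow> real" where
  "profile z = profile_scale * gauss_moment 0 z"

definition profile_deriv :: "real \<Rightarrow> real" where
  "profile_deriv z = profile_scale * (z * gauss_moment 2 z)"

definition profile_deriv2 :: "real \<Rightarrow> real" where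
  "profile_deriv2 z = profile_scale * (gauss_moment 2 z + z\<^sup>2 * gauss_moment 4 z)"

lemma profile_factor_pos: "0 < profile_scale"
  unfolding profile_scale_def using excursion_C_ge_1 gauss_moment_pos[of 0 excursion_C] by simp

lemma DERIV_profile: "(profile has_real_derivative profile_deriv z) (at z)"
  unfolding profile_def[abs_def] profile_deriv_def
  by (auto intro!: derivative_eq_intros simp: numeral_2_eq_2)

lemma DERIV_profile_deriv: "(profile_deriv has_real_derivative profile_deriv2 z) (at z)"
  unfolding profile_deriv2_def profile_deriv_def[abs_def]
  by (auto intro!: derivative_eq_intros simp: power2_eq_square numeral_eq_Suc algebra_simps)

lemma profile_deriv2_deriv:
  obtains g where "\<And>z. (profile_deriv2 has_real_derivative g z) (at z)" "continuous_on UNIV g"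
proof
  show "(profile_deriv2 has_real_derivative
      profile_scale * (3 * z * gauss_moment 4 z + z ^ 3 * gauss_moment 6 z)) (at z)" for z
    unfolding profile_deriv2_def[abs_def]
    by (auto intro!: derivative_eq_intros simp: power2_eq_square power3_eq_cube numeral_eq_Suc algebra_simps)
qed (auto intro!: continuous_intros)

text \<open>The backward equation for \<open>\<surd>(1 - s) \<cdot> profile(y / \<surd>(1 - s))\<close>, in the variable \<open>z = y / \<surd>(1 - s)\<close>.\<close>

lemma profile_ode:
  assumes "z \<noteq> 0"
  shows "profile_deriv2 z / 2 + (1 / z - z / 2) * profile_deriv z - profile z / 2 = 0"
proof -
  define k where "k = profile_scale"
  have "profile_deriv2 z / 2 + (1 / z - z / 2) * profile_deriv z - profile z / 2 =
     k / 2 * ((3 * gauss_moment 2 z + z\<^sup>2 * gauss_moment 4 z) - (gauss_moment 0 z + z\<^sup>2 * gauss_moment 2 z))"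
    using assms unfolding profile_def profile_deriv_def profile_deriv2_def k_def[symmetric]
    by (simp add: field_simps power2_eq_square)
  also have "\<dots> = 0"
    using gauss_moment_parts[of 0 z] gauss_moment_parts[of 2 z] by (simp add: numeral_eq_Suc)
  finally show ?thesis .
qed

lemma profile_C: "profile excursion_C = excursion_C"
  using gauss_moment_pos[of 0 excursion_C] by (simp add: profile_def profile_scale_def)

lemma profile_deriv_C: "profile_deriv excursion_C = 1"
  using excursion_C_tangency gauss_moment_pos[of 0 excursion_C]
  by (simp add: profile_deriv_def profile_scale_def power2_eq_square field_simps)

lemma profile_deriv2_nonneg: "0 \<le> profile_deriv2 z"
  unfolding profile_deriv2_def using profile_factor_pos gauss_moment_pos[THEN less_imp_le]
  by (intro mult_nonneg_nonneg add_nonneg_nonneg) auto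

text \<open>A convex function lies above its tangent at \<open>C\<close>, which is the diagonal.\<close>

lemma profile_ge: "z \<le> profile z"
proof -
  have "convex_on UNIV profile"
    by (rule f''_ge0_imp_convex[OF convex_UNIV DERIV_profile DERIV_profile_deriv profile_deriv2_nonneg])
  then have "profile_deriv excursion_C * (z - excursion_C) \<le> profile z - profile excursion_C"
    by (rule convex_on_imp_above_tangent) (auto intro: DERIV_profile)
  then show ?thesis by (simp add: profile_C profile_deriv_C)
qed

lemma profile_pos: "0 < profile z"
  unfolding profile_def using profile_factor_pos gauss_moment_pos by (rule mult_pos_pos)

lemma profile_le_C:
  assumes "0 \<le> z" "z \<le> excursion_C" shows "profile z \<le> excursion_C"
proof -
  have "profile z \<le> profile excursion_C"
  proof (rule DERIV_nonneg_imp_nondecreasing[OF assms(2)])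
    fix u assume "z \<le> u"
    then have "0 \<le> profile_deriv u"
      unfolding profile_deriv_def using assms profile_factor_pos gauss_moment_pos[THEN less_imp_le]
      by (intro mult_nonneg_nonneg) auto
    then show "\<exists>y. (profile has_real_derivative y) (at u) \<and> 0 \<le> y"
      using DERIV_profile by blast
  qed
  then show ?thesis by (simp add: profile_C)
qed

lemma continuous_profile: "continuous_on UNIV profile"
  unfolding profile_def[abs_def] by (intro continuous_intros)

lemma V_below_eq:
  assumes "t < 1" "0 < x" shows "V_below t x = sqrt (1 - t) * profile (x / sqrt (1 - t))"
proof -
  define r where "r = sqrt (1 - t)"
  have r: "1 - t = r * r" "0 < r" using assms by (auto simp: r_def)
  have I: "integral {0..x / r} (\<lambda>u. exp (u\<^sup>2 / 2)) = x / r * gauss_moment 0 (x / r)"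
    "integral {0..excursion_C} (\<lambda>u. exp (u\<^sup>2 / 2)) = excursion_C * gauss_moment 0 excursion_C"
    using r assms excursion_C_ge_1 by (simp_all add: integral_exp_eq_gauss_moment)
  have "V_below t x = excursion_C\<^sup>2 * inverse (excursion_C * gauss_moment 0 excursion_C) *
      (r * r / x) * (x / r * gauss_moment 0 (x / r))"
    unfolding V_below_def r_def[symmetric] I by (simp add: r(1))
  also have "\<dots> = r * profile (x / r)"
    using assms r excursion_C_ge_1 gauss_moment_pos[of 0 excursion_C]
    by (simp add: profile_def profile_scale_def field_simps power2_eq_square)
  finally show ?thesis by (simp add: r_def)
qed

lemma V_star_eq:
  assumes "t < 1" "0 \<le> x"
  shows "V_star t x = (if x < boundary t then sqrt (1 - t) * profile (x / sqrt (1 - t)) else x)"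
proof (cases "x = 0")
  case True
  have "isCont profile (0 / sqrt (1 - t))"
    using DERIV_profile DERIV_isCont by blast
  then have "((\<lambda>x. profile (x / sqrt (1 - t))) \<longlongrightarrow> profile (0 / sqrt (1 - t))) (at_right 0)"
    by (rule isCont_tendsto_compose)
       (intro tendsto_divide tendsto_ident_at tendsto_const, use assms in simp)
  then have "((\<lambda>x. sqrt (1 - t) * profile (x / sqrt (1 - t))) \<longlongrightarrow>
      sqrt (1 - t) * profile (0 / sqrt (1 - t))) (at_right 0)"
    by (rule tendsto_mult_left)
  then have "(V_below t \<longlongrightarrow> sqrt (1 - t) * profile (0 / sqrt (1 - t))) (at_right 0)"
    by (rule Lim_transform_eventually)
       (use assms in \<open>auto simp: eventually_at_right_field V_below_eq intro!: exI[of _ 1]\<close>)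
  then have "Lim (at_right 0) (V_below t) = sqrt (1 - t) * profile (0 / sqrt (1 - t))"
    by (intro tendsto_Lim) auto
  then show ?thesis using True by (simp add: V_star_def)
qed (use assms in \<open>auto simp: V_star_def V_below_eq\<close>)

section \<open>Extensions with bounded derivatives\<close>

text \<open>The function is constant on either side of \<open>[-R, R]\<close>, and continuous on this compact interval.\<close>

lemma bounded_if_deriv_vanishes_outside:
  fixes f f' :: "real \<Rightarrow> real"
  assumes "\<And>z. (f has_real_derivative f' z) (at z)" and "\<And>z. R \<le> \<bar>z\<bar> \<Longrightarrow> f' z = 0" and "0 \<le> R"
  shows "\<exists>B. \<forall>z. \<bar>f z\<bar> \<le> B"
proof -
  have "continuous_on {-R..R} f"
    using assms(1) by (auto intro!: DERIV_continuous_on intro: DERIV_subset)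
  then have "bounded (f ` {-R..R})"
    by (intro compact_imp_bounded compact_continuous_image) auto
  then obtain B where B: "\<And>z. z \<in> {-R..R} \<Longrightarrow> \<bar>f z\<bar> \<le> B"
    unfolding bounded_iff ball_simps real_norm_def by blast
  have "\<bar>f z\<bar> \<le> B" for z
  proof -
    consider "z \<in> {-R..R}" | "R < z" | "z < -R" by fastforce
    then show ?thesis
    proof cases
      case 2
      have "(f has_real_derivative 0) (at y)" if "R < y" "y < z" for y
        using assms(1)[of y] assms(2)[of y] that by simp
      then have "f z = f R"
        using 2 assms(1)[THEN DERIV_isCont]
        by (intro DERIV_isconst2[of R z f]) (auto intro!: continuous_at_imp_continuous_on)
      then show ?thesis using B[of R] assms(3) by auto
    next
      case 3
      have "(f has_real_derivative 0) (at y)" if "z < y" "y < -R" for y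
        using assms(1)[of y] assms(2)[of y] that by simp
      then have "f (-R) = f z"
        using 3 assms(1)[THEN DERIV_isCont]
        by (intro DERIV_isconst2[of z "-R" f]) (auto intro!: continuous_at_imp_continuous_on)
      then show ?thesis using B[of "-R"] assms(3) by auto
    qed (rule B)
  qed
  then show ?thesis by blast
qed

lemma antiderivative_UNIV:
  fixes h :: "real \<Rightarrow> real"
  assumes "continuous_on UNIV h"
  obtains H where "H 0 = c" "\<And>z. (H has_real_derivative h z) (at z)"
proof -
  let ?H = "\<lambda>z. c + (LBINT y=(0::real)..(z::real). h y)"
  have "(?H has_real_derivative h z) (at z)" for z
  proof -
    have "((\<lambda>u. LBINT y=(0::real)..u. h y) has_vector_derivative h z) (at z within {-\<bar>z\<bar>-1..\<bar>z\<bar>+1})"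
      by (rule interval_integral_FTC2) (use assms in \<open>auto intro: continuous_on_subset\<close>)
    then have "((\<lambda>u. LBINT y=(0::real)..u. h y) has_real_derivative h z) (at z)"
      by (subst (asm) at_within_Icc_at) (auto simp: has_real_derivative_iff_has_vector_derivative)
    then show ?thesis
      by (auto intro!: derivative_eq_intros)
  qed
  moreover have "?H 0 = c" by simp
  ultimately show ?thesis by (rule that[rotated])
qed

text \<open>A function with three derivatives agrees on \<open>[-R, R]\<close> with one whose first two derivatives and whose
  Legendre transform \<open>z p' - p\<close> are bounded. The bounds are those that a self-similar function
  \<open>\<surd>(1 - s) \<cdot> p(y / \<surd>(1 - s))\<close> needs: its time derivative is \<open>(z p' - p) / (2 \<surd>(1 - s))\<close>. The idea is to
  cut off the second derivative and to integrate twice; then \<open>p'\<close> and \<open>z p' - p\<close> have derivatives \<open>p''\<close>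
  and \<open>z p''\<close> of compact support.\<close>

lemma cutoff_extension:
  fixes g g1 g2 g3 :: "real \<Rightarrow> real"
  assumes g: "\<And>z. (g has_real_derivative g1 z) (at z)"
    and g1: "\<And>z. (g1 has_real_derivative g2 z) (at z)"
    and g2: "\<And>z. (g2 has_real_derivative g3 z) (at z)"
    and g3: "continuous_on UNIV g3" and R: "0 \<le> R"
  obtains p q h B where
    "\<And>z. (p has_real_derivative q z) (at z)" "\<And>z. (q has_real_derivative h z) (at z)"
    "\<And>z. \<bar>q z\<bar> \<le> B" "\<And>z. \<bar>h z\<bar> \<le> B" "\<And>z. \<bar>z * q z - p z\<bar> \<le> B"
    "\<And>z w. \<bar>h z - h w\<bar> \<le> B * \<bar>z - w\<bar>" "continuous_on UNIV h"
    "\<And>z. \<bar>z\<bar> \<le> R \<Longrightarrow> p z = g z" "\<And>z. \<bar>z\<bar> \<le> R \<Longrightarrow> q z = g1 z" "\<And>z. \<bar>z\<bar> \<le> R \<Longrightarrow> h z = g2 z"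
proof -
  \<comment> \<open>The second derivative is frozen outside \<open>[-R, R]\<close> and multiplied by a tent that is 1 on this interval.\<close>
  define cl where "cl z = max (-R) (min R z)" for z
  define ct where "ct z = max 0 (min 1 (R + 1 - \<bar>z\<bar>))" for z
  define h where "h z = g2 (cl z) * ct z" for z
  have cont_g2: "continuous_on UNIV g2" using g2 by (auto intro!: DERIV_continuous_on)
  have "bounded (g2 ` {-R..R})" "bounded (g3 ` {-R..R})"
    using cont_g2 g3 by (auto intro!: compact_imp_bounded compact_continuous_image intro: continuous_on_subset)
  then obtain B2 B3 where B: "\<forall>y\<in>g2 ` {-R..R}. norm y \<le> B2" "\<forall>y\<in>g3 ` {-R..R}. norm y \<le> B3"
    unfolding bounded_iff by blast
  then have B2: "\<And>z. z \<in> {-R..R} \<Longrightarrow> \<bar>g2 z\<bar> \<le> B2" and B3: "\<And>z. z \<in> {-R..R} \<Longrightarrow> \<bar>g3 z\<bar> \<le> B3"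
    by auto
  have "0 \<le> B2" "0 \<le> B3" using B2[of 0] B3[of 0] R by auto
  have cl: "cl z \<in> {-R..R}" "\<bar>cl z - cl w\<bar> \<le> \<bar>z - w\<bar>" for z w
    using R unfolding cl_def by (auto simp: min_def max_def abs_if)
  have ct: "0 \<le> ct z" "ct z \<le> 1" "\<bar>ct z - ct w\<bar> \<le> \<bar>z - w\<bar>" for z w
    unfolding ct_def by (simp, simp, smt (verit))
  have g2_lip: "\<bar>g2 a - g2 b\<bar> \<le> B3 * \<bar>a - b\<bar>" if "a \<in> {-R..R}" "b \<in> {-R..R}" for a b
    unfolding real_norm_def[symmetric]
    by (rule field_differentiable_bound[of "{-R..R}" g2 g3 B3 a b])
       (use that g2[THEN DERIV_subset] B3 in simp_all)
  have h_bound: "\<bar>h z\<bar> \<le> B2" for z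
    using mult_mono[OF B2[OF cl(1)[of z]] ct(2)[of z]] ct(1)[of z] \<open>0 \<le> B2\<close>
    by (simp add: h_def abs_mult)
  have h_lip: "\<bar>h z - h w\<bar> \<le> (B3 + B2) * \<bar>z - w\<bar>" for z w
  proof -
    have "h z - h w = (g2 (cl z) - g2 (cl w)) * ct z + g2 (cl w) * (ct z - ct w)"
      by (simp add: h_def algebra_simps)
    also have "\<bar>\<dots>\<bar> \<le> \<bar>g2 (cl z) - g2 (cl w)\<bar> * ct z + \<bar>g2 (cl w)\<bar> * \<bar>ct z - ct w\<bar>"
      using ct(1)[of z] abs_triangle_ineq[of "(g2 (cl z) - g2 (cl w)) * ct z" "g2 (cl w) * (ct z - ct w)"]
      by (simp add: abs_mult)
    also have "\<dots> \<le> (B3 * \<bar>z - w\<bar>) * 1 + B2 * \<bar>z - w\<bar>"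
    proof (intro add_mono mult_mono ct B2 cl)
      show "\<bar>g2 (cl z) - g2 (cl w)\<bar> \<le> B3 * \<bar>z - w\<bar>"
        using g2_lip[OF cl(1) cl(1), of z w] mult_left_mono[OF cl(2)[of z w] \<open>0 \<le> B3\<close>] by linarith
    qed (use \<open>0 \<le> B2\<close> \<open>0 \<le> B3\<close> in auto)
    finally show ?thesis by (simp add: algebra_simps)
  qed
  have h_cont: "continuous_on UNIV h"
    unfolding h_def[abs_def] cl_def[abs_def] ct_def[abs_def]
    by (intro continuous_intros continuous_on_compose2[OF cont_g2]) auto
  obtain q where q: "q 0 = g1 0" "\<And>z. (q has_real_derivative h z) (at z)"
    using antiderivative_UNIV[OF h_cont] by metis
  have "continuous_on UNIV q" using q(2) by (auto intro!: DERIV_continuous_on)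
  then obtain p where p: "p 0 = g 0" "\<And>z. (p has_real_derivative q z) (at z)"
    using antiderivative_UNIV by metis
  have h_in: "h z = g2 z" if "\<bar>z\<bar> \<le> R" for z
  proof -
    have "cl z = z" "ct z = 1" using that unfolding cl_def ct_def by (smt (verit))+
    then show ?thesis by (simp add: h_def)
  qed
  have h_out: "h z = 0" if "R + 1 \<le> \<bar>z\<bar>" for z
    using that by (simp add: h_def ct_def)
  have eq_in: "f z = k z"
    if "\<And>z. (f has_real_derivative f' z) (at z)" "\<And>z. (k has_real_derivative k' z) (at z)"
      "\<And>z. \<bar>z\<bar> \<le> R \<Longrightarrow> f' z = k' z" "f 0 = k 0" "\<bar>z\<bar> \<le> R" for f k f' k' :: "real \<Rightarrow> real" and z
  proof -
    have "\<bar>(f z - k z) - (f 0 - k 0)\<bar> \<le> 0 * \<bar>z - 0\<bar>"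
      unfolding real_norm_def[symmetric]
      by (rule field_differentiable_bound[of "{-R..R}" "\<lambda>z. f z - k z" "\<lambda>z. f' z - k' z"])
         (use that R in \<open>auto intro!: DERIV_diff intro: DERIV_subset\<close>)
    then show ?thesis using that by simp
  qed
  have q_in: "q z = g1 z" if "\<bar>z\<bar> \<le> R" for z
    using eq_in[OF q(2) g1 h_in q(1) that] .
  have p_in: "p z = g z" if "\<bar>z\<bar> \<le> R" for z
    using eq_in[OF p(2) g q_in p(1) that] .
  obtain Bq where Bq: "\<And>z. \<bar>q z\<bar> \<le> Bq"
    using bounded_if_deriv_vanishes_outside[of q h "R + 1"] q(2) h_out R by auto
  have deriv: "((\<lambda>z. z * q z - p z) has_real_derivative z * h z) (at z)" for z
    using DERIV_diff[OF DERIV_mult[OF DERIV_ident q(2)] p(2), of z] by (simp add: mult.commute)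
  have "\<exists>B. \<forall>z. \<bar>z * q z - p z\<bar> \<le> B"
    by (rule bounded_if_deriv_vanishes_outside[OF deriv, of "R + 1"]) (use h_out R in simp_all)
  then obtain Bp where Bp: "\<And>z. \<bar>z * q z - p z\<bar> \<le> Bp" by blast
  have nonneg: "0 \<le> Bq" "0 \<le> Bp" using Bq[of 0] Bp[of 0] by linarith+
  define B where "B = Bq + Bp + B2 + B3"
  have B: "Bq \<le> B" "Bp \<le> B" "B2 \<le> B" "B3 + B2 \<le> B"
    using nonneg \<open>0 \<le> B2\<close> \<open>0 \<le> B3\<close> by (auto simp: B_def)
  show ?thesis
  proof (rule that[of p q h B])
    show "\<bar>h z - h w\<bar> \<le> B * \<bar>z - w\<bar>" for z w
      using h_lip[of z w] mult_right_mono[OF B(4), of "\<bar>z - w\<bar>"] by linarith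
    show "\<bar>q z\<bar> \<le> B" "\<bar>h z\<bar> \<le> B" "\<bar>z * q z - p z\<bar> \<le> B" for z
      using Bq[of z] Bp[of z] h_bound[of z] B by linarith+
  qed (fact p(2) q(2) h_cont p_in q_in h_in)+
qed
section \<open>Equidistant grids\<close>

text \<open>With \<open>Suc n\<close> cells instead of \<open>n\<close>, the mesh is positive for every \<open>n\<close>. Rounding a time down gives the
  cell that contains it; rounding up gives a grid point at which the information up to a stopping
  time is available.\<close>

definition grid :: "real \<Rightarrow> real \<Rightarrow> nat \<Rightarrow> nat \<Rightarrow> real" where
  "grid t T n k = t + real k * (T - t) / real (Suc n)"

definition grid_down :: "real \<Rightarrow> real \<Rightarrow> nat \<Rightarrow> real \<Rightarrow> nat" where
  "grid_down t T n s = nat \<lfloor>(s - t) * real (Suc n) / (T - t)\<rfloor>"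

definition grid_up :: "real \<Rightarrow> real \<Rightarrow> nat \<Rightarrow> real \<Rightarrow> nat" where
  "grid_up t T n s = nat \<lceil>(s - t) * real (Suc n) / (T - t)\<rceil>"

lemma grid_0 [simp]: "grid t T n 0 = t"
  and grid_last [simp]: "grid t T n (Suc n) = T"
  by (simp_all add: grid_def del: of_nat_Suc)

lemma grid_Suc: "grid t T n (Suc k) = grid t T n k + (T - t) / real (Suc n)"
  by (simp add: grid_def distrib_right add_divide_distrib)

context
  fixes t T :: real assumes tT: "t < T"
begin

lemma grid_le_iff: "grid t T n k \<le> s \<longleftrightarrow> real k \<le> (s - t) * real (Suc n) / (T - t)"
  using tT by (simp add: grid_def field_simps del: of_nat_Suc)

lemma grid_less_iff: "grid t T n k < s \<longleftrightarrow> real k < (s - t) * real (Suc n) / (T - t)"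
  using tT by (simp add: grid_def field_simps del: of_nat_Suc)

lemma grid_mono_iff: "grid t T n j \<le> grid t T n k \<longleftrightarrow> j \<le> k"
  using tT by (simp add: grid_def divide_le_cancel del: of_nat_Suc)

lemma grid_strict_iff: "grid t T n j < grid t T n k \<longleftrightarrow> j < k"
  using tT by (simp add: grid_def divide_less_cancel del: of_nat_Suc)

lemma grid_ge: "t \<le> grid t T n k"
  using grid_mono_iff[of n 0 k] by simp

lemma grid_le_end: "k \<le> Suc n \<Longrightarrow> grid t T n k \<le> T"
  using grid_mono_iff[of n k "Suc n"] by simp

lemma grid_range: "k \<le> Suc n \<Longrightarrow> grid t T n k \<in> {t..T}"
  by (simp add: grid_ge grid_le_end)

lemma grid_down_iff:
  assumes "t \<le> s" shows "k \<le> grid_down t T n s \<longleftrightarrow> grid t T n k \<le> s"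
proof -
  have "0 \<le> (s - t) * real (Suc n) / (T - t)" using assms tT by simp
  then show ?thesis unfolding grid_le_iff grid_down_def
    by (simp add: le_nat_floor le_floor_iff nat_le_iff le_nat_iff del: of_nat_Suc)
qed

lemma grid_down_bounds:
  assumes "t \<le> s" shows "grid t T n (grid_down t T n s) \<le> s" "s < grid t T n (Suc (grid_down t T n s))"
  using grid_down_iff[OF assms, of "grid_down t T n s" n] grid_down_iff[OF assms, of "Suc (grid_down t T n s)" n] by auto

lemma grid_down_less: "t \<le> s \<Longrightarrow> s < T \<Longrightarrow> grid_down t T n s < Suc n"
  using grid_down_iff[of s "Suc n" n] by (simp add: not_le[symmetric])

lemma grid_up_iff: "k < grid_up t T n s \<longleftrightarrow> grid t T n k < s"
  unfolding grid_less_iff grid_up_def by (simp add: zless_nat_eq_int_zless less_ceiling_iff del: of_nat_Suc)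

lemma grid_up_le: "s \<le> T \<Longrightarrow> grid_up t T n s \<le> Suc n"
  using grid_up_iff[of "Suc n" n s] by (simp add: not_less[symmetric])

lemma grid_up_bounds:
  assumes "t \<le> s" shows "s \<le> grid t T n (grid_up t T n s)" "grid t T n (grid_up t T n s) \<le> s + (T - t) / real (Suc n)"
proof -
  show "s \<le> grid t T n (grid_up t T n s)"
    using grid_up_iff[of "grid_up t T n s" n s] by simp
  show "grid t T n (grid_up t T n s) \<le> s + (T - t) / real (Suc n)"
  proof (cases "grid_up t T n s")
    case 0
    have "0 \<le> (T - t) / real (Suc n)" using tT by simp
    then show ?thesis using 0 assms by (simp del: of_nat_Suc)
  next
    case (Suc j)
    then have "grid t T n j < s" using grid_up_iff[of j n s] by simp
    then show ?thesis unfolding Suc grid_Suc by simp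
  qed
qed

lemma grid_mesh_tendsto: "(\<lambda>n. (T - t) / real (Suc n)) \<longlonglongrightarrow> 0"
  using tendsto_mult[OF tendsto_const LIMSEQ_inverse_real_of_nat, of "T - t"] by (simp add: divide_inverse)

lemma grid_up_tendsto:
  assumes "t \<le> s" shows "(\<lambda>n. grid t T n (grid_up t T n s)) \<longlonglongrightarrow> s"
  by (rule tendsto_sandwich[where f = "\<lambda>_. s" and h = "\<lambda>n. s + (T - t) / real (Suc n)"])
     (use grid_up_bounds[OF assms] tendsto_add[OF tendsto_const grid_mesh_tendsto, of s] in simp_all)

lemma grid_down_tendsto:
  assumes "t \<le> s"
  shows "(\<lambda>n. grid t T n (grid_down t T n s)) \<longlonglongrightarrow> s"
    and "(\<lambda>n. grid t T n (Suc (grid_down t T n s))) \<longlonglongrightarrow> s"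
proof -
  have *: "s - (T - t) / real (Suc n) \<le> grid t T n (grid_down t T n s)"
    "grid t T n (Suc (grid_down t T n s)) \<le> s + (T - t) / real (Suc n)" for n
    using grid_down_bounds[OF assms, of n] unfolding grid_Suc by linarith+
  show "(\<lambda>n. grid t T n (grid_down t T n s)) \<longlonglongrightarrow> s"
    by (rule tendsto_sandwich[where f = "\<lambda>n. s - (T - t) / real (Suc n)" and h = "\<lambda>_. s"])
       (use grid_down_bounds(1)[OF assms] *(1) tendsto_diff[OF tendsto_const grid_mesh_tendsto, of s]
         in \<open>simp_all del: of_nat_Suc\<close>)
  show "(\<lambda>n. grid t T n (Suc (grid_down t T n s))) \<longlonglongrightarrow> s"
    by (rule tendsto_sandwich[where f = "\<lambda>_. s" and h = "\<lambda>n. s + (T - t) / real (Suc n)"])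
       (use grid_down_bounds(2)[OF assms] *(2) tendsto_add[OF tendsto_const grid_mesh_tendsto, of s]
         in \<open>simp_all add: less_imp_le del: of_nat_Suc\<close>)
qed

text \<open>A process stopped at the grid point above \<open>s\<close>, written as a sum in which the \<open>k\<close>-th summand only asks
  whether \<open>s\<close> exceeds the \<open>k\<close>-th grid point. If \<open>s\<close> is a stopping time, this indicator is measurable at
  the left end of the cell.\<close>

lemma grid_telescope:
  fixes a :: "nat \<Rightarrow> real"
  assumes "s \<le> T"
  shows "(\<Sum>k<Suc n. of_bool (grid t T n k < s) * (a (Suc k) - a k)) = a (grid_up t T n s) - a 0"
proof -
  define j where "j = grid_up t T n s"
  have "(\<Sum>k<Suc n. of_bool (grid t T n k < s) * (a (Suc k) - a k)) = (\<Sum>k<j. a (Suc k) - a k)"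
    using grid_up_le[OF assms, of n] unfolding j_def grid_up_iff[symmetric]
    by (intro sum.mono_neutral_cong_right) auto
  then show ?thesis by (simp add: sum_lessThan_telescope j_def)
qed

lemma grid_disjoint: "s \<in> {grid t T n j..<grid t T n (Suc j)} \<Longrightarrow> s \<in> {grid t T n k..<grid t T n (Suc k)} \<Longrightarrow> j = k"
  using grid_strict_iff[of n j "Suc k"] grid_strict_iff[of n k "Suc j"] by force

end

section \<open>Hitting times and stopping times\<close>

text \<open>The value at a random time is the limit of the values at the grid points above it.\<close>

lemma measurable_process_at_random_time:
  fixes Y :: "real \<Rightarrow> 'a \<Rightarrow> real"
  assumes tT: "t < T" and Y: "\<And>s. s \<in> {t..T} \<Longrightarrow> Y s \<in> borel_measurable M"
    and cont: "\<And>\<omega>. \<omega> \<in> space M \<Longrightarrow> continuous_on {t..T} (\<lambda>s. Y s \<omega>)"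
    and tau: "\<tau> \<in> borel_measurable M" "\<And>\<omega>. \<omega> \<in> space M \<Longrightarrow> \<tau> \<omega> \<in> {t..T}"
  shows "(\<lambda>\<omega>. Y (\<tau> \<omega>) \<omega>) \<in> borel_measurable M"
proof (rule borel_measurable_LIMSEQ_real)
  fix \<omega> assume \<omega>: "\<omega> \<in> space M"
  have "(\<lambda>n. Y (grid t T n (grid_up t T n (\<tau> \<omega>))) \<omega>) \<longlonglongrightarrow> Y (\<tau> \<omega>) \<omega>"
    by (rule continuous_on_tendsto_compose[OF cont[OF \<omega>]])
       (use tau(2)[OF \<omega>] grid_up_tendsto[OF tT] grid_range[OF tT grid_up_le[OF tT]] in auto)
  moreover have "Y t \<omega> + (\<Sum>k<Suc n. of_bool (grid t T n k < \<tau> \<omega>) *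
      (Y (grid t T n (Suc k)) \<omega> - Y (grid t T n k) \<omega>)) = Y (grid t T n (grid_up t T n (\<tau> \<omega>))) \<omega>" for n
    using grid_telescope[OF tT, of "\<tau> \<omega>" n "\<lambda>k. Y (grid t T n k) \<omega>"] tau(2)[OF \<omega>] by simp
  ultimately show "(\<lambda>n. Y t \<omega> + (\<Sum>k<Suc n. of_bool (grid t T n k < \<tau> \<omega>) *
      (Y (grid t T n (Suc k)) \<omega> - Y (grid t T n k) \<omega>))) \<longlonglongrightarrow> Y (\<tau> \<omega>) \<omega>"
    by (simp only:)
next
  fix n
  have [measurable]: "Y (grid t T n k) \<in> borel_measurable M" if "k \<le> Suc n" for k
    using Y grid_range[OF tT that] by blast
  have "Y t \<in> borel_measurable M" using Y tT by auto
  then show "(\<lambda>\<omega>. Y t \<omega> + (\<Sum>k<Suc n. of_bool (grid t T n k < \<tau> \<omega>) *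
      (Y (grid t T n (Suc k)) \<omega> - Y (grid t T n k) \<omega>))) \<in> borel_measurable M"
    using tau(1) by (intro borel_measurable_add borel_measurable_sum borel_measurable_times borel_measurable_diff) auto
qed

text \<open>The time at which \<open>Y\<close> enters \<open>[0, \<infinity>)\<close>, set to 1 if this does not happen before time 1.\<close>

definition hitting_time :: "(real \<Rightarrow> 'a \<Rightarrow> real) \<Rightarrow> real \<Rightarrow> 'a \<Rightarrow> real" where
  "hitting_time Y t \<omega> = Inf (insert 1 {s \<in> {t..1}. 0 \<le> Y s \<omega>})"

lemma hitting_time_range: "t \<le> 1 \<Longrightarrow> hitting_time Y t \<omega> \<in> {t..1}"
proof -
  assume t: "t \<le> 1"
  have "t \<le> Inf (insert 1 {s \<in> {t..1}. 0 \<le> Y s \<omega>})" by (rule cInf_greatest) (use t in auto)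
  moreover have "Inf (insert 1 {s \<in> {t..1}. 0 \<le> Y s \<omega>}) \<le> 1"
    by (rule cInf_lower) (use t in \<open>auto intro!: bdd_belowI[of _ t]\<close>)
  ultimately show ?thesis by (simp add: hitting_time_def)
qed

lemma before_hitting_time:
  assumes "t \<le> s" "s < hitting_time Y t \<omega>" "t \<le> 1" shows "Y s \<omega> < 0"
proof (rule ccontr)
  assume "\<not> Y s \<omega> < 0"
  moreover have "s \<le> 1" using hitting_time_range[OF assms(3), of Y \<omega>] assms by simp
  ultimately have "hitting_time Y t \<omega> \<le> s"
    unfolding hitting_time_def using assms by (intro cInf_lower bdd_belowI[of _ t]) auto
  then show False using assms by simp
qed

lemma at_hitting_time:
  assumes "continuous_on {t..1} (\<lambda>s. Y s \<omega>)" "t \<le> 1" "hitting_time Y t \<omega> < 1"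
  shows "0 \<le> Y (hitting_time Y t \<omega>) \<omega>"
proof -
  have "closed ({t..1} \<inter> (\<lambda>s. Y s \<omega>) -` {0..})"
    using assms(1) by (intro continuous_closed_preimage) auto
  moreover have "{t..1} \<inter> (\<lambda>s. Y s \<omega>) -` {0..} = {s \<in> {t..1}. 0 \<le> Y s \<omega>}" by auto
  ultimately have "hitting_time Y t \<omega> \<in> insert 1 {s \<in> {t..1}. 0 \<le> Y s \<omega>}"
    unfolding hitting_time_def using assms(2) by (intro closed_contains_Inf closed_insert bdd_belowI[of _ t]) auto
  then show ?thesis using assms by auto
qed

text \<open>Countably many conditions decide whether a continuous function reaches \<open>[0, \<infinity>)\<close> on \<open>[t, s]\<close>: by
  compactness it is enough to come close to this closed set. Rational proportions of the interval are
  used, rather than rational times, because \<open>[t, s]\<close> may be a single point.\<close>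

lemma rational_parameter_dense:
  fixes f :: "real \<Rightarrow> real"
  assumes "t \<le> s" "continuous_on {t..s} f"
  shows "(\<exists>r\<in>{t..s}. 0 \<le> f r) \<longleftrightarrow> (\<forall>n. \<exists>u\<in>\<rat> \<inter> {0..1}. - 1 / real (Suc n) < f (t + (s - t) * u))"
proof
  assume "\<exists>r\<in>{t..s}. 0 \<le> f r"
  then obtain r where r: "r \<in> {t..s}" "0 \<le> f r" by blast
  show "\<forall>n. \<exists>u\<in>\<rat> \<inter> {0..1}. - 1 / real (Suc n) < f (t + (s - t) * u)"
  proof
    fix n
    define e where "e = 1 / real (Suc n)"
    have "0 < e" by (simp add: e_def)
    then obtain d where d: "0 < d" "\<And>y. y \<in> {t..s} \<Longrightarrow> dist y r < d \<Longrightarrow> dist (f y) (f r) < e"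
      using assms(2) r(1) unfolding continuous_on_iff by blast
    have "\<exists>u\<in>\<rat> \<inter> {0..1}. \<bar>t + (s - t) * u - r\<bar> < d"
    proof (cases "s = t")
      case True then show ?thesis using d r by (intro bexI[of _ 0]) auto
    next
      case False
      then have st: "t < s" using assms by simp
      define v where "v = (r - t) / (s - t)"
      have v: "0 \<le> v" "v \<le> 1" "r = t + (s - t) * v" using r st by (auto simp: v_def)
      define c where "c = d / (s - t)"
      have c: "0 < c" using d st by (simp add: c_def)
      have "max 0 (v - c) < min 1 (v + c)" using v c by auto
      then obtain u where u: "u \<in> \<rat>" "max 0 (v - c) < u" "u < min 1 (v + c)"
        using Rats_dense_in_real by blast
      then have "\<bar>u - v\<bar> < c" by auto
      then have "\<bar>(s - t) * (u - v)\<bar> < d"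
        using st mult_strict_left_mono[of "\<bar>u - v\<bar>" c "s - t"] by (simp add: abs_mult c_def)
      then show ?thesis using u v by (intro bexI[of _ u]) (auto simp: algebra_simps)
    qed
    then obtain u where u: "u \<in> \<rat> \<inter> {0..1}" "\<bar>t + (s - t) * u - r\<bar> < d" by blast
    have "(s - t) * u \<le> s - t" "0 \<le> (s - t) * u" using u assms by (auto intro: mult_left_le)
    then have "\<bar>f (t + (s - t) * u) - f r\<bar> < e" using d(2)[of "t + (s - t) * u"] u by (auto simp: dist_real_def)
    then have "- e < f (t + (s - t) * u)" using r by linarith
    then show "\<exists>u\<in>\<rat> \<inter> {0..1}. - 1 / real (Suc n) < f (t + (s - t) * u)"
      using u(1) unfolding e_def by auto
  qed
next
  assume *: "\<forall>n. \<exists>u\<in>\<rat> \<inter> {0..1}. - 1 / real (Suc n) < f (t + (s - t) * u)"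
  obtain r where r: "r \<in> {t..s}" "\<And>y. y \<in> {t..s} \<Longrightarrow> f y \<le> f r"
    using continuous_attains_sup[of "{t..s}" f] assms by auto
  have "- 1 / real (Suc n) \<le> f r" for n
  proof -
    obtain u where u: "u \<in> \<rat> \<inter> {0..1}" "- 1 / real (Suc n) < f (t + (s - t) * u)" using * by blast
    have "(s - t) * u \<le> s - t" "0 \<le> (s - t) * u" using u assms by (auto intro: mult_left_le)
    then show ?thesis using r(2)[of "t + (s - t) * u"] u by simp
  qed
  moreover have "(\<lambda>n. - 1 / real (Suc n)) \<longlonglongrightarrow> 0"
    using tendsto_minus[OF LIMSEQ_inverse_real_of_nat] by (simp add: divide_inverse)
  ultimately have "0 \<le> f r" by (intro LIMSEQ_le_const2) auto
  then show "\<exists>r\<in>{t..s}. 0 \<le> f r" using r by blast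
qed

context filtered_brownian_motion begin

lemma measurable_F_le:
  assumes "r \<le> s" "f \<in> borel_measurable (F r)" shows "f \<in> borel_measurable (F s)"
proof (rule measurable_from_subalg[OF _ assms(2)])
  show "subalgebra (F s) (F r)"
    unfolding subalgebra_def space_F using sets_F_mono[OF assms(1)] by simp
qed

lemma measurable_F_M: "0 \<le> s \<Longrightarrow> f \<in> borel_measurable (F s) \<Longrightarrow> f \<in> borel_measurable M"
  by (rule measurable_from_subalg[OF subalgebra_F])

text \<open>The hitting time of a closed set by a continuous path belongs to the set of times at which the path
  is in it. So the event that it is at most \<open>s\<close> depends on the path on \<open>[t, s]\<close> only.\<close>

lemma stopping_time_hitting_time:
  assumes t: "t \<le> 1" and Y: "\<And>s. s \<in> {t..1} \<Longrightarrow> Y s \<in> borel_measurable (F s)"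
    and cont: "\<And>\<omega>. \<omega> \<in> space M \<Longrightarrow> continuous_on {t..1} (\<lambda>s. Y s \<omega>)"
  shows "stopping_time F (hitting_time Y t)"
proof (rule stopping_timeI)
  fix s :: real
  consider "s < t" | "1 \<le> s" | "t \<le> s" "s < 1" by linarith
  then show "Measurable.pred (F s) (\<lambda>\<omega>. hitting_time Y t \<omega> \<le> s)"
  proof cases
    case 1
    then have "\<not> hitting_time Y t \<omega> \<le> s" for \<omega> using hitting_time_range[OF t, of Y \<omega>] by simp
    then show ?thesis by simp
  next
    case 2
    then have "hitting_time Y t \<omega> \<le> s" for \<omega> using hitting_time_range[OF t, of Y \<omega>] by simp
    then show ?thesis by simp
  next
    case 3
    have eq: "hitting_time Y t \<omega> \<le> s \<longleftrightarrow> (\<forall>n. \<exists>u\<in>\<rat> \<inter> {0..1}. - 1 / real (Suc n) < Y (t + (s - t) * u) \<omega>)"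
      if \<omega>: "\<omega> \<in> space M" for \<omega>
    proof -
      have "hitting_time Y t \<omega> \<le> s \<longleftrightarrow> (\<exists>r\<in>{t..s}. 0 \<le> Y r \<omega>)"
      proof
        assume "hitting_time Y t \<omega> \<le> s"
        then show "\<exists>r\<in>{t..s}. 0 \<le> Y r \<omega>"
          using at_hitting_time[of t Y \<omega>, OF cont[OF \<omega>] t] hitting_time_range[OF t, of Y \<omega>] 3
          by (intro bexI[of _ "hitting_time Y t \<omega>"]) auto
      next
        assume "\<exists>r\<in>{t..s}. 0 \<le> Y r \<omega>"
        then obtain r where r: "t \<le> r" "r \<le> s" "0 \<le> Y r \<omega>" by auto
        then have "\<not> r < hitting_time Y t \<omega>" using before_hitting_time[of t r Y \<omega>] t by auto
        then show "hitting_time Y t \<omega> \<le> s" using r by simp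
      qed
      also have "\<dots> \<longleftrightarrow> (\<forall>n. \<exists>u\<in>\<rat> \<inter> {0..1}. - 1 / real (Suc n) < Y (t + (s - t) * u) \<omega>)"
        using 3 by (intro rational_parameter_dense continuous_on_subset[OF cont[OF \<omega>]]) auto
      finally show ?thesis .
    qed
    have m: "Y (t + (s - t) * u) \<in> borel_measurable (F s)" if "u \<in> \<rat> \<inter> {0..1}" for u
    proof -
      have "(s - t) * u \<le> s - t" "0 \<le> (s - t) * u" using that 3 by (auto intro: mult_left_le)
      then show ?thesis using 3 by (intro measurable_F_le[OF _ Y]) auto
    qed
    have "countable (\<rat> \<inter> {0..1} :: real set)" using countable_rat by (rule countable_Int1)
    then have "Measurable.pred (F s) (\<lambda>\<omega>. \<forall>n. \<exists>u\<in>\<rat> \<inter> {0..1}. - 1 / real (Suc n) < Y (t + (s - t) * u) \<omega>)"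
    proof (intro pred_intros_countable(1))
      fix n :: nat
      have "{\<omega> \<in> space (F s). \<exists>u\<in>\<rat> \<inter> {0..1}. - 1 / real (Suc n) < Y (t + (s - t) * u) \<omega>} \<in> sets (F s)"
      proof (rule sets.sets_Collect_countable_Ex')
        fix u :: real assume "u \<in> \<rat> \<inter> {0..1}"
        from m[OF this] show "{\<omega> \<in> space (F s). - 1 / real (Suc n) < Y (t + (s - t) * u) \<omega>} \<in> sets (F s)"
          by (intro borel_measurable_less) auto
      qed fact
      then show "Measurable.pred (F s) (\<lambda>\<omega>. \<exists>u\<in>\<rat> \<inter> {0..1}. - 1 / real (Suc n) < Y (t + (s - t) * u) \<omega>)"
        by (simp add: pred_def)
    qed
    moreover have "Measurable.pred (F s) (\<lambda>\<omega>. hitting_time Y t \<omega> \<le> s) \<longleftrightarrow>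
        Measurable.pred (F s) (\<lambda>\<omega>. \<forall>n. \<exists>u\<in>\<rat> \<inter> {0..1}. - 1 / real (Suc n) < Y (t + (s - t) * u) \<omega>)"
      by (rule measurable_cong, rule eq) (simp only: space_F)
    ultimately show ?thesis by blast
  qed
qed

lemma stopping_time_measurable:
  assumes "stopping_time F \<tau>" "\<And>\<omega>. \<omega> \<in> space M \<Longrightarrow> 0 \<le> \<tau> \<omega>"
  shows "\<tau> \<in> borel_measurable M"
proof (rule borel_measurableI_le)
  fix a
  show "{\<omega> \<in> space M. \<tau> \<omega> \<le> a} \<in> sets M"
  proof (cases "0 \<le> a")
    case True
    have "Measurable.pred (F a) (\<lambda>\<omega>. \<tau> \<omega> \<le> a)" using stopping_timeD[OF assms(1)] .
    then have "{\<omega> \<in> space M. \<tau> \<omega> \<le> a} \<in> sets (F a)" by (simp add: pred_def space_F)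
    then show ?thesis using subalgebra_F[OF True] by (auto simp: subalgebra_def)
  next
    case False
    have "\<not> \<tau> \<omega> \<le> a" if "\<omega> \<in> space M" for \<omega> using assms(2)[OF that] False by linarith
    then have "{\<omega> \<in> space M. \<tau> \<omega> \<le> a} = {}" by blast
    then show ?thesis by (simp only: sets.empty_sets)
  qed
qed

lemma stopping_time_indicator:
  assumes "stopping_time F \<tau>"
  shows "(\<lambda>\<omega>. of_bool (s < \<tau> \<omega>) :: real) \<in> borel_measurable (F s)"
proof -
  have "Measurable.pred (F s) (\<lambda>\<omega>. \<tau> \<omega> \<le> s)" using stopping_timeD[OF assms] .
  then have "Measurable.pred (F s) (\<lambda>\<omega>. \<not> \<tau> \<omega> \<le> s)" by (rule pred_intros_logic)
  then show ?thesis unfolding not_le by measurable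
qed

end

section \<open>Brownian increments and maximal inequality\<close>

context filtered_brownian_motion begin

context
  fixes r s :: real assumes rs: "0 \<le> r" "r < s"
begin

lemma indep_increment:
  assumes "Y \<in> borel_measurable (F r)"
  shows "indep_var borel Y borel (\<lambda>\<omega>. W s \<omega> - W r \<omega>)"
proof -
  let ?D = "\<lambda>\<omega>. W s \<omega> - W r \<omega>"
  let ?B = "{?D -` A \<inter> space M |A. A \<in> sets borel}"
  have meas: "Y \<in> borel_measurable M" "?D \<in> borel_measurable M"
    using measurable_F_M[OF _ assms] measurable_F_M[OF _ adapted_W[of s]] measurable_F_M[OF _ adapted_W[of r]] rs
    by auto
  have "Int_stable ?B"
  proof (rule Int_stableI)
    fix a b assume "a \<in> ?B" "b \<in> ?B"
    then obtain A A' where A: "A \<in> sets borel" "A' \<in> sets borel" "a = ?D -` A \<inter> space M" "b = ?D -` A' \<inter> space M" by blast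
    have "a \<inter> b = ?D -` (A \<inter> A') \<inter> space M" using A by auto
    then show "a \<inter> b \<in> ?B" using A by blast
  qed
  then have "indep_set (sigma_sets (space M) (sets (F r))) (sigma_sets (space M) ?B)"
    by (intro indep_set_sigma_sets[OF W_indep[OF rs]] sets.Int_stable)
  moreover have "sigma_sets (space M) {Y -` A \<inter> space M |A. A \<in> sets borel} \<subseteq> sigma_sets (space M) (sets (F r))"
    using assms by (intro sigma_sets_mono') (auto simp: measurable_def space_F)
  ultimately show ?thesis
    unfolding indep_var_eq indep_set_def using meas
    by (intro conjI, simp_all, elim indep_sets_mono_sets) (auto split: bool.splits)
qed

lemma indep_increment_mult:
  fixes Y :: "'a \<Rightarrow> real" and g :: "real \<Rightarrow> real"
  assumes "Y \<in> borel_measurable (F r)" "integrable M Y"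
    and g: "g \<in> borel_measurable borel" "integrable M (\<lambda>\<omega>. g (W s \<omega> - W r \<omega>))"
  shows "integrable M (\<lambda>\<omega>. Y \<omega> * g (W s \<omega> - W r \<omega>))"
    and "expectation (\<lambda>\<omega>. Y \<omega> * g (W s \<omega> - W r \<omega>)) = expectation Y * expectation (\<lambda>\<omega>. g (W s \<omega> - W r \<omega>))"
proof -
  have "indep_var borel ((\<lambda>x. x) \<circ> Y) borel (g \<circ> (\<lambda>\<omega>. W s \<omega> - W r \<omega>))"
    by (rule indep_var_compose[OF indep_increment[OF assms(1)]]) (use g in auto)
  then have "indep_var borel Y borel (\<lambda>\<omega>. g (W s \<omega> - W r \<omega>))" by (simp add: comp_def)
  then show "integrable M (\<lambda>\<omega>. Y \<omega> * g (W s \<omega> - W r \<omega>))"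
    "expectation (\<lambda>\<omega>. Y \<omega> * g (W s \<omega> - W r \<omega>)) = expectation Y * expectation (\<lambda>\<omega>. g (W s \<omega> - W r \<omega>))"
    using assms by (auto intro: indep_var_integrable indep_var_lebesgue_integral)
qed

lemma increment_integral:
  fixes g :: "real \<Rightarrow> real"
  assumes "g \<in> borel_measurable borel" "has_bochner_integral lborel (\<lambda>x. normal_density 0 (sqrt (s - r)) x * g x) c"
  shows "integrable M (\<lambda>\<omega>. g (W s \<omega> - W r \<omega>))" "expectation (\<lambda>\<omega>. g (W s \<omega> - W r \<omega>)) = c"
  using distributed_integrable[OF W_normal[OF rs], of g] distributed_integral[OF W_normal[OF rs], of g] assms
  by (auto simp: has_bochner_integral_iff)

lemma increment_moments:
  shows increment_integrable: "integrable M (\<lambda>\<omega>. W s \<omega> - W r \<omega>)"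
    and increment_mean: "expectation (\<lambda>\<omega>. W s \<omega> - W r \<omega>) = 0"
    and increment_square_integrable: "integrable M (\<lambda>\<omega>. (W s \<omega> - W r \<omega>)\<^sup>2)"
    and increment_square: "expectation (\<lambda>\<omega>. (W s \<omega> - W r \<omega>)\<^sup>2) = s - r"
    and increment_cube_integrable: "integrable M (\<lambda>\<omega>. \<bar>W s \<omega> - W r \<omega>\<bar> ^ 3)"
    and increment_cube: "expectation (\<lambda>\<omega>. \<bar>W s \<omega> - W r \<omega>\<bar> ^ 3) \<le> 2 * (s - r) * sqrt (s - r)"
proof -
  have sd: "0 < sqrt (s - r)" using rs by simp
  have "has_bochner_integral lborel (\<lambda>x. normal_density 0 (sqrt (s - r)) x * x) 0"
    using normal_moment_odd[OF sd, of 0 0] by simp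
  from increment_integral[OF _ this]
  show "integrable M (\<lambda>\<omega>. W s \<omega> - W r \<omega>)" "expectation (\<lambda>\<omega>. W s \<omega> - W r \<omega>) = 0" by simp_all
  have "has_bochner_integral lborel (\<lambda>x. normal_density 0 (sqrt (s - r)) x * x\<^sup>2) (s - r)"
    using normal_moment_even[OF sd, of 0 1] rs by (simp add: diff_divide_distrib)
  from increment_integral[OF _ this]
  show "integrable M (\<lambda>\<omega>. (W s \<omega> - W r \<omega>)\<^sup>2)" "expectation (\<lambda>\<omega>. (W s \<omega> - W r \<omega>)\<^sup>2) = s - r" by simp_all
  have "has_bochner_integral lborel (\<lambda>x. normal_density 0 (sqrt (s - r)) x * \<bar>x\<bar> ^ 3) (2 * sqrt (s - r) ^ 3 * sqrt (2 / pi))"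
    using normal_moment_abs_odd[OF sd, of 0 1] by simp
  note * = increment_integral[OF _ this]
  show "integrable M (\<lambda>\<omega>. \<bar>W s \<omega> - W r \<omega>\<bar> ^ 3)" using * by simp
  have "sqrt (2 / pi) \<le> 1" using pi_gt3 by simp
  moreover have "sqrt (s - r) ^ 3 = (s - r) * sqrt (s - r)" using rs by (simp add: power3_eq_cube)
  moreover have "expectation (\<lambda>\<omega>. \<bar>W s \<omega> - W r \<omega>\<bar> ^ 3) = 2 * sqrt (s - r) ^ 3 * sqrt (2 / pi)"
    using * by simp
  ultimately show "expectation (\<lambda>\<omega>. \<bar>W s \<omega> - W r \<omega>\<bar> ^ 3) \<le> 2 * (s - r) * sqrt (s - r)"
    using mult_left_le[of "sqrt (2 / pi)" "2 * (s - r) * sqrt (s - r)"] rs by (simp only: mult.assoc) simp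
qed

end

end

primrec running_max :: "(nat \<Rightarrow> real) \<Rightarrow> nat \<Rightarrow> real" where
  "running_max a 0 = \<bar>a 0\<bar>"
| "running_max a (Suc n) = max (running_max a n) \<bar>a (Suc n)\<bar>"

lemma running_max_ge: "k \<le> n \<Longrightarrow> \<bar>a k\<bar> \<le> running_max a n"
proof (induction n)
  case (Suc n)
  then show ?case by (cases "k = Suc n") (auto simp: le_Suc_eq le_max_iff_disj)
qed simp

lemma running_max_nonneg: "0 \<le> running_max a n"
  using running_max_ge[of 0 n a] by simp

lemma running_max_square_le: "(running_max a n)\<^sup>2 \<le> (\<Sum>k\<le>n. (a k)\<^sup>2)"
proof (induction n)
  case (Suc n)
  have "0 \<le> (\<Sum>k\<le>n. (a k)\<^sup>2)" by (intro sum_nonneg) auto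
  then show ?case using Suc by (simp add: max_def add_increasing2)
qed simp

text \<open>Summation by parts. The maximum only grows at indices where it equals \<open>|a|\<close>, hence
  \<open>S\<^sup>2 - R\<^sup>2 \<le> 2 |a| (S - R)\<close> for consecutive maxima \<open>R \<le> S\<close>.\<close>

lemma running_max_summation:
  "(running_max a n)\<^sup>2 + 2 * (\<Sum>k<n. running_max a k * (\<bar>a (Suc k)\<bar> - \<bar>a k\<bar>)) \<le> 2 * running_max a n * \<bar>a n\<bar>"
proof (induction n)
  case 0 show ?case using zero_le_square[of "a 0"] by (simp add: power2_eq_square mult.assoc)
next
  case (Suc n)
  have "(running_max a (Suc n))\<^sup>2 - (running_max a n)\<^sup>2 \<le> 2 * \<bar>a (Suc n)\<bar> * (running_max a (Suc n) - running_max a n)"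
  proof (cases "running_max a n \<le> \<bar>a (Suc n)\<bar>")
    case True
    have "0 \<le> (\<bar>a (Suc n)\<bar> - running_max a n)\<^sup>2" by simp
    then show ?thesis using True by (simp add: max_def power2_eq_square algebra_simps)
  qed simp
  then show ?case using Suc by (simp add: algebra_simps del: running_max.simps(2))
qed

text \<open>A pathwise form of Doob's inequality in the square mean: if \<open>a\<close> is a martingale, then the sum on
  the right has expectation zero, because the coefficient of each increment is known beforehand.\<close>

lemma running_max_doob:
  "(running_max a n)\<^sup>2 \<le> 4 * (a n)\<^sup>2 - 4 * (\<Sum>k<n. running_max a k * sgn (a k) * (a (Suc k) - a k))"
proof -
  have "(\<Sum>k<n. running_max a k * sgn (a k) * (a (Suc k) - a k)) \<le> (\<Sum>k<n. running_max a k * (\<bar>a (Suc k)\<bar> - \<bar>a k\<bar>))"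
  proof (rule sum_mono)
    fix k
    have "sgn (a k) * (a (Suc k) - a k) \<le> \<bar>a (Suc k)\<bar> - \<bar>a k\<bar>"
      by (auto simp: sgn_if abs_if)
    then show "running_max a k * sgn (a k) * (a (Suc k) - a k) \<le> running_max a k * (\<bar>a (Suc k)\<bar> - \<bar>a k\<bar>)"
      using running_max_nonneg[of a k] by (simp add: mult.assoc mult_left_mono)
  qed
  moreover have "2 * (2 * running_max a n * \<bar>a n\<bar>) \<le> (running_max a n)\<^sup>2 + 4 * (a n)\<^sup>2"
  proof -
    have "0 \<le> (running_max a n - 2 * \<bar>a n\<bar>)\<^sup>2" by simp
    then show ?thesis by (simp add: power2_diff power_mult_distrib)
  qed
  ultimately show ?thesis using running_max_summation[of a n] by linarith
qed

lemma abs_le_one_plus_square: "\<bar>w\<bar> \<le> 1 + w\<^sup>2" for w :: real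
proof -
  have "0 \<le> (\<bar>w\<bar> - 1 / 2)\<^sup>2" by simp
  also have "\<dots> = w\<^sup>2 - \<bar>w\<bar> + 1 / 4" by (simp add: power2_diff power_divide)
  finally show ?thesis by simp
qed

lemma borel_measurable_running_max:
  "(\<And>k. k \<le> n \<Longrightarrow> S k \<in> borel_measurable M) \<Longrightarrow> (\<lambda>\<omega>. running_max (\<lambda>k. S k \<omega>) n) \<in> borel_measurable M"
  by (induction n) auto

context filtered_brownian_motion begin

text \<open>Taking expectations in the pathwise inequality, the increments have mean zero and are independent
  of their coefficients.\<close>

lemma doob_square_inequality:
  assumes g: "0 \<le> g 0" "\<And>k. g k < g (Suc k)"
  defines "S k \<omega> \<equiv> W (g k) \<omega> - W (g 0) \<omega>"
  shows "integrable M (\<lambda>\<omega>. (running_max (\<lambda>k. S k \<omega>) n)\<^sup>2)"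
    and "expectation (\<lambda>\<omega>. (running_max (\<lambda>k. S k \<omega>) n)\<^sup>2) \<le> 4 * (g n - g 0)"
proof -
  have g_mono: "g j \<le> g k" if "j \<le> k" for j k
    using lift_Suc_mono_le[of g j k] g(2) that by (simp add: less_imp_le)
  have g_nonneg: "0 \<le> g k" for k using g_mono[of 0 k] g(1) by simp
  have S_F: "S j \<in> borel_measurable (F (g k))" if "j \<le> k" for j k
    unfolding S_def[abs_def]
    by (intro borel_measurable_diff measurable_F_le[OF g_mono adapted_W] that g_nonneg) simp
  have S_M: "S k \<in> borel_measurable M" for k
    using measurable_F_M[OF g_nonneg S_F[OF order_refl]] .
  have S_sq: "integrable M (\<lambda>\<omega>. (S k \<omega>)\<^sup>2)" "expectation (\<lambda>\<omega>. (S k \<omega>)\<^sup>2) = g k - g 0" for k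
  proof -
    have "integrable M (\<lambda>\<omega>. (S k \<omega>)\<^sup>2) \<and> expectation (\<lambda>\<omega>. (S k \<omega>)\<^sup>2) = g k - g 0"
    proof (cases k)
      case 0 then show ?thesis by (simp add: S_def)
    next
      case (Suc j)
      then have "g 0 < g k" using g_mono[of 0 j] g(2)[of j] by simp
      then show ?thesis
        unfolding S_def using increment_square_integrable[OF g(1)] increment_square[OF g(1)] by blast
    qed
    then show "integrable M (\<lambda>\<omega>. (S k \<omega>)\<^sup>2)" "expectation (\<lambda>\<omega>. (S k \<omega>)\<^sup>2) = g k - g 0" by auto
  qed
  define R where "R k \<omega> = running_max (\<lambda>k. S k \<omega>) k" for k \<omega>
  have R_F: "R k \<in> borel_measurable (F (g k))" for k
    unfolding R_def[abs_def] by (intro borel_measurable_running_max S_F)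
  have R_M: "R k \<in> borel_measurable M" for k
    using measurable_F_M[OF g_nonneg R_F] .
  have R_sq: "integrable M (\<lambda>\<omega>. (R k \<omega>)\<^sup>2)" for k
  proof (rule Bochner_Integration.integrable_bound)
    show "integrable M (\<lambda>\<omega>. \<Sum>j\<le>k. (S j \<omega>)\<^sup>2)" using S_sq by auto
    show "AE \<omega> in M. norm ((R k \<omega>)\<^sup>2) \<le> norm (\<Sum>j\<le>k. (S j \<omega>)\<^sup>2)"
      unfolding R_def by (intro AE_I2) (auto intro!: running_max_square_le order_trans[OF _ abs_ge_self])
  qed (use R_M in measurable)
  have Y: "(\<lambda>\<omega>. R k \<omega> * sgn (S k \<omega>)) \<in> borel_measurable (F (g k))" for k
    using R_F[of k] S_F[of k k] by measurable
  have Y_int: "integrable M (\<lambda>\<omega>. R k \<omega> * sgn (S k \<omega>))" for k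
  proof (rule Bochner_Integration.integrable_bound)
    show "integrable M (\<lambda>\<omega>. 1 + (R k \<omega>)\<^sup>2)" using R_sq by auto
    have "\<bar>R k \<omega>\<bar> \<le> 1 + (R k \<omega>)\<^sup>2" for \<omega>
      by (rule abs_le_one_plus_square)
    moreover have "\<bar>R k \<omega> * sgn (S k \<omega>)\<bar> \<le> \<bar>R k \<omega>\<bar>" for \<omega>
      by (simp add: abs_mult sgn_if)
    ultimately show "AE \<omega> in M. norm (R k \<omega> * sgn (S k \<omega>)) \<le> norm (1 + (R k \<omega>)\<^sup>2)"
      by (intro AE_I2) (auto intro: order_trans order_trans[OF _ abs_ge_self])
  qed (rule measurable_F_M[OF g_nonneg Y])
  have cross: "integrable M (\<lambda>\<omega>. R k \<omega> * sgn (S k \<omega>) * (S (Suc k) \<omega> - S k \<omega>))"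
    "expectation (\<lambda>\<omega>. R k \<omega> * sgn (S k \<omega>) * (S (Suc k) \<omega> - S k \<omega>)) = 0" for k
    using indep_increment_mult[OF g_nonneg g(2) Y Y_int, of "\<lambda>x. x"]
      increment_integrable[OF g_nonneg g(2)] increment_mean[OF g_nonneg g(2), of k]
    by (simp_all add: S_def)
  show "integrable M (\<lambda>\<omega>. (running_max (\<lambda>k. S k \<omega>) n)\<^sup>2)"
    using R_sq unfolding R_def .
  have "expectation (\<lambda>\<omega>. (R n \<omega>)\<^sup>2) \<le> expectation (\<lambda>\<omega>. 4 * (S n \<omega>)\<^sup>2 - 4 * (\<Sum>k<n. R k \<omega> * sgn (S k \<omega>) * (S (Suc k) \<omega> - S k \<omega>)))"
  proof (rule integral_mono)
    show "(R n \<omega>)\<^sup>2 \<le> 4 * (S n \<omega>)\<^sup>2 - 4 * (\<Sum>k<n. R k \<omega> * sgn (S k \<omega>) * (S (Suc k) \<omega> - S k \<omega>))" for \<omega>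
      unfolding R_def by (rule running_max_doob)
  qed (use R_sq S_sq cross in auto)
  also have "\<dots> = 4 * (g n - g 0)"
    using S_sq cross by (simp add: Bochner_Integration.integral_diff Bochner_Integration.integral_sum)
  finally show "expectation (\<lambda>\<omega>. (running_max (\<lambda>k. S k \<omega>) n)\<^sup>2) \<le> 4 * (g n - g 0)"
    unfolding R_def .
qed

text \<open>Doob's bound is uniform in the grid, and by continuity the deviation at any time is a limit of
  deviations at grid points. Fatou's lemma for the lower limit of the squared maxima gives an
  integrable bound; adding 1 turns the bound on the square into one on the absolute value.\<close>

lemma integrable_sup_bound:
  assumes tT: "0 \<le> t" "t < T"
  obtains Z where "integrable M Z" "\<And>\<omega>. 0 \<le> Z \<omega>"
    "AE \<omega> in M. \<forall>s\<in>{t..T}. \<bar>W s \<omega> - W t \<omega>\<bar> \<le> Z \<omega>"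
proof -
  define R where "R n \<omega> = (running_max (\<lambda>k. W (grid t T n k) \<omega> - W t \<omega>) (Suc n))\<^sup>2" for n \<omega>
  have R: "integrable M (R n)" "expectation (R n) \<le> 4 * (T - t)" for n
    using doob_square_inequality[of "grid t T n" "Suc n"] tT
    by (simp_all add: R_def[abs_def] grid_strict_iff del: running_max.simps)
  have R_nonneg: "0 \<le> R n \<omega>" for n \<omega> by (simp add: R_def)
  define L where "L \<omega> = liminf (\<lambda>n. ennreal (R n \<omega>))" for \<omega>
  have R_meas[measurable]: "R n \<in> borel_measurable M" for n using R(1) by (rule borel_measurable_integrable)
  have L_meas[measurable]: "L \<in> borel_measurable M" unfolding L_def by measurable
  have "(\<integral>\<^sup>+\<omega>. L \<omega> \<partial>M) \<le> liminf (\<lambda>n. \<integral>\<^sup>+\<omega>. ennreal (R n \<omega>) \<partial>M)"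
    unfolding L_def by (rule nn_integral_liminf) measurable
  also have "\<dots> \<le> liminf (\<lambda>n::nat. ennreal (4 * (T - t)))"
  proof (intro Liminf_mono always_eventually allI)
    show "(\<integral>\<^sup>+\<omega>. ennreal (R n \<omega>) \<partial>M) \<le> ennreal (4 * (T - t))" for n
      using R[of n] R_nonneg by (subst nn_integral_eq_integral) (auto intro: ennreal_leI)
  qed
  also have "\<dots> = ennreal (4 * (T - t))" by (simp add: Liminf_const)
  finally have L_fin: "(\<integral>\<^sup>+\<omega>. L \<omega> \<partial>M) < \<infinity>" by (rule le_less_trans) simp
  have L_AE: "AE \<omega> in M. L \<omega> \<noteq> \<infinity>"
    using L_fin by (intro nn_integral_noteq_infinite) auto
  have "integrable M (\<lambda>\<omega>. enn2real (L \<omega>))"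
  proof (rule integrableI_bounded)
    have "(\<integral>\<^sup>+\<omega>. ennreal (norm (enn2real (L \<omega>))) \<partial>M) \<le> (\<integral>\<^sup>+\<omega>. L \<omega> \<partial>M)"
      by (intro nn_integral_mono) (simp add: ennreal_enn2real_if)
    then show "(\<integral>\<^sup>+\<omega>. ennreal (norm (enn2real (L \<omega>))) \<partial>M) < \<infinity>" using L_fin by (rule le_less_trans)
  qed measurable
  then have "integrable M (\<lambda>\<omega>. 1 + enn2real (L \<omega>))" by auto
  moreover have "AE \<omega> in M. \<forall>s\<in>{t..T}. \<bar>W s \<omega> - W t \<omega>\<bar> \<le> 1 + enn2real (L \<omega>)"
    using L_AE W_continuous
  proof eventually_elim
    case (elim \<omega>)
    show ?case
    proof
      fix s assume s: "s \<in> {t..T}"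
      \<comment> \<open>The cell of the end point \<open>T\<close> lies outside the grid, while \<open>T\<close> itself is its last point.\<close>
      define k where "k n = (if s < T then grid_down t T n s else Suc n)" for n
      have k: "k n \<le> Suc n" for n
        using grid_down_less[OF tT(2), of s n] s by (auto simp: k_def)
      have "(\<lambda>n. grid t T n (k n)) \<longlonglongrightarrow> s"
        using grid_down_tendsto(1)[OF tT(2), of s] s by (cases "s < T") (auto simp: k_def)
      then have "(\<lambda>n. W (grid t T n (k n)) \<omega>) \<longlonglongrightarrow> W s \<omega>"
        by (rule continuous_on_tendsto_compose[OF elim(2)])
           (use s tT grid_ge[OF tT(2)] in \<open>auto intro!: always_eventually intro: order_trans\<close>)
      then have "(\<lambda>n. ennreal ((W (grid t T n (k n)) \<omega> - W t \<omega>)\<^sup>2)) \<longlonglongrightarrow> ennreal ((W s \<omega> - W t \<omega>)\<^sup>2)"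
        by (intro tendsto_ennrealI tendsto_intros)
      then have "ennreal ((W s \<omega> - W t \<omega>)\<^sup>2) = liminf (\<lambda>n. ennreal ((W (grid t T n (k n)) \<omega> - W t \<omega>)\<^sup>2))"
        by (intro lim_imp_Liminf[symmetric]) auto
      also have "\<dots> \<le> L \<omega>"
        unfolding L_def
      proof (intro Liminf_mono always_eventually allI ennreal_leI)
        fix n
        have "\<bar>W (grid t T n (k n)) \<omega> - W t \<omega>\<bar> \<le> running_max (\<lambda>k. W (grid t T n k) \<omega> - W t \<omega>) (Suc n)"
          by (rule running_max_ge[OF k])
        then show "(W (grid t T n (k n)) \<omega> - W t \<omega>)\<^sup>2 \<le> R n \<omega>"
          unfolding R_def by (metis abs_ge_zero power2_abs power_mono)
      qed
      finally have "(W s \<omega> - W t \<omega>)\<^sup>2 \<le> enn2real (L \<omega>)"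
        using enn2real_mono[of "ennreal ((W s \<omega> - W t \<omega>)\<^sup>2)" "L \<omega>"] elim(1) by (simp add: less_top)
      then show "\<bar>W s \<omega> - W t \<omega>\<bar> \<le> 1 + enn2real (L \<omega>)"
        using abs_le_one_plus_square[of "W s \<omega> - W t \<omega>"] by linarith
    qed
  qed
  ultimately show ?thesis by (intro that[of "\<lambda>\<omega>. 1 + enn2real (L \<omega>)"]) auto
qed

end

section \<open>Bounds along a path of the excursion\<close>

definition excursion_drift :: "(real \<Rightarrow> real) \<Rightarrow> real \<Rightarrow> real" where
  "excursion_drift X r = 1 / X r - X r / (1 - r)"

lemma set_integral_Icc_Ico:
  fixes f :: "real \<Rightarrow> real"
  assumes "set_integrable lborel {a..b} f"
  shows "(LBINT r:{a..b}. f r) = (LBINT r:{a..<b}. f r)"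
  unfolding set_lebesgue_integral_def
proof (rule integral_cong_AE)
  have "set_integrable lborel {a..<b} f" by (rule set_integrable_subset[OF assms]) auto
  then show "(\<lambda>r. indicator {a..<b} r *\<^sub>R f r) \<in> borel_measurable lborel"
    "(\<lambda>r. indicator {a..b} r *\<^sub>R f r) \<in> borel_measurable lborel"
    using assms unfolding set_integrable_def by (auto dest: borel_measurable_integrable)
  have "AE r in lborel. r \<noteq> b" by (rule AE_lborel_singleton)
  then show "AE r in lborel. indicator {a..b} r *\<^sub>R f r = indicator {a..<b} r *\<^sub>R f r"
    by eventually_elim (auto simp: indicator_def)
qed

lemma set_integral_Ico_split:
  fixes f :: "real \<Rightarrow> real"
  assumes "a \<le> b" "b \<le> c" "set_integrable lborel {a..<c} f"
  shows "(LBINT r:{a..<c}. f r) = (LBINT r:{a..<b}. f r) + (LBINT r:{b..<c}. f r)"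
proof -
  have "{a..<c} = {a..<b} \<union> {b..<c}" using assms by auto
  moreover have "set_integrable lborel {a..<b} f" "set_integrable lborel {b..<c} f"
    using assms by (auto intro: set_integrable_subset[OF assms(3)])
  ultimately show ?thesis by (simp add: set_integral_Un)
qed

text \<open>One path of the excursion together with the path of the driving noise and a bound for the latter.
  The statements below hold for each such path, without probability.\<close>

locale excursion_path =
  fixes t T x Z :: real and X W :: "real \<Rightarrow> real"
  assumes tT: "0 \<le> t" "t < T" "T < 1"
    and W_cont: "continuous_on {t..T} W" and X_cont: "continuous_on {t..T} X" and X_nonneg: "\<And>s. s \<in> {t..T} \<Longrightarrow> 0 \<le> X s"
    and X_start: "X t = x"
    and inv_finite: "(\<integral>\<^sup>+r\<in>{t..T}. 1 / ennreal (X r) \<partial>lborel) < \<infinity>"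
    and eq: "\<And>s. s \<in> {t..T} \<Longrightarrow> X s = X t + (LBINT r:{t..s}. 1 / X r - X r / (1 - r)) + (W s - W t)"
    and Z: "\<And>s. s \<in> {t..T} \<Longrightarrow> \<bar>W s - W t\<bar> \<le> Z"
begin

lemma X_measurable: "(\<lambda>r. indicator {t..T} r * X r) \<in> borel_measurable lborel"
  using borel_measurable_continuous_on_indicator[OF _ X_cont] by simp

lemma inv_measurable: "(\<lambda>r. 1 / ennreal (X r) * indicator {t..T} r) \<in> borel_measurable lborel"
proof -
  have "(\<lambda>r. 1 / ennreal (indicator {t..T} r * X r) * indicator {t..T} r) \<in> borel_measurable lborel"
    using X_measurable by measurable
  moreover have "1 / ennreal (indicator {t..T} r * X r) * indicator {t..T} r = 1 / ennreal (X r) * indicator {t..T} r" for r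
    by (simp add: indicator_def)
  ultimately show ?thesis by simp
qed

lemma X_pos_AE: "AE r in lborel. r \<in> {t..T} \<longrightarrow> 0 < X r"
proof -
  have "AE r in lborel. 1 / ennreal (X r) * indicator {t..T} r \<noteq> \<infinity>"
    using inv_finite by (intro nn_integral_noteq_infinite inv_measurable) auto
  then show ?thesis
  proof eventually_elim
    case (elim r)
    show ?case
    proof
      assume r: "r \<in> {t..T}"
      have "X r \<noteq> 0"
      proof
        assume "X r = 0" then show False using elim r by (simp add: divide_ennreal_def)
      qed
      then show "0 < X r" using X_nonneg[OF r] by simp
    qed
  qed
qed

lemma inv_integrable: "set_integrable lborel {t..T} (\<lambda>r. 1 / X r)"
  unfolding set_integrable_def
proof (rule integrableI_bounded)
  have "(\<lambda>r. indicator {t..T} r * (1 / (indicator {t..T} r * X r))) \<in> borel_measurable lborel"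
    using X_measurable by measurable
  moreover have "indicator {t..T} r * (1 / (indicator {t..T} r * X r)) = indicator {t..T} r *\<^sub>R (1 / X r)" for r
    by (simp add: indicator_def)
  ultimately show "(\<lambda>r. indicator {t..T} r *\<^sub>R (1 / X r)) \<in> borel_measurable lborel" by simp
  have "(\<integral>\<^sup>+r. ennreal (norm (indicator {t..T} r *\<^sub>R (1 / X r))) \<partial>lborel) \<le> (\<integral>\<^sup>+r\<in>{t..T}. 1 / ennreal (X r) \<partial>lborel)"
  proof (rule nn_integral_mono)
    fix r
    show "ennreal (norm (indicator {t..T} r *\<^sub>R (1 / X r))) \<le> 1 / ennreal (X r) * indicator {t..T} r"
    proof (cases "r \<in> {t..T}")
      case True
      show ?thesis
      proof (cases "X r = 0")
        case False
        then have "0 < X r" using X_nonneg[OF True] by simp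
        then show ?thesis using True divide_ennreal[of 1 "X r"] by simp
      qed simp
    qed simp
  qed
  then show "(\<integral>\<^sup>+r. ennreal (norm (indicator {t..T} r *\<^sub>R (1 / X r))) \<partial>lborel) < \<infinity>"
    using inv_finite by (rule le_less_trans)
qed

lemma linear_integrable: "set_integrable lborel {t..T} (\<lambda>r. X r / (1 - r))"
  using tT by (intro borel_integrable_atLeastAtMost' continuous_intros X_cont) auto

lemma drift_integrable: "set_integrable lborel {t..T} (excursion_drift X)"
  unfolding excursion_drift_def[abs_def] using inv_integrable linear_integrable by (rule set_integral_diff)

lemma drift_integrable_Ico:
  assumes "t \<le> a" "b \<le> T" shows "set_integrable lborel {a..<b} (excursion_drift X)"
  by (rule set_integrable_subset[OF drift_integrable]) (use assms in auto)

lemma increment_eq: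
  assumes "t \<le> a" "a \<le> b" "b \<le> T"
  shows "X b - X a = (LBINT r:{a..<b}. excursion_drift X r) + (W b - W a)"
proof -
  have "X s = X t + (LBINT r:{t..<s}. excursion_drift X r) + (W s - W t)" if "s \<in> {t..T}" for s
  proof -
    have "set_integrable lborel {t..s} (excursion_drift X)"
      by (rule set_integrable_subset[OF drift_integrable]) (use that in auto)
    then show ?thesis using eq[OF that] by (simp add: set_integral_Icc_Ico flip: excursion_drift_def)
  qed
  from this[of a] this[of b] show ?thesis
    using assms set_integral_Ico_split[OF assms(1,2) drift_integrable_Ico] by simp
qed

text \<open>After the last time before \<open>s\<close> at which \<open>X \<le> max x 1\<close> the drift is at most 1, so from then on \<open>X\<close> gains
  at most \<open>1\<close> plus an increment of the noise.\<close>

lemma X_bound: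
  assumes s: "s \<in> {t..T}" shows "X s \<le> max x 1 + 1 + 2 * Z"
proof (cases "X s \<le> max x 1")
  case True then show ?thesis using Z[OF s] by linarith
next
  case False
  \<comment> \<open>The supremum of \<open>G\<close> is the last time before \<open>s\<close> at which \<open>X\<close> is at most \<open>max x 1\<close>.\<close>
  define G where "G = {t..s} \<inter> X -` {..max x 1}"
  have "closed G" unfolding G_def
    using s by (intro continuous_closed_preimage continuous_on_subset[OF X_cont]) auto
  moreover have "t \<in> G" using s X_start by (auto simp: G_def)
  moreover have "bdd_above G" by (auto simp: G_def intro!: bdd_aboveI[of _ s])
  ultimately have g: "Sup G \<in> G" by (intro closed_contains_Sup) auto
  define g where "g = Sup G"
  have g': "t \<le> g" "g \<le> s" "X g \<le> max x 1" using g by (auto simp: G_def g_def)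
  have above: "max x 1 < X r" if "r \<in> {g<..s}" for r
  proof (rule ccontr)
    assume "\<not> max x 1 < X r"
    then have "r \<in> G" using that g' by (auto simp: G_def)
    then have "r \<le> g" unfolding g_def using \<open>bdd_above G\<close> by (rule cSup_upper)
    then show False using that by simp
  qed
  have "(LBINT r:{g..<s}. excursion_drift X r) \<le> (LBINT r:{g..<s}. 1)"
    unfolding set_lebesgue_integral_def
  proof (rule integral_mono_AE)
    show "integrable lborel (\<lambda>r. indicator {g..<s} r *\<^sub>R excursion_drift X r)"
      using drift_integrable_Ico[of g s] g' s by (simp add: set_integrable_def)
    show "integrable lborel (\<lambda>r. indicator {g..<s} r *\<^sub>R (1::real))" using g' by simp
    have "AE r in lborel. r \<noteq> g" by (rule AE_lborel_singleton)
    then show "AE r in lborel. indicator {g..<s} r *\<^sub>R excursion_drift X r \<le> indicator {g..<s} r *\<^sub>R 1"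
    proof eventually_elim
      case (elim r)
      have "excursion_drift X r \<le> 1" if "r \<in> {g..<s}"
      proof -
        have "1 < X r" using above[of r] that elim by auto
        moreover have "0 \<le> X r / (1 - r)" using that s tT \<open>1 < X r\<close> by (intro divide_nonneg_nonneg) auto
        ultimately show ?thesis unfolding excursion_drift_def
          using divide_le_eq_1[of 1 "X r"] by linarith
      qed
      then show ?case by (simp add: indicator_def)
    qed
  qed
  also have "\<dots> = s - g" using g' by (simp add: set_lebesgue_integral_def)
  finally have "X s - X g \<le> (s - g) + (W s - W g)"
    using increment_eq[of g s] g' s by simp
  moreover have "s - g \<le> 1" using g' s tT by simp
  moreover have "W s - W g \<le> 2 * Z" using Z[of s] Z[of g] g' s by auto
  ultimately show ?thesis using g' by linarith
qed

text \<open>The equation itself bounds \<open>\<integral> 1 / X\<close>, being the difference of \<open>X\<close>, the noise, and the other drift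
  term, all of which are controlled.\<close>

lemma drift_abs_bound:
  "(LBINT r:{t..<T}. \<bar>excursion_drift X r\<bar>) \<le> (max x 1 + 1 + 2 * Z) * (1 + 2 / (1 - T)) + Z"
proof -
  define b where "b = max x 1 + 1 + 2 * Z"
  have b: "X s \<le> b" if "s \<in> {t..T}" for s using X_bound[OF that] by (simp add: b_def)
  have b0: "0 \<le> b" using b[of t] X_nonneg[of t] tT by simp
  have Ico: "set_integrable lborel {t..<T} (\<lambda>r. 1 / X r)" "set_integrable lborel {t..<T} (\<lambda>r. X r / (1 - r))"
    by (auto intro: set_integrable_subset[OF inv_integrable] set_integrable_subset[OF linear_integrable])
  have "(LBINT r:{t..<T}. \<bar>excursion_drift X r\<bar>) \<le> (LBINT r:{t..<T}. 1 / X r + X r / (1 - r))"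
  proof (rule set_integral_mono)
    show "set_integrable lborel {t..<T} (\<lambda>r. \<bar>excursion_drift X r\<bar>)"
      using drift_integrable_Ico[of t T] by (intro set_integrable_abs) auto
    show "\<bar>excursion_drift X r\<bar> \<le> 1 / X r + X r / (1 - r)" if "r \<in> {t..<T}" for r
    proof -
      have "0 \<le> 1 / X r" "0 \<le> X r / (1 - r)" using X_nonneg[of r] that tT by auto
      then show ?thesis unfolding excursion_drift_def by linarith
    qed
  qed (use Ico in \<open>rule set_integral_add\<close>)
  also have "\<dots> = (LBINT r:{t..<T}. 1 / X r) + (LBINT r:{t..<T}. X r / (1 - r))"
    using Ico by (rule set_integral_add)
  also have "(LBINT r:{t..<T}. 1 / X r) = (LBINT r:{t..<T}. excursion_drift X r) + (LBINT r:{t..<T}. X r / (1 - r))"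
    using set_integral_diff(2)[OF Ico] unfolding excursion_drift_def by simp
  also have "(LBINT r:{t..<T}. excursion_drift X r) = X T - X t - (W T - W t)"
    using increment_eq[of t T] tT by simp
  also have "(LBINT r:{t..<T}. X r / (1 - r)) \<le> (LBINT r:{t..<T}. b / (1 - T))"
  proof (rule set_integral_mono)
    show "X r / (1 - r) \<le> b / (1 - T)" if "r \<in> {t..<T}" for r
      using that b[of r] b0 tT by (intro frac_le) auto
    show "set_integrable lborel {t..<T} (\<lambda>r. b / (1 - T))"
      unfolding set_integrable_def by (intro integrable_scaleR_left integrable_real_indicator) (use tT in auto)
  qed (rule Ico)
  also have "(LBINT r:{t..<T}. b / (1 - T)) = (T - t) * (b / (1 - T))"
    using tT by (simp add: set_lebesgue_integral_def)
  also have "(T - t) * (b / (1 - T)) \<le> 1 * (b / (1 - T))"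
    using tT b0 by (intro mult_right_mono) auto
  finally have "(LBINT r:{t..<T}. \<bar>excursion_drift X r\<bar>) \<le> X T - X t - (W T - W t) + 2 * (b / (1 - T))"
    by simp
  moreover have "X T \<le> b" "0 \<le> X t" "\<bar>W T - W t\<bar> \<le> Z" using b[of T] X_nonneg[of t] Z[of T] tT by auto
  ultimately show ?thesis unfolding b_def[symmetric] by (simp add: algebra_simps)
qed

end

section \<open>Riemann sums with integrable weights\<close>

lemma grid_indicator_sum:
  fixes a :: "nat \<Rightarrow> real"
  assumes tT: "t < T"
  shows "(\<Sum>k<Suc n. indicator {grid t T n k..<grid t T n (Suc k)} r * a k) =
    indicator {t..<T} r * a (grid_down t T n r)"
proof (cases "r \<in> {t..<T}")
  case True
  define j where "j = grid_down t T n r"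
  have j: "j < Suc n" "r \<in> {grid t T n j..<grid t T n (Suc j)}"
    using grid_down_less[OF tT] grid_down_bounds[OF tT] True by (auto simp: j_def)
  have "(\<Sum>k<Suc n. indicator {grid t T n k..<grid t T n (Suc k)} r * a k) = (\<Sum>k<Suc n. if k = j then a k else 0)"
    using j grid_disjoint[OF tT] by (intro sum.cong) (auto simp: indicator_def simp del: atLeastLessThan_iff)
  then show ?thesis using j True by (simp add: j_def)
next
  case False
  have "r \<notin> {grid t T n k..<grid t T n (Suc k)}" if "k < Suc n" for k
    using False grid_ge[OF tT, of n k] grid_le_end[OF tT, of "Suc k" n] that by auto
  then have "(\<Sum>k<Suc n. indicator {grid t T n k..<grid t T n (Suc k)} r * a k) = (\<Sum>k<Suc n. 0)"
    by (intro sum.cong) (auto simp: indicator_def simp del: atLeastLessThan_iff)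
  then show ?thesis using False by simp
qed

context
  fixes t T :: real and g :: "real \<Rightarrow> real"
  assumes tT: "t < T" and g: "set_integrable lborel {t..<T} g"
begin

lemma set_integrable_grid_cell: "k < Suc n \<Longrightarrow> set_integrable lborel {grid t T n k..<grid t T n (Suc k)} g"
  using grid_ge[OF tT, of n k] grid_le_end[OF tT, of "Suc k" n]
  by (intro set_integrable_subset[OF g]) auto

text \<open>Sums of cell integrals with constant weights are integrals of step functions, to which dominated
  convergence applies below.\<close>

lemma grid_cells_integral:
  fixes c :: "nat \<Rightarrow> real"
  shows "(\<Sum>k<Suc n. c k * (LBINT r:{grid t T n k..<grid t T n (Suc k)}. g r)) =
      (\<integral>r. indicator {t..<T} r * (c (grid_down t T n r) * g r) \<partial>lborel)"
    and "integrable lborel (\<lambda>r. indicator {t..<T} r * (c (grid_down t T n r) * g r))"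
proof -
  have int: "integrable lborel (\<lambda>r. c k * (indicator {grid t T n k..<grid t T n (Suc k)} r * g r))" if "k < Suc n" for k
    using set_integrable_grid_cell[OF that] unfolding set_integrable_def by (intro integrable_mult_right) simp
  have eq: "indicator {t..<T} r * (c (grid_down t T n r) * g r) =
      (\<Sum>k<Suc n. c k * (indicator {grid t T n k..<grid t T n (Suc k)} r * g r))" for r
    using grid_indicator_sum[OF tT, of n r "\<lambda>k. c k * g r"] by (simp only: mult_ac)
  show "integrable lborel (\<lambda>r. indicator {t..<T} r * (c (grid_down t T n r) * g r))"
    unfolding eq using int by (intro Bochner_Integration.integrable_sum) auto
  have "(\<integral>r. indicator {t..<T} r * (c (grid_down t T n r) * g r) \<partial>lborel) =
      (\<Sum>k<Suc n. \<integral>r. c k * (indicator {grid t T n k..<grid t T n (Suc k)} r * g r) \<partial>lborel)"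
    unfolding eq using int by (intro Bochner_Integration.integral_sum) auto
  then show "(\<Sum>k<Suc n. c k * (LBINT r:{grid t T n k..<grid t T n (Suc k)}. g r)) =
      (\<integral>r. indicator {t..<T} r * (c (grid_down t T n r) * g r) \<partial>lborel)"
    by (simp add: set_lebesgue_integral_def del: sum.lessThan_Suc)
qed

lemma grid_cells_abs_le:
  fixes c :: "nat \<Rightarrow> real"
  assumes "\<And>k. k < Suc n \<Longrightarrow> \<bar>c k\<bar> \<le> B"
  shows "\<bar>\<Sum>k<Suc n. c k * (LBINT r:{grid t T n k..<grid t T n (Suc k)}. g r)\<bar> \<le> B * (LBINT r:{t..<T}. \<bar>g r\<bar>)"
proof -
  have "\<bar>\<integral>r. indicator {t..<T} r * (c (grid_down t T n r) * g r) \<partial>lborel\<bar> \<le>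
      (\<integral>r. B * (indicator {t..<T} r * \<bar>g r\<bar>) \<partial>lborel)"
  proof (rule order_trans[OF integral_abs_bound integral_mono])
    show "integrable lborel (\<lambda>r. B * (indicator {t..<T} r * \<bar>g r\<bar>))"
      using set_integrable_abs[OF g] unfolding set_integrable_def by (intro integrable_mult_right) simp
    show "\<bar>indicator {t..<T} r * (c (grid_down t T n r) * g r)\<bar> \<le> B * (indicator {t..<T} r * \<bar>g r\<bar>)" for r
      using assms[OF grid_down_less[OF tT, of r n]] by (auto simp: indicator_def abs_mult intro: mult_right_mono)
  qed (intro integrable_abs grid_cells_integral(2))
  then show ?thesis
    unfolding grid_cells_integral(1) by (simp add: set_lebesgue_integral_def)
qed

lemma grid_cells_tendsto:
  fixes c :: "nat \<Rightarrow> nat \<Rightarrow> real"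
  assumes c: "\<And>n k. k < Suc n \<Longrightarrow> \<bar>c n k\<bar> \<le> B"
    and lim: "AE r in lborel. r \<in> {t..<T} \<longrightarrow> (\<lambda>n. c n (grid_down t T n r)) \<longlonglongrightarrow> C r"
    and meas: "(\<lambda>r. indicator {t..<T} r * (C r * g r)) \<in> borel_measurable lborel"
  shows "(\<lambda>n. \<Sum>k<Suc n. c n k * (LBINT r:{grid t T n k..<grid t T n (Suc k)}. g r)) \<longlonglongrightarrow> (LBINT r:{t..<T}. C r * g r)"
  unfolding grid_cells_integral(1) unfolding set_lebesgue_integral_def real_scaleR_def
proof (rule integral_dominated_convergence)
  show "integrable lborel (\<lambda>r. B * (indicator {t..<T} r * \<bar>g r\<bar>))"
    using set_integrable_abs[OF g] unfolding set_integrable_def by (intro integrable_mult_right) simp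
  show "AE r in lborel. (\<lambda>n. indicator {t..<T} r * (c n (grid_down t T n r) * g r)) \<longlonglongrightarrow> indicator {t..<T} r * (C r * g r)"
    using lim by eventually_elim (auto simp: indicator_def intro!: tendsto_intros)
  show "AE r in lborel. norm (indicator {t..<T} r * (c n (grid_down t T n r) * g r)) \<le> B * (indicator {t..<T} r * \<bar>g r\<bar>)" for n
    using c[OF grid_down_less[OF tT]] by (intro AE_I2) (auto simp: indicator_def abs_mult intro: mult_right_mono)
qed (use meas grid_cells_integral(2) in \<open>auto dest: borel_measurable_integrable\<close>)

end

section \<open>Test functions\<close>

lemma mvt_between:
  fixes f f' :: "real \<Rightarrow> real"
  assumes "\<And>y. y \<in> {min a b..max a b} \<Longrightarrow> (f has_real_derivative f' y) (at y)"
  shows "\<exists>y\<in>{min a b..max a b}. f b - f a = (b - a) * f' y"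
proof (cases a b rule: linorder_cases)
  case less
  then show ?thesis using MVT2[of a b f f'] assms by (fastforce simp: min_def max_def)
next
  case greater
  then obtain y where "b < y" "y < a" "f a - f b = (a - b) * f' y"
    using MVT2[of b a f f'] assms by (auto simp: min_def max_def)
  then show ?thesis by (intro bexI[of _ y]) (auto simp: algebra_simps)
qed (auto simp: min_def max_def)

text \<open>Functions to which the Dynkin inequality applies. The Lipschitz condition on the second derivative
  is what makes the Taylor remainder cubic.\<close>

locale test_function =
  fixes t T B :: real and f fs fx fxx :: "real \<Rightarrow> real \<Rightarrow> real"
  assumes deriv_s: "\<And>s y. s \<in> {t..T} \<Longrightarrow> ((\<lambda>s. f s y) has_real_derivative fs s y) (at s)"
    and deriv_x: "\<And>s y. s \<in> {t..T} \<Longrightarrow> (f s has_real_derivative fx s y) (at y)"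
    and deriv_xx: "\<And>s y. s \<in> {t..T} \<Longrightarrow> (fx s has_real_derivative fxx s y) (at y)"
    and bound_s: "\<And>s y. s \<in> {t..T} \<Longrightarrow> \<bar>fs s y\<bar> \<le> B"
    and bound_x: "\<And>s y. s \<in> {t..T} \<Longrightarrow> \<bar>fx s y\<bar> \<le> B"
    and bound_xx: "\<And>s y. s \<in> {t..T} \<Longrightarrow> \<bar>fxx s y\<bar> \<le> B"
    and lipschitz_xx: "\<And>s y z. s \<in> {t..T} \<Longrightarrow> \<bar>fxx s y - fxx s z\<bar> \<le> B * \<bar>y - z\<bar>"
    and cont_s: "continuous_on ({t..T} \<times> UNIV) (\<lambda>(s, y). fs s y)"
    and cont_x: "continuous_on ({t..T} \<times> UNIV) (\<lambda>(s, y). fx s y)"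
    and cont_xx: "continuous_on ({t..T} \<times> UNIV) (\<lambda>(s, y). fxx s y)"
begin

lemma B_nonneg: "t \<le> T \<Longrightarrow> 0 \<le> B"
  using bound_s[of t 0] by simp

lemma lipschitz:
  assumes "s \<in> {t..T}" "s' \<in> {t..T}"
  shows "\<bar>f s' y' - f s y\<bar> \<le> B * (\<bar>s' - s\<bar> + \<bar>y' - y\<bar>)"
proof -
  have "\<exists>u\<in>{min s s'..max s s'}. f s' y' - f s y' = (s' - s) * fs u y'"
    by (rule mvt_between) (use assms in \<open>auto intro!: deriv_s\<close>)
  then obtain u where u0: "u \<in> {min s s'..max s s'}" and u: "f s' y' - f s y' = (s' - s) * fs u y'" by blast
  have "u \<in> {t..T}" using u0 assms by (auto simp: min_le_iff_disj le_max_iff_disj)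
  have "\<exists>v\<in>{min y y'..max y y'}. f s y' - f s y = (y' - y) * fx s v"
    by (rule mvt_between) (use assms in \<open>auto intro!: deriv_x\<close>)
  then obtain v where v: "f s y' - f s y = (y' - y) * fx s v" by blast
  have "\<bar>f s' y' - f s y'\<bar> \<le> \<bar>s' - s\<bar> * B"
    unfolding u abs_mult by (intro mult_left_mono bound_s \<open>u \<in> {t..T}\<close>) simp
  moreover have "\<bar>f s y' - f s y\<bar> \<le> \<bar>y' - y\<bar> * B"
    unfolding v abs_mult by (intro mult_left_mono bound_x assms(1)) simp
  ultimately show ?thesis by (simp add: algebra_simps)
qed

text \<open>The mean value theorem, applied to the remainder and then to \<open>f\<^sub>x\<close>; the Lipschitz condition supplies
  the third factor \<open>|w|\<close>.\<close>

lemma taylor_remainder: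
  assumes s: "s \<in> {t..T}"
  shows "\<bar>f s (y + w) - f s y - fx s y * w - fxx s y * w\<^sup>2 / 2\<bar> \<le> B * \<bar>w\<bar> ^ 3"
proof -
  define R where "R v = f s (y + v) - fx s y * v - fxx s y * v\<^sup>2 / 2" for v
  have "\<exists>v\<in>{min 0 w..max 0 w}. R w - R 0 = (w - 0) * (fx s (y + v) - fx s y - fxx s y * v)"
  proof (rule mvt_between)
    fix v
    have "((\<lambda>v. f s (y + v)) has_real_derivative fx s (y + v) * 1) (at v)"
      by (rule DERIV_chain2[OF deriv_x[OF s]]) (auto intro!: derivative_eq_intros)
    then show "(R has_real_derivative fx s (y + v) - fx s y - fxx s y * v) (at v)"
      unfolding R_def[abs_def] by (auto intro!: derivative_eq_intros)
  qed
  then obtain v where v0: "v \<in> {min 0 w..max 0 w}"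
    and "R w - R 0 = (w - 0) * (fx s (y + v) - fx s y - fxx s y * v)" by blast
  then have v: "\<bar>v\<bar> \<le> \<bar>w\<bar>" "R w - R 0 = w * (fx s (y + v) - fx s y - fxx s y * v)" by auto
  have "\<exists>u\<in>{min y (y + v)..max y (y + v)}. fx s (y + v) - fx s y = (y + v - y) * fxx s u"
    by (rule mvt_between) (rule deriv_xx[OF s])
  then obtain u where u0: "u \<in> {min y (y + v)..max y (y + v)}"
    and "fx s (y + v) - fx s y = (y + v - y) * fxx s u" by blast
  then have u: "\<bar>u - y\<bar> \<le> \<bar>v\<bar>" "fx s (y + v) - fx s y = v * fxx s u" by auto
  have "fx s (y + v) - fx s y - fxx s y * v = v * (fxx s u - fxx s y)"
    using u(2) by (simp add: algebra_simps)
  then have "\<bar>R w - R 0\<bar> = \<bar>w\<bar> * (\<bar>v\<bar> * \<bar>fxx s u - fxx s y\<bar>)"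
    using v(2) by (simp add: abs_mult)
  also have "\<dots> \<le> \<bar>w\<bar> * (\<bar>w\<bar> * (B * \<bar>w\<bar>))"
  proof (intro mult_left_mono mult_mono)
    have "0 \<le> B" using bound_s[OF s, of 0] by simp
    show "\<bar>fxx s u - fxx s y\<bar> \<le> B * \<bar>w\<bar>"
      using lipschitz_xx[OF s, of u y] mult_left_mono[of "\<bar>u - y\<bar>" "\<bar>w\<bar>" B] u(1) v(1) \<open>0 \<le> B\<close> by linarith
  qed (use v in auto)
  also have "\<dots> = B * \<bar>w\<bar> ^ 3" by (simp add: power3_eq_cube)
  finally show ?thesis by (simp add: R_def algebra_simps)
qed

end

context filtered_brownian_motion begin

text \<open>The effect of one Brownian increment \<open>w\<close> on a test function is \<open>f\<^sub>x w + f\<^sub>x\<^sub>x w\<^sup>2 / 2\<close> up to \<open>|w|\<^sup>3\<close>. By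
  independence the terms with \<open>w\<close> and \<open>w\<^sup>2 - (s - r)\<close> vanish in the mean, also after multiplication with
  quantities known at time \<open>r\<close>. The error is of order \<open>3/2\<close> in the length of the step, so it
  disappears when summed over a grid.\<close>

lemma expected_increment_test_function:
  assumes "test_function t T B f fs fx fxx" and s: "0 \<le> r" "r < s" "s \<in> {t..T}"
    and h: "h \<in> borel_measurable (F r)" "\<And>\<omega>. \<bar>h \<omega>\<bar> \<le> 1" and Y: "Y \<in> borel_measurable (F r)"
  defines "I \<omega> \<equiv> h \<omega> * (f s (Y \<omega> + (W s \<omega> - W r \<omega>)) - f s (Y \<omega>) - (s - r) / 2 * fxx s (Y \<omega>))"
  shows "integrable M I" "\<bar>expectation I\<bar> \<le> 2 * B * (s - r) * sqrt (s - r)"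
proof -
  interpret test_function t T B f fs fx fxx by fact
  define w where "w \<omega> = W s \<omega> - W r \<omega>" for \<omega>
  define R where "R \<omega> = h \<omega> * (f s (Y \<omega> + w \<omega>) - f s (Y \<omega>) - fx s (Y \<omega>) * w \<omega> - fxx s (Y \<omega>) * (w \<omega>)\<^sup>2 / 2)" for \<omega>
  have B0: "0 \<le> B" using bound_s[OF s(3), of 0] by simp
  have cont: "continuous_on UNIV (f s)" "continuous_on UNIV (fx s)"
    using deriv_x[OF s(3)] deriv_xx[OF s(3)] by (auto intro!: DERIV_continuous_on)
  have "continuous_on UNIV (\<lambda>y. case (s, y) of (s, y) \<Rightarrow> fxx s y)"
    by (rule continuous_on_compose2[OF cont_xx]) (use s(3) in \<open>auto intro!: continuous_intros\<close>)
  then have "continuous_on UNIV (fxx s)" by simp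
  note cont = cont this
  have [measurable]: "f s \<in> borel_measurable borel" "fx s \<in> borel_measurable borel" "fxx s \<in> borel_measurable borel"
    using cont by (auto intro: borel_measurable_continuous_onI)
  have hM[measurable]: "h \<in> borel_measurable M" "Y \<in> borel_measurable M"
    using h(1) Y s(1) by (auto intro: measurable_F_M)
  have [measurable]: "W s \<in> borel_measurable M" "W r \<in> borel_measurable M"
    using adapted_W s by (auto intro: measurable_F_M[of s] measurable_F_M[of r])
  have wM[measurable]: "w \<in> borel_measurable M" unfolding w_def[abs_def] by measurable
  have hB: "\<bar>h \<omega> * c\<bar> \<le> \<bar>c\<bar>" for c \<omega>
    using h(2)[of \<omega>] mult_right_mono[of "\<bar>h \<omega>\<bar>" 1 "\<bar>c\<bar>"] by (simp add: abs_mult)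
  have F1: "(\<lambda>\<omega>. h \<omega> * fx s (Y \<omega>)) \<in> borel_measurable (F r)" "(\<lambda>\<omega>. h \<omega> * fxx s (Y \<omega>) / 2) \<in> borel_measurable (F r)"
    using h(1) Y by measurable
  have I1: "integrable M (\<lambda>\<omega>. h \<omega> * fx s (Y \<omega>))"
    by (rule integrable_const_bound[of _ B]) (use order_trans[OF hB bound_x[OF s(3)]] in auto)
  have "\<bar>h \<omega> * fxx s (Y \<omega>) / 2\<bar> \<le> B" for \<omega>
    using hB[of \<omega> "fxx s (Y \<omega>)"] bound_xx[OF s(3), of "Y \<omega>"] B0 by simp
  then have I2: "integrable M (\<lambda>\<omega>. h \<omega> * fxx s (Y \<omega>) / 2)"
    by (intro integrable_const_bound[of _ B]) auto
  note m = increment_moments[OF s(1,2), folded w_def]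
  have E1: "integrable M (\<lambda>\<omega>. h \<omega> * fx s (Y \<omega>) * w \<omega>)" "expectation (\<lambda>\<omega>. h \<omega> * fx s (Y \<omega>) * w \<omega>) = 0"
    using indep_increment_mult[OF s(1,2) F1(1) I1, of "\<lambda>x. x", folded w_def] m by simp_all
  have sq: "integrable M (\<lambda>\<omega>. (w \<omega>)\<^sup>2 - (s - r))" "expectation (\<lambda>\<omega>. (w \<omega>)\<^sup>2 - (s - r)) = 0"
    using m by (simp_all add: prob_space)
  have E2: "integrable M (\<lambda>\<omega>. h \<omega> * fxx s (Y \<omega>) / 2 * ((w \<omega>)\<^sup>2 - (s - r)))"
    "expectation (\<lambda>\<omega>. h \<omega> * fxx s (Y \<omega>) / 2 * ((w \<omega>)\<^sup>2 - (s - r))) = 0"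
    using indep_increment_mult[OF s(1,2) F1(2) I2, of "\<lambda>x. x\<^sup>2 - (s - r)", folded w_def] sq by simp_all
  have R_bound: "\<bar>R \<omega>\<bar> \<le> B * \<bar>w \<omega>\<bar> ^ 3" for \<omega>
    unfolding R_def using hB taylor_remainder[OF s(3)] by (rule order_trans)
  have R_int: "integrable M R"
  proof (rule Bochner_Integration.integrable_bound)
    show "integrable M (\<lambda>\<omega>. B * \<bar>w \<omega>\<bar> ^ 3)" using m by simp
    show "R \<in> borel_measurable M" unfolding R_def[abs_def] by measurable
  qed (use R_bound B0 in \<open>auto simp: abs_mult\<close>)
  have I_eq: "I \<omega> = R \<omega> + h \<omega> * fx s (Y \<omega>) * w \<omega> + h \<omega> * fxx s (Y \<omega>) / 2 * ((w \<omega>)\<^sup>2 - (s - r))" for \<omega>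
    unfolding I_def R_def w_def by (simp add: field_simps)
  show "integrable M I" unfolding I_eq[abs_def] using R_int E1 E2 by auto
  have "expectation I = expectation R"
    unfolding I_eq[abs_def] using R_int E1 E2 by simp
  also have "\<bar>\<dots>\<bar> \<le> expectation (\<lambda>\<omega>. B * \<bar>w \<omega>\<bar> ^ 3)"
    using R_int m R_bound by (intro order_trans[OF integral_abs_bound integral_mono]) auto
  also have "\<dots> \<le> B * (2 * (s - r) * sqrt (s - r))"
    using m(6) B0 by (simp add: mult_left_mono)
  finally show "\<bar>expectation I\<bar> \<le> 2 * B * (s - r) * sqrt (s - r)" by (simp add: algebra_simps)
qed

end

text \<open>The scaling under which the excursion is invariant.\<close>

definition self_similar :: "(real \<Rightarrow> real) \<Rightarrow> real \<Rightarrow> real \<Rightarrow> real" where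
  "self_similar p s y = sqrt (1 - s) * p (y / sqrt (1 - s))"

text \<open>The bounds degenerate as time approaches 1, hence the constant, where \<open>1 - max 0 T\<close> is a positive
  number not exceeding \<open>1 - s\<close> and 1.\<close>

lemma test_function_self_similar:
  assumes T: "T < 1"
    and p: "\<And>z. (p has_real_derivative q z) (at z)" and q: "\<And>z. (q has_real_derivative h z) (at z)"
    and bounds: "\<And>z. \<bar>q z\<bar> \<le> B" "\<And>z. \<bar>h z\<bar> \<le> B" "\<And>z. \<bar>z * q z - p z\<bar> \<le> B"
    and lip: "\<And>z w. \<bar>h z - h w\<bar> \<le> B * \<bar>z - w\<bar>" and h: "continuous_on UNIV h"
  shows "test_function t T (B / (1 - max 0 T)) (self_similar p)
    (\<lambda>s y. (y / sqrt (1 - s) * q (y / sqrt (1 - s)) - p (y / sqrt (1 - s))) / (2 * sqrt (1 - s)))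
    (\<lambda>s y. q (y / sqrt (1 - s))) (\<lambda>s y. h (y / sqrt (1 - s)) / sqrt (1 - s))"
proof -
  define m where "m = 1 - max 0 T"
  have m: "0 < m" "m \<le> 1" using T by (auto simp: m_def)
  have B0: "0 \<le> B" using bounds(1)[of 0] by simp
  have B1: "B \<le> B / m" using m B0 by (simp add: field_simps mult_left_le)
  have r: "0 < sqrt (1 - s)" "m \<le> sqrt (1 - s)" "m \<le> sqrt (1 - s) * sqrt (1 - s)" if "s \<in> {t..T}" for s
  proof -
    have "m \<le> 1 - s" "0 < 1 - s" using that T by (auto simp: m_def)
    moreover have "m * m \<le> m" using m by (simp add: mult_left_le)
    moreover from calculation have "m * m \<le> 1 - s" by linarith
    ultimately show "0 < sqrt (1 - s)" "m \<le> sqrt (1 - s)" "m \<le> sqrt (1 - s) * sqrt (1 - s)"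
      using m by (auto intro!: real_le_rsqrt simp: power2_eq_square)
  qed
  have cont_pq: "continuous_on UNIV p" "continuous_on UNIV q"
    using p q by (auto intro!: DERIV_continuous_on)
  have cont: "continuous_on ({t..T} \<times> UNIV) (\<lambda>(s, y). F (y / sqrt (1 - s)))"
    if "continuous_on UNIV F" for F :: "real \<Rightarrow> real"
    unfolding case_prod_unfold using T by (intro continuous_on_compose2[OF that] continuous_intros) auto
  show ?thesis unfolding m_def[symmetric]
  proof
    fix s y z assume s: "s \<in> {t..T}"
    define \<rho> where "\<rho> = sqrt (1 - s)"
    have \<rho>: "0 < \<rho>" "m \<le> \<rho>" "m \<le> \<rho> * \<rho>" "\<rho> * \<rho> = 1 - s" using r[OF s] s T by (auto simp: \<rho>_def)
    have s1: "s < 1" using s T by auto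
    have root: "((\<lambda>s. sqrt (1 - s)) has_real_derivative - 1 / (2 * \<rho>)) (at s)"
    proof -
      have "((\<lambda>s. 1 - s) has_real_derivative - 1) (at s)" by (auto intro!: derivative_eq_intros)
      from DERIV_chain2[OF DERIV_real_sqrt this] s1 show ?thesis by (simp add: \<rho>_def inverse_eq_divide mult.commute)
    qed
    have "((\<lambda>s. y / sqrt (1 - s)) has_real_derivative y / (2 * (\<rho> * \<rho> * \<rho>))) (at s)"
      by (rule DERIV_cong[OF DERIV_divide[OF DERIV_const root]])
         (use \<rho>(1) in \<open>simp_all add: \<rho>_def[symmetric] field_simps\<close>)
    from DERIV_chain2[OF p this]
    have "((\<lambda>s. p (y / sqrt (1 - s))) has_real_derivative q (y / \<rho>) * (y / (2 * (\<rho> * \<rho> * \<rho>)))) (at s)"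
      by (simp add: \<rho>_def)
    from DERIV_mult[OF root this]
    show "((\<lambda>s. self_similar p s y) has_real_derivative
        (y / sqrt (1 - s) * q (y / sqrt (1 - s)) - p (y / sqrt (1 - s))) / (2 * sqrt (1 - s))) (at s)"
      unfolding self_similar_def \<rho>_def[symmetric] by (rule DERIV_cong) (use \<rho>(1) in \<open>simp add: field_simps\<close>)
    have lin: "((\<lambda>y. y / \<rho>) has_real_derivative 1 / \<rho>) (at y)"
      using \<rho>(1) by (auto intro!: derivative_eq_intros)
    show "(self_similar p s has_real_derivative q (y / sqrt (1 - s))) (at y)"
      unfolding self_similar_def[abs_def] \<rho>_def[symmetric]
      using DERIV_cmult[OF DERIV_chain2[OF p lin], of \<rho>] \<rho>(1) by simp
    show "((\<lambda>y. q (y / sqrt (1 - s))) has_real_derivative h (y / sqrt (1 - s)) / sqrt (1 - s)) (at y)"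
      unfolding \<rho>_def[symmetric] using DERIV_chain2[OF q lin] by simp
    show "\<bar>(y / sqrt (1 - s) * q (y / sqrt (1 - s)) - p (y / sqrt (1 - s))) / (2 * sqrt (1 - s))\<bar> \<le> B / m"
      unfolding \<rho>_def[symmetric] abs_divide using \<rho> m bounds(3)[of "y / \<rho>"] B0 by (intro frac_le) auto
    show "\<bar>q (y / sqrt (1 - s))\<bar> \<le> B / m" using bounds(1) B1 by (rule order_trans)
    show "\<bar>h (y / sqrt (1 - s)) / sqrt (1 - s)\<bar> \<le> B / m"
      unfolding \<rho>_def[symmetric] abs_divide using \<rho> m bounds(2)[of "y / \<rho>"] B0 by (intro frac_le) auto
    have "\<bar>h (y / \<rho>) / \<rho> - h (z / \<rho>) / \<rho>\<bar> = \<bar>h (y / \<rho>) - h (z / \<rho>)\<bar> / \<rho>"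
      using \<rho> by (simp add: diff_divide_distrib[symmetric])
    also have "\<dots> \<le> B * \<bar>y / \<rho> - z / \<rho>\<bar> / \<rho>"
      using \<rho> lip by (intro divide_right_mono) auto
    also have "\<dots> = B * \<bar>y - z\<bar> / (\<rho> * \<rho>)"
      using \<rho> by (simp add: diff_divide_distrib[symmetric])
    also have "\<dots> \<le> B * \<bar>y - z\<bar> / m"
      using \<rho> m B0 by (intro frac_le) auto
    finally show "\<bar>h (y / sqrt (1 - s)) / sqrt (1 - s) - h (z / sqrt (1 - s)) / sqrt (1 - s)\<bar> \<le> B / m * \<bar>y - z\<bar>"
      by (simp add: \<rho>_def)
  next
    show "continuous_on ({t..T} \<times> UNIV) (\<lambda>(s, y). (y / sqrt (1 - s) * q (y / sqrt (1 - s)) - p (y / sqrt (1 - s))) / (2 * sqrt (1 - s)))"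
      using cont[OF cont_pq(1)] cont[OF cont_pq(2)] T unfolding case_prod_unfold
      by (intro continuous_intros) auto
    show "continuous_on ({t..T} \<times> UNIV) (\<lambda>(s, y). q (y / sqrt (1 - s)))" by (rule cont[OF cont_pq(2)])
    show "continuous_on ({t..T} \<times> UNIV) (\<lambda>(s, y). h (y / sqrt (1 - s)) / sqrt (1 - s))"
      using cont[OF h] T unfolding case_prod_unfold by (intro continuous_intros) auto
  qed
qed

text \<open>Approach \<open>u\<close> from the left.\<close>

lemma continuous_le_at_endpoint:
  fixes g :: "real \<Rightarrow> real"
  assumes "continuous_on {t..b} g" "t < u" "u \<le> b" "\<And>r. r \<in> {t..<u} \<Longrightarrow> g r \<le> 0"
  shows "g u \<le> 0"
proof (rule LIMSEQ_le_const2)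
  have "(\<lambda>n. u - (u - t) / real (Suc n)) \<longlonglongrightarrow> u"
    using tendsto_diff[OF tendsto_const grid_mesh_tendsto[OF assms(2)], of u] by simp
  moreover have in_range: "u - (u - t) / real (Suc n) \<in> {t..<u}" for n
  proof -
    have "(u - t) / real (Suc n) \<le> u - t" "0 < (u - t) / real (Suc n)"
      using assms(2) divide_left_mono[of 1 "real (Suc n)" "u - t"] by auto
    then show ?thesis by simp
  qed
  moreover have "u - (u - t) / real (Suc n) \<in> {t..b}" for n
    using in_range[of n] assms(3) unfolding atLeastAtMost_iff atLeastLessThan_iff by linarith
  ultimately show "(\<lambda>n. g (u - (u - t) / real (Suc n))) \<longlonglongrightarrow> g u"
    using assms(2,3) by (intro continuous_on_tendsto_compose[OF assms(1)] always_eventually allI) simp_all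
  show "\<exists>N. \<forall>n\<ge>N. g (u - (u - t) / real (Suc n)) \<le> 0"
    using assms(4)[OF in_range] by blast
qed

section \<open>Pathwise limit of the grid approximation\<close>

text \<open>What is left of the increment of \<open>f(s, X\<^sub>s)\<close> over a cell, once the change of \<open>f\<close> in space under the
  Brownian increment alone has been replaced by its mean \<open>(s' - s) / 2 \<cdot> f\<^sub>x\<^sub>x\<close>.\<close>

definition cell_remainder ::
    "(real \<Rightarrow> real \<Rightarrow> real) \<Rightarrow> (real \<Rightarrow> real \<Rightarrow> real) \<Rightarrow> (real \<Rightarrow> real) \<Rightarrow> (real \<Rightarrow> real) \<Rightarrow> real \<Rightarrow> real \<Rightarrow> real" where
  "cell_remainder f fxx X W s s' = f s' (X s') - f s' (X s + (W s' - W s)) + (s' - s) / 2 * fxx s' (X s)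
    + (f s' (X s) - f s (X s))"

locale excursion_path_test_function = excursion_path + test_function
begin

text \<open>The limit \<open>G\<close> is the integral of the generator along the path up to \<open>\<tau>\<close>. By the mean value theorem, the \<open>k\<close>-th summand is the integral over the cell of the drift,
  weighted with \<open>f\<^sub>x\<close> at some nearby point, plus the length of the cell times time and second
  derivatives. The mean value theorem is used in place of a chain rule because the path minus its
  noise is only absolutely continuous: the drift is singular where \<open>X\<close> vanishes.\<close>

lemma path_grid_approximation:
  assumes \<tau>: "\<tau> \<in> {t..T}"
  defines "D n \<equiv> \<Sum>k<Suc n. of_bool (grid t T n k < \<tau>) *
      cell_remainder f fxx X W (grid t T n k) (grid t T n (Suc k))"
    and "G \<equiv> (LBINT r:{t..<T}. of_bool (r < \<tau>) * fx r (X r) * excursion_drift X r) +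
      (LBINT r:{t..<T}. of_bool (r < \<tau>) * (fs r (X r) + fxx r (X r) / 2))"
  shows path_grid_limit: "D \<longlonglongrightarrow> G"
    and path_grid_bound: "\<bar>D n\<bar> \<le> B * (LBINT r:{t..<T}. \<bar>excursion_drift X r\<bar>) + 2 * B * (T - t)"
    and path_generator_nonpos:
      "(\<And>r. r \<in> {t..<\<tau>} \<Longrightarrow> 0 < X r \<Longrightarrow> fs r (X r) + fxx r (X r) / 2 + fx r (X r) * excursion_drift X r \<le> 0) \<Longrightarrow>
        G \<le> 0"
proof -
  let ?g = "grid t T"
  have tT': "t < T" using tT by simp
  have B0: "0 \<le> B" using B_nonneg tT by simp
  have in_range: "?g n k \<in> {t..T}" if "k \<le> Suc n" for n k using grid_range[OF tT' that] .
  have step: "?g n k \<le> ?g n (Suc k)" for n k using grid_mono_iff[OF tT', of n k "Suc k"] by simp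
  have mesh: "?g n (Suc k) - ?g n k = (T - t) / real (Suc n)" for n k by (simp add: grid_Suc)
  have drift: "X (?g n (Suc k)) - (X (?g n k) + (W (?g n (Suc k)) - W (?g n k))) =
      (LBINT r:{?g n k..<?g n (Suc k)}. excursion_drift X r)" if "k < Suc n" for n k
    using increment_eq[of "?g n k" "?g n (Suc k)"] in_range[of k n] in_range[of "Suc k" n] step that by simp
  \<comment> \<open>Either end of the jump from the noise-only position to the true one; the intermediate points lie between them.\<close>
  define lo where "lo n k = min (X (?g n k) + (W (?g n (Suc k)) - W (?g n k))) (X (?g n (Suc k)))" for n k
  define hi where "hi n k = max (X (?g n k) + (W (?g n (Suc k)) - W (?g n k))) (X (?g n (Suc k)))" for n k
  have "\<exists>\<xi>\<in>{lo n k..hi n k}. k < Suc n \<longrightarrow> f (?g n (Suc k)) (X (?g n (Suc k))) -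
      f (?g n (Suc k)) (X (?g n k) + (W (?g n (Suc k)) - W (?g n k))) =
      (X (?g n (Suc k)) - (X (?g n k) + (W (?g n (Suc k)) - W (?g n k)))) * fx (?g n (Suc k)) \<xi>" for n k
  proof (cases "k < Suc n")
    case True
    show ?thesis
      using mvt_between[OF deriv_x[OF in_range[of "Suc k" n]],
          of "X (?g n k) + (W (?g n (Suc k)) - W (?g n k))" "X (?g n (Suc k))"] True
      unfolding lo_def hi_def by auto
  qed (auto simp: lo_def hi_def intro!: bexI[of _ "X (?g n (Suc k))"])
  then obtain \<xi> where \<xi>: "\<And>n k. \<xi> n k \<in> {lo n k..hi n k}"
    "\<And>n k. k < Suc n \<Longrightarrow> f (?g n (Suc k)) (X (?g n (Suc k))) -
      f (?g n (Suc k)) (X (?g n k) + (W (?g n (Suc k)) - W (?g n k))) =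
      (X (?g n (Suc k)) - (X (?g n k) + (W (?g n (Suc k)) - W (?g n k)))) * fx (?g n (Suc k)) (\<xi> n k)"
    by metis
  \<comment> \<open>The restriction on \<open>k\<close> inside the formula makes the choice of intermediate points total.\<close>
  have "\<exists>\<eta>\<in>{?g n k..?g n (Suc k)}. k < Suc n \<longrightarrow> f (?g n (Suc k)) (X (?g n k)) - f (?g n k) (X (?g n k)) =
      (?g n (Suc k) - ?g n k) * fs \<eta> (X (?g n k))" for n k
  proof (cases "k < Suc n")
    case True
    have "\<exists>\<eta>\<in>{min (?g n k) (?g n (Suc k))..max (?g n k) (?g n (Suc k))}.
      f (?g n (Suc k)) (X (?g n k)) - f (?g n k) (X (?g n k)) = (?g n (Suc k) - ?g n k) * fs \<eta> (X (?g n k))"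
    proof (rule mvt_between)
      fix s assume "s \<in> {min (?g n k) (?g n (Suc k))..max (?g n k) (?g n (Suc k))}"
      then have "s \<in> {t..T}" using step[of n k] in_range[of k n] in_range[of "Suc k" n] True by auto
      then show "((\<lambda>s. f s (X (?g n k))) has_real_derivative fs s (X (?g n k))) (at s)" by (rule deriv_s)
    qed
    then show ?thesis unfolding min_absorb1[OF step] max_absorb2[OF step] by blast
  qed (use step in \<open>auto intro!: bexI[of _ "?g n k"]\<close>)
  then obtain \<eta> where \<eta>: "\<And>n k. \<eta> n k \<in> {?g n k..?g n (Suc k)}"
    "\<And>n k. k < Suc n \<Longrightarrow> f (?g n (Suc k)) (X (?g n k)) - f (?g n k) (X (?g n k)) =
      (?g n (Suc k) - ?g n k) * fs (\<eta> n k) (X (?g n k))"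
    by metis
  have \<eta>_range: "\<eta> n k \<in> {t..T}" if "k < Suc n" for n k
    using \<eta>(1)[of n k] in_range[of k n] in_range[of "Suc k" n] that by auto
  define c1 where "c1 n k = of_bool (?g n k < \<tau>) * fx (?g n (Suc k)) (\<xi> n k)" for n k
  define c2 where "c2 n k = of_bool (?g n k < \<tau>) *
      (fs (\<eta> n k) (X (?g n k)) + fxx (?g n (Suc k)) (X (?g n k)) / 2)" for n k
  have c1_bound: "\<bar>c1 n k\<bar> \<le> B" if "k < Suc n" for n k
    using bound_x[OF in_range[of "Suc k" n], of "\<xi> n k"] B0 that by (simp add: c1_def)
  have c2_bound: "\<bar>c2 n k\<bar> \<le> 2 * B" if "k < Suc n" for n k
  proof -
    have "\<bar>fs (\<eta> n k) (X (?g n k)) + fxx (?g n (Suc k)) (X (?g n k)) / 2\<bar> \<le> B + B / 2"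
      using bound_s[OF \<eta>_range[OF that], of "X (?g n k)"] bound_xx[OF in_range[of "Suc k" n], of "X (?g n k)"] that
      by linarith
    then show ?thesis using B0 by (simp add: c2_def)
  qed
  have one: "set_integrable lborel {t..<T} (\<lambda>r. 1::real)"
    unfolding set_integrable_def by (intro integrable_scaleR_left integrable_real_indicator) (use tT in auto)
  have dr: "set_integrable lborel {t..<T} (excursion_drift X)"
    using drift_integrable_Ico[of t T] by simp
  have cell: "(LBINT r:{?g n k..<?g n (Suc k)}. (1::real)) = (T - t) / real (Suc n)" for n k
    using step[of n k] mesh[of n k] by (simp add: set_lebesgue_integral_def)
  have D_eq: "D n = (\<Sum>k<Suc n. c1 n k * (LBINT r:{?g n k..<?g n (Suc k)}. excursion_drift X r)) +
      (\<Sum>k<Suc n. c2 n k * (LBINT r:{?g n k..<?g n (Suc k)}. 1))" for n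
    unfolding D_def sum.distrib[symmetric]
  proof (rule sum.cong)
    fix k assume "k \<in> {..<Suc n}"
    then have k: "k < Suc n" by simp
    show "of_bool (?g n k < \<tau>) * cell_remainder f fxx X W (?g n k) (?g n (Suc k)) =
      c1 n k * (LBINT r:{?g n k..<?g n (Suc k)}. excursion_drift X r) + c2 n k * (LBINT r:{?g n k..<?g n (Suc k)}. 1)"
      unfolding cell_remainder_def
      unfolding \<xi>(2)[OF k] \<eta>(2)[OF k] drift[OF k] mesh cell c1_def c2_def
      by (simp add: algebra_simps del: of_nat_Suc)
  qed simp
  have "B * (LBINT r:{t..<T}. \<bar>excursion_drift X r\<bar>) + 2 * B * (LBINT r:{t..<T}. \<bar>1\<bar>) =
      B * (LBINT r:{t..<T}. \<bar>excursion_drift X r\<bar>) + 2 * B * (T - t)"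
    using tT by (simp add: set_lebesgue_integral_def)
  then show "\<bar>D n\<bar> \<le> B * (LBINT r:{t..<T}. \<bar>excursion_drift X r\<bar>) + 2 * B * (T - t)"
    unfolding D_eq
    using grid_cells_abs_le[OF tT' dr, of n "c1 n" B] grid_cells_abs_le[OF tT' one, of n "c2 n" "2 * B"] c1_bound c2_bound
    by (smt (verit))
  have X_lim: "(\<lambda>n. X (a n)) \<longlonglongrightarrow> X r" and W_lim: "(\<lambda>n. W (a n)) \<longlonglongrightarrow> W r"
    if "a \<longlonglongrightarrow> r" "r \<in> {t..T}" "\<And>n. a n \<in> {t..T}" for a r
    using continuous_on_tendsto_compose[OF X_cont that(1,2)] continuous_on_tendsto_compose[OF W_cont that(1,2)] that(3)
    by auto
  have f_lim: "(\<lambda>n. F (a n) (b n)) \<longlonglongrightarrow> F r y"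
    if "continuous_on ({t..T} \<times> UNIV) (\<lambda>(s, y). F s y)" "a \<longlonglongrightarrow> r" "b \<longlonglongrightarrow> y" "r \<in> {t..T}" "\<And>n. a n \<in> {t..T}"
    for F :: "real \<Rightarrow> real \<Rightarrow> real" and a b r y
    using continuous_on_tendsto_compose[OF that(1) tendsto_Pair[OF that(2,3)]] that(4,5) by auto
  have lims: "(\<lambda>n. c1 n (grid_down t T n r)) \<longlonglongrightarrow> of_bool (r < \<tau>) * fx r (X r) \<and>
      (\<lambda>n. c2 n (grid_down t T n r)) \<longlonglongrightarrow> of_bool (r < \<tau>) * (fs r (X r) + fxx r (X r) / 2)"
    if r: "r \<in> {t..<T}" "r \<noteq> \<tau>" for r
  proof -
    define k where "k n = grid_down t T n r" for n
    have rT: "r \<in> {t..T}" "t \<le> r" using r by auto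
    have k: "k n < Suc n" for n using grid_down_less[OF tT'] r by (simp add: k_def)
    have g_lim: "(\<lambda>n. ?g n (k n)) \<longlonglongrightarrow> r" "(\<lambda>n. ?g n (Suc (k n))) \<longlonglongrightarrow> r"
      unfolding k_def using grid_down_tendsto[OF tT' rT(2)] .
    have rng: "?g n (k n) \<in> {t..T}" "?g n (Suc (k n)) \<in> {t..T}" "\<eta> n (k n) \<in> {t..T}" for n
      using in_range[of "k n" n] in_range[of "Suc (k n)" n] \<eta>_range[OF k] k[of n] by auto
    note xl = X_lim[OF g_lim(1) rT(1) rng(1)] X_lim[OF g_lim(2) rT(1) rng(2)]
    note wl = W_lim[OF g_lim(1) rT(1) rng(1)] W_lim[OF g_lim(2) rT(1) rng(2)]
    have mid: "(\<lambda>n. X (?g n (k n)) + (W (?g n (Suc (k n))) - W (?g n (k n)))) \<longlonglongrightarrow> X r"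
      using tendsto_add[OF xl(1) tendsto_diff[OF wl(2,1)]] by simp
    have "(\<lambda>n. lo n (k n)) \<longlonglongrightarrow> X r" "(\<lambda>n. hi n (k n)) \<longlonglongrightarrow> X r"
      unfolding lo_def hi_def using tendsto_min[OF mid xl(2)] tendsto_max[OF mid xl(2)] by simp_all
    then have \<xi>l: "(\<lambda>n. \<xi> n (k n)) \<longlonglongrightarrow> X r"
      using \<xi>(1) by (intro tendsto_sandwich[of "\<lambda>n. lo n (k n)" "\<lambda>n. \<xi> n (k n)" _ "\<lambda>n. hi n (k n)"]) auto
    have \<eta>l: "(\<lambda>n. \<eta> n (k n)) \<longlonglongrightarrow> r"
      using \<eta>(1) g_lim by (intro tendsto_sandwich[of "\<lambda>n. ?g n (k n)" "\<lambda>n. \<eta> n (k n)" _ "\<lambda>n. ?g n (Suc (k n))"]) auto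
    have "eventually (\<lambda>n. (?g n (k n) < \<tau>) = (r < \<tau>)) sequentially"
    proof (cases "r < \<tau>")
      case True
      then have "?g n (k n) < \<tau>" for n using grid_down_bounds(1)[OF tT' rT(2), of n] by (simp add: k_def)
      then show ?thesis using True by simp
    next
      case False
      then have "\<tau> < r" using r by simp
      from order_tendstoD(1)[OF g_lim(1) this] show ?thesis using False by (auto elim: eventually_mono)
    qed
    then have ind: "(\<lambda>n. of_bool (?g n (k n) < \<tau>) :: real) \<longlonglongrightarrow> of_bool (r < \<tau>)"
      by (rule tendsto_eventually[OF eventually_mono]) simp
    show ?thesis
      unfolding c1_def c2_def k_def[symmetric]
      by (intro conjI tendsto_mult tendsto_add tendsto_divide tendsto_const ind
          f_lim[OF cont_x g_lim(2) \<xi>l rT(1) rng(2)] f_lim[OF cont_s \<eta>l xl(1) rT(1) rng(3)]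
          f_lim[OF cont_xx g_lim(2) xl(1) rT(1) rng(2)]) simp
  qed
  have ne: "AE r in lborel. r \<noteq> \<tau>" by (rule AE_lborel_singleton)
  have lim1: "AE r in lborel. r \<in> {t..<T} \<longrightarrow> (\<lambda>n. c1 n (grid_down t T n r)) \<longlonglongrightarrow> of_bool (r < \<tau>) * fx r (X r)"
    using ne by eventually_elim (blast dest: lims)
  have lim2: "AE r in lborel. r \<in> {t..<T} \<longrightarrow>
      (\<lambda>n. c2 n (grid_down t T n r)) \<longlonglongrightarrow> of_bool (r < \<tau>) * (fs r (X r) + fxx r (X r) / 2)"
    using ne by eventually_elim (blast dest: lims)
  have cont_path: "continuous_on {t..T} (\<lambda>r. F r (X r))"
    if "continuous_on ({t..T} \<times> UNIV) (\<lambda>(s, y). F s y)" for F :: "real \<Rightarrow> real \<Rightarrow> real"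
    using continuous_on_compose2[OF that continuous_on_Pair[OF continuous_on_id X_cont]] by auto
  have meas_path: "(\<lambda>r. indicator {t..<T} r * (of_bool (r < \<tau>) * h r)) \<in> borel_measurable lborel"
    if "continuous_on {t..T} h" for h :: "real \<Rightarrow> real"
  proof -
    have "(\<lambda>r. indicator {t..T} r *\<^sub>R h r) \<in> borel_measurable lborel"
      using borel_measurable_continuous_on_indicator[OF _ that] by simp
    then have "(\<lambda>r. indicator {t..<T} r * (of_bool (r < \<tau>) * (indicator {t..T} r *\<^sub>R h r))) \<in> borel_measurable lborel"
      by measurable
    then show ?thesis by (rule measurable_cong[THEN iffD1, rotated]) (simp add: indicator_def)
  qed
  have dm: "(\<lambda>r. indicator {t..<T} r *\<^sub>R excursion_drift X r) \<in> borel_measurable lborel"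
    using dr unfolding set_integrable_def by (rule borel_measurable_integrable)
  have m1: "(\<lambda>r. indicator {t..<T} r * (of_bool (r < \<tau>) * fx r (X r) * excursion_drift X r)) \<in> borel_measurable lborel"
    using borel_measurable_times[OF meas_path[OF cont_path[OF cont_x]] dm]
    by (rule measurable_cong[THEN iffD1, rotated]) (simp add: indicator_def)
  have "continuous_on {t..T} (\<lambda>r. fs r (X r) + fxx r (X r) / 2)"
    by (intro continuous_intros cont_path cont_s cont_xx) simp
  then have m2: "(\<lambda>r. indicator {t..<T} r * (of_bool (r < \<tau>) * (fs r (X r) + fxx r (X r) / 2) * 1)) \<in> borel_measurable lborel"
    using meas_path by simp
  have L1: "(\<lambda>n. \<Sum>k<Suc n. c1 n k * (LBINT r:{?g n k..<?g n (Suc k)}. excursion_drift X r))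
      \<longlonglongrightarrow> (LBINT r:{t..<T}. of_bool (r < \<tau>) * fx r (X r) * excursion_drift X r)"
    by (rule grid_cells_tendsto[OF tT' dr _ lim1 m1, of B]) (rule c1_bound)
  have L2: "(\<lambda>n. \<Sum>k<Suc n. c2 n k * (LBINT r:{?g n k..<?g n (Suc k)}. 1))
      \<longlonglongrightarrow> (LBINT r:{t..<T}. of_bool (r < \<tau>) * (fs r (X r) + fxx r (X r) / 2) * 1)"
    by (rule grid_cells_tendsto[OF tT' one _ lim2 m2, of "2 * B"]) (rule c2_bound)
  show "D \<longlonglongrightarrow> G"
    using tendsto_add[OF L1 L2] unfolding D_eq[abs_def] G_def by simp
  assume gen: "\<And>r. r \<in> {t..<\<tau>} \<Longrightarrow> 0 < X r \<Longrightarrow> fs r (X r) + fxx r (X r) / 2 + fx r (X r) * excursion_drift X r \<le> 0"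
  have i1: "integrable lborel (\<lambda>r. indicator {t..<T} r * (of_bool (r < \<tau>) * fx r (X r) * excursion_drift X r))"
  proof (rule Bochner_Integration.integrable_bound[OF _ m1])
    show "integrable lborel (\<lambda>r. B * (indicator {t..<T} r * \<bar>excursion_drift X r\<bar>))"
      using set_integrable_abs[OF dr] unfolding set_integrable_def by (intro integrable_mult_right) simp
    have "\<bar>fx r (X r)\<bar> * \<bar>excursion_drift X r\<bar> \<le> B * \<bar>excursion_drift X r\<bar>" if "r \<in> {t..<T}" for r
      using bound_x[of r "X r"] that by (intro mult_right_mono) auto
    then show "AE r in lborel. norm (indicator {t..<T} r * (of_bool (r < \<tau>) * fx r (X r) * excursion_drift X r)) \<le>
        norm (B * (indicator {t..<T} r * \<bar>excursion_drift X r\<bar>))"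
      using B0 by (intro AE_I2) (simp add: indicator_def abs_mult)
  qed
  have i2: "integrable lborel (\<lambda>r. indicator {t..<T} r * (of_bool (r < \<tau>) * (fs r (X r) + fxx r (X r) / 2) * 1))"
  proof (rule Bochner_Integration.integrable_bound[OF _ m2])
    show "integrable lborel (\<lambda>r. 2 * B * (indicator {t..<T} r * \<bar>1::real\<bar>))"
      using set_integrable_abs[OF one] unfolding set_integrable_def by (intro integrable_mult_right) simp
    have "\<bar>fs r (X r) + fxx r (X r) / 2\<bar> \<le> 2 * B" if "r \<in> {t..<T}" for r
      using bound_s[of r "X r"] bound_xx[of r "X r"] that by (auto simp: abs_le_iff)
    then show "AE r in lborel. norm (indicator {t..<T} r * (of_bool (r < \<tau>) * (fs r (X r) + fxx r (X r) / 2) * 1)) \<le>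
        norm (2 * B * (indicator {t..<T} r * \<bar>1::real\<bar>))"
      using B0 by (intro AE_I2) (simp add: indicator_def abs_mult)
  qed
  have "G =
      (\<integral>r. indicator {t..<T} r * (of_bool (r < \<tau>) * fx r (X r) * excursion_drift X r) +
        indicator {t..<T} r * (of_bool (r < \<tau>) * (fs r (X r) + fxx r (X r) / 2) * 1) \<partial>lborel)"
    using Bochner_Integration.integral_add[OF i1 i2] by (simp add: G_def set_lebesgue_integral_def)
  also have "\<dots> \<le> (\<integral>r. 0 \<partial>(lborel :: real measure))"
  proof (rule integral_mono_AE)
    show "AE r in lborel. indicator {t..<T} r * (of_bool (r < \<tau>) * fx r (X r) * excursion_drift X r) +
        indicator {t..<T} r * (of_bool (r < \<tau>) * (fs r (X r) + fxx r (X r) / 2) * 1) \<le> 0"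
      using X_pos_AE
    proof eventually_elim
      case (elim r)
      then show ?case using gen[of r] by (auto simp: indicator_def of_bool_def)
    qed
  qed (use i1 i2 in auto)
  finally show "G \<le> 0" by simp
qed

end

section \<open>A Dynkin inequality\<close>

context brownian_excursion begin

lemma X_measurable: "s \<in> {t..1} \<Longrightarrow> X s \<in> borel_measurable M"
  by (rule measurable_F_M[OF _ adapted_X]) (use t_range in auto)

text \<open>Almost every path is an excursion path in the above sense, with an integrable noise bound.\<close>

lemma excursion_paths:
  assumes T: "t < T" "T < 1"
  obtains Z where "integrable M Z" "\<And>\<omega>. 0 \<le> Z \<omega>"
    "AE \<omega> in M. excursion_path t T x (Z \<omega>) (\<lambda>s. X s \<omega>) (\<lambda>s. W s \<omega>)"
proof -
  obtain Z where Z: "integrable M Z" "\<And>\<omega>. 0 \<le> Z \<omega>"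
    "AE \<omega> in M. \<forall>s\<in>{t..T}. \<bar>W s \<omega> - W t \<omega>\<bar> \<le> Z \<omega>"
    using integrable_sup_bound[OF t_range(1) T(1)] by blast
  have "AE \<omega> in M. excursion_path t T x (Z \<omega>) (\<lambda>s. X s \<omega>) (\<lambda>s. W s \<omega>)"
    using Z(3) W_continuous X_start X_sde AE_space
  proof eventually_elim
    case (elim \<omega>)
    show ?case
    proof
      show "continuous_on {t..T} (\<lambda>s. W s \<omega>)"
        by (rule continuous_on_subset[OF elim(2)]) (use t_range in auto)
      show "continuous_on {t..T} (\<lambda>s. X s \<omega>)"
        by (rule continuous_on_subset[OF X_continuous[OF elim(5)]]) (use T in auto)
      show "0 \<le> X s \<omega>" if "s \<in> {t..T}" for s by (rule X_nonneg[OF elim(5)]) (use that T in auto)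
      show "(\<integral>\<^sup>+r\<in>{t..T}. 1 / ennreal (X r \<omega>) \<partial>lborel) < \<infinity>" using bspec[OF elim(4), of T] T by simp
      show "X s \<omega> = X t \<omega> + (LBINT r:{t..s}. 1 / X r \<omega> - X r \<omega> / (1 - r)) + (W s \<omega> - W t \<omega>)"
        if "s \<in> {t..T}" for s
        using bspec[OF elim(4), of s] that T by simp
      show "\<bar>W s \<omega> - W t \<omega>\<bar> \<le> Z \<omega>" if "s \<in> {t..T}" for s using elim(1) that by blast
    qed (fact t_range(1) T elim(3))+
  qed
  with Z(1,2) show ?thesis by (rule that)
qed

text \<open>If \<open>f\<^sub>s + f\<^sub>x\<^sub>x / 2 + f\<^sub>x \<cdot> drift \<le> 0\<close> along the path before \<open>\<tau>\<close>, then \<open>f\<close> does not increase in the mean up to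
  \<open>\<tau>\<close>. In the proof \<open>S\<close> is the increment of \<open>f\<close> up to the grid point above \<open>\<tau>\<close>, the sum of the \<open>I\<close> is the
  effect of the Brownian increments, which tends to zero in the mean, and \<open>D\<close> is the remainder,
  which converges along each path to the integral of the generator. Points with \<open>X = 0\<close> are excluded
  in the hypothesis since the drift is singular there; almost no path spends time in them.\<close>

lemma dynkin_inequality:
  assumes T: "t < T" "T < 1"
    and test: "test_function t T B f fs fx fxx"
    and \<tau>: "stopping_time F \<tau>" "\<And>\<omega>. \<omega> \<in> space M \<Longrightarrow> \<tau> \<omega> \<in> {t..T}"
    and generator: "\<And>\<omega> r. \<omega> \<in> space M \<Longrightarrow> r \<in> {t..<\<tau> \<omega>} \<Longrightarrow> 0 < X r \<omega> \<Longrightarrow>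
      fs r (X r \<omega>) + fxx r (X r \<omega>) / 2 + fx r (X r \<omega>) * excursion_drift (\<lambda>s. X s \<omega>) r \<le> 0"
  shows "integrable M (\<lambda>\<omega>. f (\<tau> \<omega>) (X (\<tau> \<omega>) \<omega>))"
    and "expectation (\<lambda>\<omega>. f (\<tau> \<omega>) (X (\<tau> \<omega>) \<omega>)) \<le> f t x"
proof -
  interpret test_function t T B f fs fx fxx by fact
  let ?g = "grid t T"
  have B0: "0 \<le> B" using B_nonneg T by simp
  have g_range: "?g n k \<in> {t..T}" if "k \<le> Suc n" for n k using grid_range[OF T(1) that] .
  have g_range1: "?g n k \<in> {t..1}" if "k \<le> Suc n" for n k using g_range[OF that] T by simp
  have g_nonneg: "0 \<le> ?g n k" for n k using grid_ge[OF T(1), of n k] t_range by simp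
  have g_step: "?g n k < ?g n (Suc k)" for n k by (simp add: grid_strict_iff[OF T(1)])
  define \<delta> where "\<delta> n = (T - t) / real (Suc n)" for n
  have mesh: "?g n (Suc k) - ?g n k = \<delta> n" for n k by (simp add: grid_Suc \<delta>_def)
  have \<delta>0: "0 < \<delta> n" for n using T by (simp add: \<delta>_def)
  define h where "h n k \<omega> = (of_bool (?g n k < \<tau> \<omega>) :: real)" for n k \<omega>
  have h_F: "h n k \<in> borel_measurable (F (?g n k))" for n k
    unfolding h_def[abs_def] by (rule stopping_time_indicator[OF \<tau>(1)])
  have h_M[measurable]: "h n k \<in> borel_measurable M" for n k
    using measurable_F_M[OF g_nonneg h_F] .
  have h_le: "\<bar>h n k \<omega>\<bar> \<le> 1" for n k \<omega> by (simp add: h_def)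
  define S where "S n \<omega> = (\<Sum>k<Suc n. h n k \<omega> * (f (?g n (Suc k)) (X (?g n (Suc k)) \<omega>) - f (?g n k) (X (?g n k) \<omega>)))" for n \<omega>
  define I where "I n k \<omega> = h n k \<omega> * (f (?g n (Suc k)) (X (?g n k) \<omega> + (W (?g n (Suc k)) \<omega> - W (?g n k) \<omega>))
      - f (?g n (Suc k)) (X (?g n k) \<omega>) - (?g n (Suc k) - ?g n k) / 2 * fxx (?g n (Suc k)) (X (?g n k) \<omega>))" for n k \<omega>
  define D where "D n \<omega> = (\<Sum>k<Suc n. of_bool (?g n k < \<tau> \<omega>) *
      cell_remainder f fxx (\<lambda>s. X s \<omega>) (\<lambda>s. W s \<omega>) (?g n k) (?g n (Suc k)))" for n \<omega>
  have S_eq: "S n \<omega> = D n \<omega> + (\<Sum>k<Suc n. I n k \<omega>)" for n \<omega>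
    unfolding S_def D_def sum.distrib[symmetric] h_def I_def cell_remainder_def
    by (intro sum.cong refl) (simp add: algebra_simps)
  have I_int: "integrable M (I n k)" "\<bar>expectation (I n k)\<bar> \<le> 2 * B * \<delta> n * sqrt (\<delta> n)" if "k < Suc n" for n k
    unfolding I_def[abs_def] mesh[symmetric, of n k]
    using g_range[of "Suc k" n] g_range1[of k n] that
    by (intro expected_increment_test_function[OF test g_nonneg g_step _ h_F h_le adapted_X]; simp)+
  have noise: "(\<lambda>n. expectation (\<lambda>\<omega>. \<Sum>k<Suc n. I n k \<omega>)) \<longlonglongrightarrow> 0"
  proof (rule Lim_null_comparison)
    have "\<bar>expectation (\<lambda>\<omega>. \<Sum>k<Suc n. I n k \<omega>)\<bar> \<le> 2 * B * (T - t) * sqrt (\<delta> n)" for n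
    proof -
      have "expectation (\<lambda>\<omega>. \<Sum>k<Suc n. I n k \<omega>) = (\<Sum>k<Suc n. expectation (I n k))"
        using I_int(1)[of _ n] by (intro Bochner_Integration.integral_sum) simp
      also have "\<bar>\<dots>\<bar> \<le> (\<Sum>k<Suc n. 2 * B * \<delta> n * sqrt (\<delta> n))"
        by (rule order_trans[OF sum_abs sum_mono]) (use I_int(2)[of _ n] in simp)
      also have "\<dots> = real (Suc n) * \<delta> n * (2 * B * sqrt (\<delta> n))"
        by simp
      also have "real (Suc n) * \<delta> n = T - t" by (simp add: \<delta>_def del: of_nat_Suc)
      finally show ?thesis by (simp only: mult_ac)
    qed
    then show "eventually (\<lambda>n. norm (expectation (\<lambda>\<omega>. \<Sum>k<Suc n. I n k \<omega>)) \<le> 2 * B * (T - t) * sqrt (\<delta> n)) sequentially"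
      by simp
    have "(\<lambda>n. sqrt (\<delta> n)) \<longlonglongrightarrow> sqrt 0"
      unfolding \<delta>_def by (intro tendsto_real_sqrt grid_mesh_tendsto[OF T(1)])
    then show "(\<lambda>n. 2 * B * (T - t) * sqrt (\<delta> n)) \<longlonglongrightarrow> 0"
      using tendsto_mult_right_zero by fastforce
  qed
  obtain Z where Z: "integrable M Z" "\<And>\<omega>. 0 \<le> Z \<omega>"
    "AE \<omega> in M. excursion_path t T x (Z \<omega>) (\<lambda>s. X s \<omega>) (\<lambda>s. W s \<omega>)"
    using excursion_paths[OF T] by blast
  have path: "AE \<omega> in M. excursion_path_test_function t T x (Z \<omega>) (\<lambda>s. X s \<omega>) (\<lambda>s. W s \<omega>) B f fs fx fxx \<and> \<omega> \<in> space M"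
    using Z(3) AE_space by eventually_elim (use test in \<open>auto simp: excursion_path_test_function_def\<close>)
  have f_M: "(\<lambda>\<omega>. f s (X r \<omega>)) \<in> borel_measurable M" if "s \<in> {t..T}" "r \<in> {t..1}" for s r
  proof -
    have "continuous_on UNIV (f s)" using deriv_x[OF that(1)] by (auto intro!: DERIV_continuous_on)
    from measurable_compose[OF X_measurable[OF that(2)] borel_measurable_continuous_onI[OF this]] show ?thesis .
  qed
  have S_M: "S n \<in> borel_measurable M" for n
    unfolding S_def[abs_def]
  proof (intro borel_measurable_sum borel_measurable_times borel_measurable_diff h_M f_M)
  qed (use g_range[of _ n] g_range1[of _ n] in auto)
  have D_M: "D n \<in> borel_measurable M" for n
  proof -
    have "(\<lambda>\<omega>. S n \<omega> - (\<Sum>k<Suc n. I n k \<omega>)) \<in> borel_measurable M"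
      using I_int(1)[of _ n] S_M[of n] by (intro borel_measurable_diff borel_measurable_sum) (auto dest: borel_measurable_integrable)
    then show ?thesis by (simp add: S_eq del: sum.lessThan_Suc)
  qed
  have S_val: "S n \<omega> = f (?g n (grid_up t T n (\<tau> \<omega>))) (X (?g n (grid_up t T n (\<tau> \<omega>))) \<omega>) - f t (X t \<omega>)"
    if "\<omega> \<in> space M" for n \<omega>
    unfolding S_def h_def
    using grid_telescope[OF T(1), of "\<tau> \<omega>" n "\<lambda>k. f (?g n k) (X (?g n k) \<omega>)"] \<tau>(2)[OF that] by simp
  define L where "L \<omega> = f (\<tau> \<omega>) (X (\<tau> \<omega>) \<omega>) - f t (X t \<omega>)" for \<omega>
  have S_lim: "(\<lambda>n. S n \<omega>) \<longlonglongrightarrow> L \<omega>" if \<omega>: "\<omega> \<in> space M" for \<omega>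
    unfolding S_val[OF \<omega>] L_def
  proof (intro tendsto_diff tendsto_const)
    define u where "u n = ?g n (grid_up t T n (\<tau> \<omega>))" for n
    have u: "u \<longlonglongrightarrow> \<tau> \<omega>" "\<And>n. u n \<in> {t..T}"
      unfolding u_def using grid_up_tendsto[OF T(1)] g_range[OF grid_up_le[OF T(1)]] \<tau>(2)[OF \<omega>] by auto
    have u1: "u n \<in> {t..1}" for n using u(2)[of n] T by simp
    have Xu: "(\<lambda>n. X (u n) \<omega>) \<longlonglongrightarrow> X (\<tau> \<omega>) \<omega>"
      by (rule continuous_on_tendsto_compose[OF X_continuous[OF \<omega>] u(1)]) (use u1 \<tau>(2)[OF \<omega>] T in auto)
    have "(\<lambda>n. f (u n) (X (u n) \<omega>) - f (\<tau> \<omega>) (X (\<tau> \<omega>) \<omega>)) \<longlonglongrightarrow> 0"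
    proof (rule Lim_null_comparison)
      show "eventually (\<lambda>n. norm (f (u n) (X (u n) \<omega>) - f (\<tau> \<omega>) (X (\<tau> \<omega>) \<omega>)) \<le>
          B * (\<bar>u n - \<tau> \<omega>\<bar> + \<bar>X (u n) \<omega> - X (\<tau> \<omega>) \<omega>\<bar>)) sequentially"
        using lipschitz[OF \<tau>(2)[OF \<omega>] u(2)] by simp
      have "(\<lambda>n. B * (\<bar>u n - \<tau> \<omega>\<bar> + \<bar>X (u n) \<omega> - X (\<tau> \<omega>) \<omega>\<bar>)) \<longlonglongrightarrow>
          B * (\<bar>\<tau> \<omega> - \<tau> \<omega>\<bar> + \<bar>X (\<tau> \<omega>) \<omega> - X (\<tau> \<omega>) \<omega>\<bar>)"
        by (intro tendsto_intros u Xu)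
      then show "(\<lambda>n. B * (\<bar>u n - \<tau> \<omega>\<bar> + \<bar>X (u n) \<omega> - X (\<tau> \<omega>) \<omega>\<bar>)) \<longlonglongrightarrow> 0" by simp
    qed
    then show "(\<lambda>n. f (u n) (X (u n) \<omega>)) \<longlonglongrightarrow> f (\<tau> \<omega>) (X (\<tau> \<omega>) \<omega>)" by (simp add: LIM_zero_iff)
  qed
  have L_M: "L \<in> borel_measurable M"
    by (rule borel_measurable_LIMSEQ_real[OF S_lim S_M])
  define b where "b \<omega> = max x 1 + 1 + 2 * Z \<omega>" for \<omega>
  have b_int: "integrable M b" unfolding b_def[abs_def] using Z(1) by auto
  have S_bound: "AE \<omega> in M. norm (S n \<omega>) \<le> B * (1 + 2 * b \<omega>)" for n
    using path
  proof eventually_elim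
    case (elim \<omega>)
    then interpret excursion_path_test_function t T x "Z \<omega>" "\<lambda>s. X s \<omega>" "\<lambda>s. W s \<omega>" B f fs fx fxx by simp
    have \<omega>: "\<omega> \<in> space M" using elim by simp
    define u where "u = ?g n (grid_up t T n (\<tau> \<omega>))"
    have u: "u \<in> {t..T}" unfolding u_def using g_range[OF grid_up_le[OF T(1)]] \<tau>(2)[OF \<omega>] by simp
    have "\<bar>S n \<omega>\<bar> \<le> B * (\<bar>u - t\<bar> + \<bar>X u \<omega> - X t \<omega>\<bar>)"
      unfolding S_val[OF \<omega>] u_def[symmetric] by (rule lipschitz) (use u T in auto)
    also have "\<dots> \<le> B * (1 + 2 * b \<omega>)"
    proof (rule mult_left_mono[OF _ B0])
      have "\<bar>X u \<omega> - X t \<omega>\<bar> \<le> 2 * b \<omega>"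
        using X_bound[OF u] X_bound[of t] X_nonneg[of u] X_nonneg[of t] u T unfolding b_def by auto
      then show "\<bar>u - t\<bar> + \<bar>X u \<omega> - X t \<omega>\<bar> \<le> 1 + 2 * b \<omega>" using u T t_range by auto
    qed
    finally show ?case by simp
  qed
  have S_int: "integrable M (S n)" for n
    by (rule Bochner_Integration.integrable_bound[OF _ S_M, of "\<lambda>\<omega>. B * (1 + 2 * b \<omega>)"])
       (use b_int S_bound[of n] in \<open>auto elim!: eventually_mono\<close>)
  have dom: "integrable M (\<lambda>\<omega>. B * (1 + 2 * b \<omega>))" using b_int by auto
  have S_AE: "AE \<omega> in M. (\<lambda>n. S n \<omega>) \<longlonglongrightarrow> L \<omega>" using S_lim by (rule AE_I2)
  have L_int: "integrable M L"
    by (rule integrable_dominated_convergence[OF L_M S_M dom S_AE S_bound])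
  have S_exp: "(\<lambda>n. expectation (S n)) \<longlonglongrightarrow> expectation L"
    by (rule integral_dominated_convergence[OF L_M S_M dom S_AE S_bound])
  define w where "w \<omega> = B * (b \<omega> * (1 + 2 / (1 - T)) + Z \<omega>) + 2 * B * (T - t)" for \<omega>
  have w_int: "integrable M w" unfolding w_def[abs_def] using b_int Z(1) by auto
  define G where "G \<omega> = lim (\<lambda>n. D n \<omega>)" for \<omega>
  have G_M: "G \<in> borel_measurable M"
    unfolding G_def[abs_def] using D_M by (rule borel_measurable_lim_metric)
  have D_path: "AE \<omega> in M. (\<lambda>n. D n \<omega>) \<longlonglongrightarrow> G \<omega> \<and> G \<omega> \<le> 0 \<and> (\<forall>n. norm (D n \<omega>) \<le> w \<omega>)"
    using path
  proof eventually_elim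
    case (elim \<omega>)
    then interpret excursion_path_test_function t T x "Z \<omega>" "\<lambda>s. X s \<omega>" "\<lambda>s. W s \<omega>" B f fs fx fxx by simp
    have \<omega>: "\<omega> \<in> space M" using elim by simp
    define l where "l = (LBINT r:{t..<T}. of_bool (r < \<tau> \<omega>) * fx r (X r \<omega>) * excursion_drift (\<lambda>s. X s \<omega>) r) +
      (LBINT r:{t..<T}. of_bool (r < \<tau> \<omega>) * (fs r (X r \<omega>) + fxx r (X r \<omega>) / 2))"
    have lim: "(\<lambda>n. D n \<omega>) \<longlonglongrightarrow> l"
      using path_grid_limit[OF \<tau>(2)[OF \<omega>]] unfolding D_def l_def .
    then have "G \<omega> = l" unfolding G_def by (rule limI)
    moreover have "l \<le> 0"
      unfolding l_def by (rule path_generator_nonpos[OF \<tau>(2)[OF \<omega>]]) (rule generator[OF \<omega>])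
    moreover have "\<bar>D n \<omega>\<bar> \<le> w \<omega>" for n
      using path_grid_bound[OF \<tau>(2)[OF \<omega>], of n] mult_left_mono[OF drift_abs_bound B0]
      unfolding D_def w_def b_def by linarith
    ultimately show ?case using lim by simp
  qed
  have D_AE: "AE \<omega> in M. (\<lambda>n. D n \<omega>) \<longlonglongrightarrow> G \<omega>" "AE \<omega> in M. G \<omega> \<le> 0"
    "AE \<omega> in M. norm (D n \<omega>) \<le> w \<omega>" for n
    by (rule AE_mp[OF D_path AE_I2], blast)+
  have D_exp: "(\<lambda>n. expectation (D n)) \<longlonglongrightarrow> expectation G"
    by (rule integral_dominated_convergence[OF G_M D_M w_int D_AE(1,3)])
  have D_int: "integrable M (D n)" for n
    by (rule Bochner_Integration.integrable_bound[OF w_int D_M]) (use D_AE(3)[of n] in \<open>auto elim!: eventually_mono\<close>)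
  have "expectation (S n) = expectation (D n) + expectation (\<lambda>\<omega>. \<Sum>k<Suc n. I n k \<omega>)" for n
    unfolding S_eq[abs_def] using D_int I_int(1)[of _ n]
    by (intro Bochner_Integration.integral_add Bochner_Integration.integrable_sum) auto
  then have "(\<lambda>n. expectation (S n)) \<longlonglongrightarrow> expectation G + 0"
    using tendsto_add[OF D_exp noise] by simp
  then have "expectation L = expectation G" using LIMSEQ_unique[OF S_exp] by simp
  also have "\<dots> \<le> 0"
    using integral_nonneg_AE[of "\<lambda>\<omega>. - G \<omega>" M] D_AE(2) by simp
  finally have L_le: "expectation L \<le> 0" .
  have eq: "AE \<omega> in M. L \<omega> + f t x = f (\<tau> \<omega>) (X (\<tau> \<omega>) \<omega>)"
    using X_start by eventually_elim (simp add: L_def)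
  have "(\<lambda>\<omega>. f (\<tau> \<omega>) (X (\<tau> \<omega>) \<omega>)) \<in> borel_measurable M"
  proof -
    have "(\<lambda>\<omega>. L \<omega> + f t (X t \<omega>)) \<in> borel_measurable M"
      using L_M f_M[of t t] T by (intro borel_measurable_add) auto
    then show ?thesis by (simp add: L_def)
  qed
  then show "integrable M (\<lambda>\<omega>. f (\<tau> \<omega>) (X (\<tau> \<omega>) \<omega>))"
    using integrable_cong_AE[OF _ _ eq] L_M L_int by simp
  have "expectation (\<lambda>\<omega>. f (\<tau> \<omega>) (X (\<tau> \<omega>) \<omega>)) = expectation (\<lambda>\<omega>. L \<omega> + f t x)"
    using eq L_M \<open>(\<lambda>\<omega>. f (\<tau> \<omega>) (X (\<tau> \<omega>) \<omega>)) \<in> borel_measurable M\<close> by (intro integral_cong_AE) auto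
  also have "\<dots> = expectation L + f t x" using L_int by (simp add: prob_space)
  finally show "expectation (\<lambda>\<omega>. f (\<tau> \<omega>) (X (\<tau> \<omega>) \<omega>)) \<le> f t x" using L_le by simp
qed

end

section \<open>The value function\<close>

lemma self_similar_ge: "s < 1 \<Longrightarrow> y \<le> self_similar profile s y"
  using profile_ge[of "y / sqrt (1 - s)"] mult_left_mono[of "y / sqrt (1 - s)" "profile (y / sqrt (1 - s))" "sqrt (1 - s)"]
  by (simp add: self_similar_def)

lemma self_similar_boundary: "s < 1 \<Longrightarrow> self_similar profile s (boundary s) = boundary s"
  by (simp add: self_similar_def boundary_def profile_C)

lemma self_similar_le_boundary:
  assumes "s < 1" "0 \<le> y" "y \<le> boundary s" shows "self_similar profile s y \<le> boundary s"
proof -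
  have "profile (y / sqrt (1 - s)) \<le> excursion_C"
    using assms by (intro profile_le_C) (auto simp: boundary_def field_simps)
  then show ?thesis using assms by (simp add: self_similar_def boundary_def mult.commute mult_right_mono)
qed

lemma continuous_boundary: "continuous_on S boundary"
  unfolding boundary_def[abs_def] by (intro continuous_intros)

lemma boundary_1 [simp]: "boundary 1 = 0"
  by (simp add: boundary_def)

lemma stopping_time_min_const:
  assumes "stopping_time F \<tau>" shows "stopping_time F (\<lambda>\<omega>. min (\<tau> \<omega>) (c :: real))"
  using assms by (intro stopping_time_min stopping_time_const)

context brownian_excursion begin

text \<open>The generator of a self-similar function, multiplied by \<open>\<surd>(1 - r)\<close>, depends on \<open>z\<close> only.\<close>

lemma self_similar_dynkin:
  assumes T: "t < T" "T < 1"
    and p: "\<And>z. (p has_real_derivative q z) (at z)" and q: "\<And>z. (q has_real_derivative h z) (at z)"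
    and bounds: "\<And>z. \<bar>q z\<bar> \<le> B" "\<And>z. \<bar>h z\<bar> \<le> B" "\<And>z. \<bar>z * q z - p z\<bar> \<le> B"
    and lip: "\<And>z w. \<bar>h z - h w\<bar> \<le> B * \<bar>z - w\<bar>" and h: "continuous_on UNIV h"
    and \<tau>: "stopping_time F \<tau>" "\<And>\<omega>. \<omega> \<in> space M \<Longrightarrow> \<tau> \<omega> \<in> {t..T}"
    and generator: "\<And>\<omega> r z. \<omega> \<in> space M \<Longrightarrow> r \<in> {t..<\<tau> \<omega>} \<Longrightarrow> 0 < X r \<omega> \<Longrightarrow> z = X r \<omega> / sqrt (1 - r) \<Longrightarrow>
      h z / 2 + (1 / z - z / 2) * q z - p z / 2 \<le> 0"
  shows "integrable M (\<lambda>\<omega>. self_similar p (\<tau> \<omega>) (X (\<tau> \<omega>) \<omega>))"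
    and "expectation (\<lambda>\<omega>. self_similar p (\<tau> \<omega>) (X (\<tau> \<omega>) \<omega>)) \<le> self_similar p t x"
proof -
  note test = test_function_self_similar[OF T(2) p q bounds lip h]
  have gen: "(X r \<omega> / sqrt (1 - r) * q (X r \<omega> / sqrt (1 - r)) - p (X r \<omega> / sqrt (1 - r))) / (2 * sqrt (1 - r)) +
      h (X r \<omega> / sqrt (1 - r)) / sqrt (1 - r) / 2 +
      q (X r \<omega> / sqrt (1 - r)) * excursion_drift (\<lambda>s. X s \<omega>) r \<le> 0"
    if \<omega>: "\<omega> \<in> space M" and r: "r \<in> {t..<\<tau> \<omega>}" and X0: "0 < X r \<omega>" for \<omega> r
  proof -
    define \<rho> where "\<rho> = sqrt (1 - r)"
    define z where "z = X r \<omega> / \<rho>"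
    have \<rho>: "0 < \<rho>" "1 - r = \<rho> * \<rho>" using r \<tau>(2)[OF \<omega>] T by (auto simp: \<rho>_def)
    have z: "X r \<omega> = \<rho> * z" "0 < z" using \<rho> X0 by (auto simp: z_def)
    have "(z * q z - p z) / (2 * \<rho>) + h z / \<rho> / 2 + q z * (1 / (\<rho> * z) - \<rho> * z / (\<rho> * \<rho>)) =
        (h z / 2 + (1 / z - z / 2) * q z - p z / 2) / \<rho>"
      using \<rho>(1) z(2) by (simp add: field_simps)
    also have "\<dots> \<le> 0"
    proof (rule divide_nonpos_pos[OF _ \<rho>(1)])
      show "h z / 2 + (1 / z - z / 2) * q z - p z / 2 \<le> 0"
        by (rule generator[OF \<omega> r X0]) (simp add: z_def \<rho>_def)
    qed
    finally show ?thesis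
      unfolding excursion_drift_def \<rho>_def[symmetric] z_def[symmetric] unfolding \<rho>(2) z(1) .
  qed
  show "integrable M (\<lambda>\<omega>. self_similar p (\<tau> \<omega>) (X (\<tau> \<omega>) \<omega>))"
    by (rule dynkin_inequality(1)[OF T test \<tau>]) (use gen in auto)
  show "expectation (\<lambda>\<omega>. self_similar p (\<tau> \<omega>) (X (\<tau> \<omega>) \<omega>)) \<le> self_similar p t x"
    by (rule dynkin_inequality(2)[OF T test \<tau>]) (use gen in auto)
qed

text \<open>The self-similar function with profile \<open>z\<close> is the identity in space. Above \<open>\<surd>(1 - r)\<close> the drift of \<open>X\<close>
  is non-positive, which is the meaning of \<open>1 / z \<le> z\<close>.\<close>

lemma expectation_above_root_le:
  assumes T: "t < T" "T < 1"
    and \<tau>: "stopping_time F \<tau>" "\<And>\<omega>. \<omega> \<in> space M \<Longrightarrow> \<tau> \<omega> \<in> {t..T}"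
    and above: "\<And>\<omega> r. \<omega> \<in> space M \<Longrightarrow> r \<in> {t..<\<tau> \<omega>} \<Longrightarrow> sqrt (1 - r) \<le> X r \<omega>"
  shows "integrable M (\<lambda>\<omega>. X (\<tau> \<omega>) \<omega>)" and "expectation (\<lambda>\<omega>. X (\<tau> \<omega>) \<omega>) \<le> x"
proof -
  have gen: "0 / 2 + (1 / z - z / 2) * 1 - z / 2 \<le> 0"
    if "\<omega> \<in> space M" "r \<in> {t..<\<tau> \<omega>}" "0 < X r \<omega>" "z = X r \<omega> / sqrt (1 - r)" for \<omega> r z
  proof -
    have "1 \<le> z" using above[OF that(1,2)] \<tau>(2)[OF that(1)] T that by simp
    then have "1 / z \<le> 1" by simp
    then have "1 / z \<le> z" using \<open>1 \<le> z\<close> by linarith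
    then show ?thesis by simp
  qed
  have eq: "self_similar (\<lambda>z. z) s y = y" if "s < 1" for s y using that by (simp add: self_similar_def)
  have cong: "integrable M (\<lambda>\<omega>. self_similar (\<lambda>z. z) (\<tau> \<omega>) (X (\<tau> \<omega>) \<omega>)) = integrable M (\<lambda>\<omega>. X (\<tau> \<omega>) \<omega>)"
    "expectation (\<lambda>\<omega>. self_similar (\<lambda>z. z) (\<tau> \<omega>) (X (\<tau> \<omega>) \<omega>)) = expectation (\<lambda>\<omega>. X (\<tau> \<omega>) \<omega>)"
    using \<tau>(2) T by (force intro!: Bochner_Integration.integrable_cong Bochner_Integration.integral_cong eq)+
  note dyn = self_similar_dynkin[OF T _ _ _ _ _ _ _ \<tau>, of "\<lambda>z. z" "\<lambda>_. 1" "\<lambda>_. 0" 1]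
  show "integrable M (\<lambda>\<omega>. X (\<tau> \<omega>) \<omega>)"
    unfolding cong(1)[symmetric] by (rule dyn(1)) ((erule (3) gen) | simp)+
  have "expectation (\<lambda>\<omega>. self_similar (\<lambda>z. z) (\<tau> \<omega>) (X (\<tau> \<omega>) \<omega>)) \<le> self_similar (\<lambda>z. z) t x"
    by (rule dyn(2)) ((erule (3) gen) | simp)+
  then show "expectation (\<lambda>\<omega>. X (\<tau> \<omega>) \<omega>) \<le> x"
    unfolding cong(2) using eq t_range by simp
qed

abbreviation stopped_profile :: "('a \<Rightarrow> real) \<Rightarrow> 'a \<Rightarrow> real" where
  "stopped_profile \<sigma> \<omega> \<equiv> self_similar profile (\<sigma> \<omega>) (X (\<sigma> \<omega>) \<omega>)"

text \<open>As long as \<open>X\<close> stays below \<open>N\<close>, the profile may be replaced by a cutoff that has a vanishing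
  generator there. The Dynkin inequality for the cutoff and for its negative gives equality. At the
  time \<open>\<tau>\<close> itself the bound \<open>N\<close> follows by continuity, or from \<open>x \<le> N\<close> if \<open>\<tau> = t\<close>.\<close>

lemma expectation_profile:
  assumes T: "t < T" "T < 1"
    and \<tau>: "stopping_time F \<tau>" "\<And>\<omega>. \<omega> \<in> space M \<Longrightarrow> \<tau> \<omega> \<in> {t..T}"
    and bounded: "x \<le> N" "\<And>\<omega> r. \<omega> \<in> space M \<Longrightarrow> r \<in> {t..<\<tau> \<omega>} \<Longrightarrow> X r \<omega> \<le> N"
  shows "integrable M (\<lambda>\<omega>. stopped_profile \<tau> \<omega>)"
    and "expectation (\<lambda>\<omega>. stopped_profile \<tau> \<omega>) = self_similar profile t x"
proof -
  define R where "R = N / sqrt (1 - T)"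
  have N0: "0 \<le> N" using bounded(1) x_nonneg by simp
  then have R0: "0 \<le> R" using T by (simp add: R_def)
  obtain g3 where g3: "\<And>z. (profile_deriv2 has_real_derivative g3 z) (at z)" "continuous_on UNIV g3"
    by (rule profile_deriv2_deriv) blast
  obtain p q h B where pqh: "\<And>z. (p has_real_derivative q z) (at z)" "\<And>z. (q has_real_derivative h z) (at z)"
    "\<And>z. \<bar>q z\<bar> \<le> B" "\<And>z. \<bar>h z\<bar> \<le> B" "\<And>z. \<bar>z * q z - p z\<bar> \<le> B"
    "\<And>z w. \<bar>h z - h w\<bar> \<le> B * \<bar>z - w\<bar>" "continuous_on UNIV h"
    and agree: "\<And>z. \<bar>z\<bar> \<le> R \<Longrightarrow> p z = profile z" "\<And>z. \<bar>z\<bar> \<le> R \<Longrightarrow> q z = profile_deriv z"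
    "\<And>z. \<bar>z\<bar> \<le> R \<Longrightarrow> h z = profile_deriv2 z"
    by (rule cutoff_extension[OF DERIV_profile DERIV_profile_deriv g3 R0]) blast
  have in_R: "\<bar>y / sqrt (1 - s)\<bar> \<le> R" if "0 \<le> y" "y \<le> N" "s \<le> T" for s y
    unfolding R_def using that T N0 by (auto intro!: frac_le)
  have ode: "h z / 2 + (1 / z - z / 2) * q z - p z / 2 = 0"
    if "\<omega> \<in> space M" "r \<in> {t..<\<tau> \<omega>}" "0 < X r \<omega>" "z = X r \<omega> / sqrt (1 - r)" for \<omega> r z
  proof -
    have "r < 1" using that(1,2) \<tau>(2)[OF that(1)] T by auto
    then have "\<bar>z\<bar> \<le> R" "z \<noteq> 0"
      using in_R[of "X r \<omega>" r] bounded(2)[OF that(1,2)] that \<tau>(2)[OF that(1)] by auto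
    then show ?thesis using profile_ode[of z] agree[of z] by simp
  qed
  have upper: "integrable M (\<lambda>\<omega>. self_similar p (\<tau> \<omega>) (X (\<tau> \<omega>) \<omega>))"
    "expectation (\<lambda>\<omega>. self_similar p (\<tau> \<omega>) (X (\<tau> \<omega>) \<omega>)) \<le> self_similar p t x"
    by (rule self_similar_dynkin[OF T pqh \<tau>]; (assumption | (rule eq_refl, erule (3) ode)))+
  have neg: "self_similar (\<lambda>z. - p z) s y = - self_similar p s y" for s y by (simp add: self_similar_def)
  have "expectation (\<lambda>\<omega>. self_similar (\<lambda>z. - p z) (\<tau> \<omega>) (X (\<tau> \<omega>) \<omega>)) \<le> self_similar (\<lambda>z. - p z) t x"
  proof (rule self_similar_dynkin(2)[OF T _ _ _ _ _ _ _ \<tau>])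
    show "((\<lambda>z. - p z) has_real_derivative - q z) (at z)" "((\<lambda>z. - q z) has_real_derivative - h z) (at z)" for z
      by (intro DERIV_minus pqh)+
    show "\<bar>- q z\<bar> \<le> B" "\<bar>- h z\<bar> \<le> B" "\<bar>z * - q z - - p z\<bar> \<le> B" "\<bar>- h z - - h w\<bar> \<le> B * \<bar>z - w\<bar>" for z w
      using pqh(3,4)[of z] pqh(5)[of z] pqh(6)[of z w] by (simp_all add: abs_minus_commute)
    show "continuous_on UNIV (\<lambda>z. - h z)" using pqh(7) by (rule continuous_on_minus)
    show "- h z / 2 + (1 / z - z / 2) * - q z - - p z / 2 \<le> 0"
      if "\<omega> \<in> space M" "r \<in> {t..<\<tau> \<omega>}" "0 < X r \<omega>" "z = X r \<omega> / sqrt (1 - r)" for \<omega> r z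
      using ode[OF that] by simp
  qed
  then have lower: "self_similar p t x \<le> expectation (\<lambda>\<omega>. self_similar p (\<tau> \<omega>) (X (\<tau> \<omega>) \<omega>))"
    unfolding neg using upper(1) by simp
  have eq: "AE \<omega> in M. self_similar p (\<tau> \<omega>) (X (\<tau> \<omega>) \<omega>) = stopped_profile \<tau> \<omega>"
    using X_start AE_space
  proof eventually_elim
    case (elim \<omega>)
    have \<tau>r: "\<tau> \<omega> \<in> {t..T}" by (rule \<tau>(2)[OF elim(2)])
    have "X (\<tau> \<omega>) \<omega> \<le> N"
    proof (cases "\<tau> \<omega> = t")
      case True then show ?thesis using elim bounded by simp
    next
      case False
      have "X (\<tau> \<omega>) \<omega> - N \<le> 0"
        by (rule continuous_le_at_endpoint[of t 1 "\<lambda>s. X s \<omega> - N"])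
           (use False \<tau>r T bounded(2)[OF elim(2)] in \<open>auto intro!: continuous_intros X_continuous[OF elim(2)]\<close>)
      then show ?thesis by simp
    qed
    then have "\<bar>X (\<tau> \<omega>) \<omega> / sqrt (1 - \<tau> \<omega>)\<bar> \<le> R"
      using X_nonneg[OF elim(2), of "\<tau> \<omega>"] \<tau>r T by (intro in_R) auto
    then show ?case by (simp add: self_similar_def agree(1))
  qed
  have meas: "(\<lambda>\<omega>. stopped_profile \<tau> \<omega>) \<in> borel_measurable M"
  proof -
    have "\<tau> \<in> borel_measurable M"
      by (rule stopping_time_measurable[OF \<tau>(1)]) (use \<tau>(2) t_range in force)
    moreover have "(\<lambda>\<omega>. X (\<tau> \<omega>) \<omega>) \<in> borel_measurable M"
      by (rule measurable_process_at_random_time[OF t_range(2) X_measurable X_continuous])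
         (use calculation \<tau>(2) T in force)+
    moreover have "profile \<in> borel_measurable borel"
      using continuous_profile by (rule borel_measurable_continuous_onI)
    ultimately show ?thesis unfolding self_similar_def by measurable
  qed
  show "integrable M (\<lambda>\<omega>. stopped_profile \<tau> \<omega>)"
    using upper(1) integrable_cong_AE[OF _ meas eq] by (auto dest: borel_measurable_integrable)
  have "expectation (\<lambda>\<omega>. stopped_profile \<tau> \<omega>) = expectation (\<lambda>\<omega>. self_similar p (\<tau> \<omega>) (X (\<tau> \<omega>) \<omega>))"
    using eq upper(1) meas by (intro integral_cong_AE[symmetric]) auto
  also have "\<dots> = self_similar p t x" using upper(2) lower by simp
  also have "\<dots> = self_similar profile t x"
    using in_R[OF x_nonneg bounded(1), of t] T by (simp add: self_similar_def agree(1))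
  finally show "expectation (\<lambda>\<omega>. stopped_profile \<tau> \<omega>) = self_similar profile t x" .
qed

end

context brownian_excursion begin

definition horizon :: "nat \<Rightarrow> real" where
  "horizon n = 1 - (1 - t) / real (n + 2)"

text \<open>The stopping time is cut at the time when \<open>X\<close> reaches \<open>n\<close> and at a deterministic horizon before 1,
  because the bounds on the drift and on self-similar functions hold only up to a time before 1.\<close>

definition localizer :: "('a \<Rightarrow> real) \<Rightarrow> nat \<Rightarrow> 'a \<Rightarrow> real" where
  "localizer \<tau> n \<omega> = min (min (\<tau> \<omega>) (hitting_time (\<lambda>s \<omega>. X s \<omega> - real n) t \<omega>)) (horizon n)"

lemma horizon_bounds: "t < horizon n" "horizon n < 1"
proof -
  have "0 < (1 - t) / real (n + 2)" using t_range by simp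
  moreover have "(1 - t) / real (n + 2) < 1 - t"
    using t_range divide_strict_left_mono[of 1 "real (n + 2)" "1 - t"] by simp
  ultimately show "t < horizon n" "horizon n < 1" by (simp_all add: horizon_def del: of_nat_add)
qed

lemma horizon_tendsto: "horizon \<longlonglongrightarrow> 1"
proof -
  have "(\<lambda>n. (1 - t) / real (n + 2)) \<longlonglongrightarrow> 0"
    using LIMSEQ_ignore_initial_segment[OF lim_const_over_n[of "1 - t"], of 2] by simp
  then show ?thesis
    unfolding horizon_def[abs_def] using tendsto_diff[OF tendsto_const, of _ 0 sequentially 1] by simp
qed

lemma stopping_time_hitting:
  fixes c :: "real \<Rightarrow> real"
  assumes "continuous_on {t..1} c"
  shows "stopping_time F (hitting_time (\<lambda>s \<omega>. X s \<omega> - c s) t)"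
    and "stopping_time F (hitting_time (\<lambda>s \<omega>. c s - X s \<omega>) t)"
  using t_range adapted_X assms X_continuous
  by (auto intro!: stopping_time_hitting_time borel_measurable_diff continuous_on_diff)

lemma X_at_measurable:
  assumes "\<sigma> \<in> borel_measurable M" "\<And>\<omega>. \<omega> \<in> space M \<Longrightarrow> \<sigma> \<omega> \<in> {t..1}"
  shows "(\<lambda>\<omega>. X (\<sigma> \<omega>) \<omega>) \<in> borel_measurable M"
  by (rule measurable_process_at_random_time[OF t_range(2) X_measurable X_continuous assms])

context
  fixes \<tau> :: "'a \<Rightarrow> real" assumes \<tau>: "\<tau> \<in> stopping_times M F t"
begin

lemma stopping_times_range: "\<omega> \<in> space M \<Longrightarrow> \<tau> \<omega> \<in> {t..1}"
  using \<tau> by (simp add: stopping_times_def)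

lemma stopping_time_localizer: "stopping_time F (localizer \<tau> n)"
  unfolding localizer_def[abs_def] using \<tau>
  by (intro stopping_time_min_const stopping_time_min stopping_time_hitting) (auto simp: stopping_times_def)

lemma localizer_range: "\<omega> \<in> space M \<Longrightarrow> localizer \<tau> n \<omega> \<in> {t..horizon n}"
  using stopping_times_range[of \<omega>] hitting_time_range[of t "\<lambda>s \<omega>. X s \<omega> - real n" \<omega>] t_range horizon_bounds[of n]
  by (simp add: localizer_def)

lemma localizer_le: "localizer \<tau> n \<omega> \<le> \<tau> \<omega>"
  by (simp add: localizer_def)

lemma before_localizer: "r \<in> {t..<localizer \<tau> n \<omega>} \<Longrightarrow> X r \<omega> \<le> real n"
  using before_hitting_time[of t r "\<lambda>s \<omega>. X s \<omega> - real n" \<omega>] t_range by (simp add: localizer_def)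

text \<open>A path is bounded on \<open>[t, 1]\<close>, so it does not reach \<open>n\<close> for large \<open>n\<close>.\<close>

lemma eventually_localizer:
  assumes \<omega>: "\<omega> \<in> space M"
  shows "eventually (\<lambda>n. localizer \<tau> n \<omega> = min (\<tau> \<omega>) (horizon n)) sequentially"
proof -
  obtain y where "\<forall>s\<in>{t..1}. X s \<omega> \<le> X y \<omega>"
    using continuous_attains_sup[OF compact_Icc _ X_continuous[OF \<omega>]] t_range by auto
  then have y: "\<And>s. s \<in> {t..1} \<Longrightarrow> X s \<omega> \<le> X y \<omega>" by blast
  obtain m :: nat where m: "X y \<omega> < real m" using reals_Archimedean2 by blast
  show ?thesis
    unfolding eventually_sequentially
  proof (intro exI allI impI)
    fix n assume "m \<le> n"
    define Y where "Y s \<omega> = X s \<omega> - real n" for s \<omega>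
    have "\<not> hitting_time Y t \<omega> < 1"
    proof
      assume "hitting_time Y t \<omega> < 1"
      moreover have "continuous_on {t..1} (\<lambda>s. Y s \<omega>)"
        unfolding Y_def by (intro continuous_on_diff X_continuous[OF \<omega>] continuous_on_const)
      ultimately have "0 \<le> Y (hitting_time Y t \<omega>) \<omega>"
        using at_hitting_time[of t Y \<omega>] t_range by simp
      moreover have "X (hitting_time Y t \<omega>) \<omega> \<le> X y \<omega>"
        by (rule y[OF hitting_time_range]) (use t_range in simp)
      moreover have "real m \<le> real n" using \<open>m \<le> n\<close> by simp
      ultimately show False using m unfolding Y_def by linarith
    qed
    then have "hitting_time Y t \<omega> = 1"
      using hitting_time_range[of t Y \<omega>] t_range by simp
    then show "localizer \<tau> n \<omega> = min (\<tau> \<omega>) (horizon n)"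
      using stopping_times_range[OF \<omega>] by (simp add: localizer_def Y_def[abs_def])
  qed
qed

lemma localizer_tendsto:
  assumes \<omega>: "\<omega> \<in> space M" shows "(\<lambda>n. localizer \<tau> n \<omega>) \<longlonglongrightarrow> \<tau> \<omega>"
proof -
  have "(\<lambda>n. min (\<tau> \<omega>) (horizon n)) \<longlonglongrightarrow> min (\<tau> \<omega>) 1"
    by (intro tendsto_min tendsto_const horizon_tendsto)
  moreover have "min (\<tau> \<omega>) 1 = \<tau> \<omega>" using stopping_times_range[OF \<omega>] by simp
  ultimately show ?thesis
    using eventually_localizer[OF \<omega>] by (simp add: tendsto_cong)
qed

lemma X_localizer_tendsto:
  assumes \<omega>: "\<omega> \<in> space M" shows "(\<lambda>n. X (localizer \<tau> n \<omega>) \<omega>) \<longlonglongrightarrow> X (\<tau> \<omega>) \<omega>"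
proof (rule continuous_on_tendsto_compose[OF X_continuous[OF \<omega>] localizer_tendsto[OF \<omega>] stopping_times_range[OF \<omega>]])
  have "localizer \<tau> n \<omega> \<in> {t..1}" for n using localizer_range[OF \<omega>, of n] horizon_bounds[of n] by simp
  then show "eventually (\<lambda>n. localizer \<tau> n \<omega> \<in> {t..1}) sequentially" by simp
qed

lemma localizer_range1: "\<omega> \<in> space M \<Longrightarrow> localizer \<tau> n \<omega> \<in> {t..1}"
  using localizer_range[of \<omega> n] horizon_bounds[of n] by simp

lemma X_localizer_measurable: "(\<lambda>\<omega>. X (localizer \<tau> n \<omega>) \<omega>) \<in> borel_measurable M"
proof (rule X_at_measurable)
  have "0 \<le> localizer \<tau> n \<omega>" if "\<omega> \<in> space M" for \<omega>
    using localizer_range1[OF that, of n] t_range by simp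
  then show "localizer \<tau> n \<in> borel_measurable M"
    by (rule stopping_time_measurable[OF stopping_time_localizer])
qed (rule localizer_range1)

lemma X_stopped_measurable: "(\<lambda>\<omega>. X (\<tau> \<omega>) \<omega>) \<in> borel_measurable M"
proof (rule X_at_measurable)
  show "\<tau> \<in> borel_measurable M"
    by (rule stopping_time_measurable) (use \<tau> stopping_times_range t_range in \<open>force simp: stopping_times_def\<close>)+
qed (rule stopping_times_range)

lemma expectation_profile_localizer:
  assumes "x \<le> real n"
  shows "integrable M (\<lambda>\<omega>. stopped_profile (localizer \<tau> n) \<omega>)"
    and "expectation (\<lambda>\<omega>. stopped_profile (localizer \<tau> n) \<omega>) = self_similar profile t x"
  by (rule expectation_profile[OF horizon_bounds stopping_time_localizer localizer_range assms before_localizer]; assumption)+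

lemma X_localizer_le_profile:
  assumes "\<omega> \<in> space M"
  shows "X (localizer \<tau> n \<omega>) \<omega> \<le> stopped_profile (localizer \<tau> n) \<omega>"
  using localizer_range[OF assms, of n] horizon_bounds[of n] by (intro self_similar_ge) simp

lemma X_localizer_integrable:
  assumes "x \<le> real n" shows "integrable M (\<lambda>\<omega>. X (localizer \<tau> n \<omega>) \<omega>)"
proof (rule Bochner_Integration.integrable_bound[OF expectation_profile_localizer(1)[OF assms] X_localizer_measurable])
  show "AE \<omega> in M. norm (X (localizer \<tau> n \<omega>) \<omega>) \<le> norm (stopped_profile (localizer \<tau> n) \<omega>)"
  proof (rule AE_I2)
    fix \<omega> assume \<omega>: "\<omega> \<in> space M"
    show "norm (X (localizer \<tau> n \<omega>) \<omega>) \<le> norm (stopped_profile (localizer \<tau> n) \<omega>)"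
      using X_localizer_le_profile[OF \<omega>, of n] X_nonneg[OF \<omega> localizer_range1[OF \<omega>], of n] by simp
  qed
qed

text \<open>Fatou's lemma: as \<open>X \<ge> 0\<close>, bounds for the localised stopping times pass to the limit.\<close>

lemma expected_payoff_le:
  assumes "\<And>n. x \<le> real n \<Longrightarrow> expectation (\<lambda>\<omega>. X (localizer \<tau> n \<omega>) \<omega>) \<le> v"
  shows "expected_payoff M X \<tau> \<le> ennreal v"
proof -
  obtain m :: nat where m: "x \<le> real m" using real_arch_simple by blast
  have le: "(\<integral>\<^sup>+\<omega>. ennreal (X (localizer \<tau> (n + m) \<omega>) \<omega>) \<partial>M) \<le> ennreal v" for n
  proof -
    have xn: "x \<le> real (n + m)" using m by simp
    have "(\<integral>\<^sup>+\<omega>. ennreal (X (localizer \<tau> (n + m) \<omega>) \<omega>) \<partial>M) = ennreal (expectation (\<lambda>\<omega>. X (localizer \<tau> (n + m) \<omega>) \<omega>))"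
      using X_nonneg localizer_range1 by (intro nn_integral_eq_integral X_localizer_integrable[OF xn]) auto
    also have "\<dots> \<le> ennreal v" by (intro ennreal_leI assms xn)
    finally show ?thesis .
  qed
  have "expected_payoff M X \<tau> = (\<integral>\<^sup>+\<omega>. liminf (\<lambda>n. ennreal (X (localizer \<tau> (n + m) \<omega>) \<omega>)) \<partial>M)"
    unfolding expected_payoff_def
  proof (rule nn_integral_cong)
    fix \<omega> assume "\<omega> \<in> space M"
    from LIMSEQ_ignore_initial_segment[OF X_localizer_tendsto[OF this], of m]
    have "(\<lambda>n. ennreal (X (localizer \<tau> (n + m) \<omega>) \<omega>)) \<longlonglongrightarrow> ennreal (X (\<tau> \<omega>) \<omega>)"
      by (rule tendsto_ennrealI)
    then show "ennreal (X (\<tau> \<omega>) \<omega>) = liminf (\<lambda>n. ennreal (X (localizer \<tau> (n + m) \<omega>) \<omega>))"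
      by (intro lim_imp_Liminf[symmetric]) auto
  qed
  also have "\<dots> \<le> liminf (\<lambda>n. \<integral>\<^sup>+\<omega>. ennreal (X (localizer \<tau> (n + m) \<omega>) \<omega>) \<partial>M)"
    using X_localizer_measurable by (intro nn_integral_liminf) auto
  also have "\<dots> \<le> liminf (\<lambda>n::nat. ennreal v)"
    by (intro Liminf_mono always_eventually allI le)
  finally show ?thesis by (simp add: Liminf_const)
qed

lemma expected_payoff_le_profile: "expected_payoff M X \<tau> \<le> ennreal (self_similar profile t x)"
proof (rule expected_payoff_le)
  fix n assume n: "x \<le> real n"
  have "expectation (\<lambda>\<omega>. X (localizer \<tau> n \<omega>) \<omega>) \<le>
      expectation (\<lambda>\<omega>. stopped_profile (localizer \<tau> n) \<omega>)"
    by (intro integral_mono X_localizer_integrable expectation_profile_localizer X_localizer_le_profile n)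
  then show "expectation (\<lambda>\<omega>. X (localizer \<tau> n \<omega>) \<omega>) \<le> self_similar profile t x"
    using expectation_profile_localizer(2)[OF n] by simp
qed

text \<open>Compare with \<open>X\<close> up to the time \<open>\<sigma>\<close> at which it falls to the boundary and with the self-similar
  solution \<open>U\<close> afterwards. With \<open>\<theta> = min \<tau> \<sigma>\<close>, one has \<open>X\<^sub>\<tau> + U(\<theta>, X\<^sub>\<theta>) \<le> X\<^sub>\<theta> + U(\<tau>, X\<^sub>\<tau>)\<close>: both sides
  agree if \<open>\<tau> \<le> \<sigma>\<close>, and otherwise \<open>U(\<sigma>, X\<^sub>\<sigma>) = X\<^sub>\<sigma>\<close>. The expectations of \<open>U\<close> at both times are equal.\<close>

lemma expected_payoff_le_start:
  assumes x: "boundary t \<le> x" shows "expected_payoff M X \<tau> \<le> ennreal x"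
proof (rule expected_payoff_le)
  fix n assume n: "x \<le> real n"
  define \<tau>n where "\<tau>n = localizer \<tau> n"
  define \<sigma> where "\<sigma> = hitting_time (\<lambda>s \<omega>. boundary s - X s \<omega>) t"
  define \<theta> where "\<theta> \<omega> = min (\<tau>n \<omega>) (\<sigma> \<omega>)" for \<omega>
  note T = horizon_bounds[of n]
  have \<tau>n: "\<tau>n \<omega> \<in> {t..horizon n}" if "\<omega> \<in> space M" for \<omega>
    unfolding \<tau>n_def by (rule localizer_range[OF that])
  have \<sigma>_range: "\<sigma> \<omega> \<in> {t..1}" for \<omega> unfolding \<sigma>_def by (rule hitting_time_range) (use t_range in simp)
  have \<theta>: "stopping_time F \<theta>" "\<And>\<omega>. \<omega> \<in> space M \<Longrightarrow> \<theta> \<omega> \<in> {t..horizon n}"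
  proof -
    show "stopping_time F \<theta>"
      unfolding \<theta>_def[abs_def] \<tau>n_def \<sigma>_def
      by (intro stopping_time_min stopping_time_localizer stopping_time_hitting(2) continuous_boundary)
    show "\<theta> \<omega> \<in> {t..horizon n}" if "\<omega> \<in> space M" for \<omega>
      using \<tau>n[OF that] \<sigma>_range[of \<omega>] by (auto simp: \<theta>_def)
  qed
  have above: "sqrt (1 - r) \<le> X r \<omega>" if "\<omega> \<in> space M" "r \<in> {t..<\<theta> \<omega>}" for \<omega> r
  proof -
    have r: "t \<le> r" "r < \<sigma> \<omega>" "r < 1" using that \<theta>(2)[OF that(1)] T by (auto simp: \<theta>_def)
    then have "boundary r < X r \<omega>"
      using before_hitting_time[of t r "\<lambda>s \<omega>. boundary s - X s \<omega>" \<omega>] t_range by (simp add: \<sigma>_def)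
    moreover have "1 * sqrt (1 - r) \<le> boundary r"
      unfolding boundary_def using excursion_C_ge_1 r by (intro mult_right_mono) auto
    ultimately show ?thesis by simp
  qed
  note E\<theta> = expectation_above_root_le[OF T \<theta> above]
  have below_N: "X r \<omega> \<le> real n" if "\<omega> \<in> space M" "r \<in> {t..<\<theta> \<omega>}" for \<omega> r
    by (rule before_localizer) (use that in \<open>auto simp: \<theta>_def \<tau>n_def\<close>)
  note U\<theta> = expectation_profile[OF T \<theta> n below_N]
  note U\<tau> = expectation_profile_localizer[OF n, folded \<tau>n_def]
  have X\<tau>: "integrable M (\<lambda>\<omega>. X (\<tau>n \<omega>) \<omega>)" using X_localizer_integrable[OF n] by (simp add: \<tau>n_def)
  have "AE \<omega> in M. X (\<tau>n \<omega>) \<omega> + stopped_profile \<theta> \<omega> \<le>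
      X (\<theta> \<omega>) \<omega> + stopped_profile \<tau>n \<omega>"
    using X_start AE_space
  proof eventually_elim
    case (elim \<omega>)
    show ?case
    proof (cases "\<tau>n \<omega> \<le> \<sigma> \<omega>")
      case True then show ?thesis by (simp add: \<theta>_def)
    next
      case False
      then have \<theta>\<sigma>: "\<theta> \<omega> = \<sigma> \<omega>" "\<sigma> \<omega> < 1" using \<tau>n[OF elim(2)] T by (auto simp: \<theta>_def)
      have cont: "continuous_on {t..1} (\<lambda>s. boundary s - X s \<omega>)"
        by (intro continuous_on_diff continuous_boundary X_continuous[OF elim(2)])
      have "0 \<le> boundary (\<sigma> \<omega>) - X (\<sigma> \<omega>) \<omega>"
        unfolding \<sigma>_def
        by (rule at_hitting_time[of t "\<lambda>s \<omega>. boundary s - X s \<omega>" \<omega>, OF cont]) (use t_range \<theta>\<sigma>(2) in \<open>auto simp: \<sigma>_def\<close>)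
      moreover have "boundary (\<sigma> \<omega>) - X (\<sigma> \<omega>) \<omega> \<le> 0"
      proof (cases "\<sigma> \<omega> = t")
        case True then show ?thesis using x elim by simp
      next
        case False
        show ?thesis
        proof (rule continuous_le_at_endpoint[OF cont])
          show "boundary r - X r \<omega> \<le> 0" if "r \<in> {t..<\<sigma> \<omega>}" for r
            using before_hitting_time[of t r "\<lambda>s \<omega>. boundary s - X s \<omega>" \<omega>] that t_range by (simp add: \<sigma>_def)
        qed (use False \<sigma>_range[of \<omega>] in auto)
      qed
      ultimately have "X (\<sigma> \<omega>) \<omega> = boundary (\<sigma> \<omega>)" by simp
      then have "stopped_profile \<theta> \<omega> = X (\<theta> \<omega>) \<omega>"
        using self_similar_boundary[OF \<theta>\<sigma>(2)] \<theta>\<sigma>(1) by simp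
      then show ?thesis using X_localizer_le_profile[OF elim(2), of n] by (simp add: \<tau>n_def)
    qed
  qed
  then have "expectation (\<lambda>\<omega>. X (\<tau>n \<omega>) \<omega> + stopped_profile \<theta> \<omega>) \<le>
      expectation (\<lambda>\<omega>. X (\<theta> \<omega>) \<omega> + stopped_profile \<tau>n \<omega>)"
    using X\<tau> U\<theta>(1) E\<theta>(1) U\<tau>(1) by (intro integral_mono_AE Bochner_Integration.integrable_add)
  then show "expectation (\<lambda>\<omega>. X (localizer \<tau> n \<omega>) \<omega>) \<le> x"
    using X\<tau> U\<theta> E\<theta> U\<tau> unfolding \<tau>n_def by simp
qed

end

text \<open>At time 1 the boundary is zero, so \<open>s = 1\<close> always belongs to the set whose infimum is \<open>\<tau>*\<close>.\<close>

lemma tau_star_eq_hitting_time: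
  assumes \<omega>: "\<omega> \<in> space M" shows "tau_star X t \<omega> = hitting_time (\<lambda>s \<omega>. X s \<omega> - boundary s) t \<omega>"
proof -
  have "{s \<in> {t..1}. boundary s \<le> X s \<omega>} = insert 1 {s \<in> {t..1}. 0 \<le> X s \<omega> - boundary s}"
    using X_nonneg[OF \<omega>, of 1] t_range by auto
  then show ?thesis by (simp add: tau_star_def hitting_time_def)
qed

lemma tau_star_stopping_time: "tau_star X t \<in> stopping_times M F t"
  unfolding stopping_times_def
proof (intro CollectI conjI ballI)
  show "tau_star X t \<omega> \<in> {t..1}" if "\<omega> \<in> space M" for \<omega>
    unfolding tau_star_eq_hitting_time[OF that] by (rule hitting_time_range) (use t_range in simp)
  show "stopping_time F (tau_star X t)"
  proof (rule stopping_timeI)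
    fix s
    have "Measurable.pred (F s) (\<lambda>\<omega>. tau_star X t \<omega> \<le> s) \<longleftrightarrow>
        Measurable.pred (F s) (\<lambda>\<omega>. hitting_time (\<lambda>s \<omega>. X s \<omega> - boundary s) t \<omega> \<le> s)"
      by (rule measurable_cong) (simp add: space_F tau_star_eq_hitting_time)
    then show "Measurable.pred (F s) (\<lambda>\<omega>. tau_star X t \<omega> \<le> s)"
      using stopping_timeD[OF stopping_time_hitting(1)[OF continuous_boundary]] by blast
  qed
qed

text \<open>By continuity the bound extends from the times before \<open>\<tau>*\<close> to \<open>\<tau>*\<close> itself.\<close>

lemma X_le_boundary_tau_star:
  assumes \<omega>: "\<omega> \<in> space M" and start: "X t \<omega> < boundary t" and s: "s \<in> {t..tau_star X t \<omega>}"
  shows "X s \<omega> \<le> boundary s"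
proof -
  have star: "tau_star X t \<omega> = hitting_time (\<lambda>s \<omega>. X s \<omega> - boundary s) t \<omega>" by (rule tau_star_eq_hitting_time[OF \<omega>])
  have before: "X r \<omega> - boundary r \<le> 0" if "r \<in> {t..<tau_star X t \<omega>}" for r
    using before_hitting_time[of t r "\<lambda>s \<omega>. X s \<omega> - boundary s" \<omega>] that t_range star by simp
  have s1: "s \<le> 1" using hitting_time_range[of t "\<lambda>s \<omega>. X s \<omega> - boundary s" \<omega>] star s t_range by simp
  have "X s \<omega> - boundary s \<le> 0"
  proof (cases "s = t")
    case False
    show ?thesis
      by (rule continuous_le_at_endpoint[of t 1])
         (use False s s1 before in \<open>auto intro!: continuous_on_diff X_continuous[OF \<omega>] continuous_boundary\<close>)
  qed (use start in simp)
  then show ?thesis by simp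
qed

text \<open>Up to \<open>\<tau>*\<close> the self-similar solution is at most the boundary, so its localised expectations converge
  by bounded convergence. The limit is \<open>X\<close> at time \<open>\<tau>*\<close>: if \<open>\<tau>* < 1\<close>, because \<open>X\<close> is on the boundary; if
  \<open>\<tau>* = 1\<close>, because both the boundary and, squeezed by it, \<open>X\<close> tend to zero.\<close>

lemma expected_payoff_tau_star_below:
  assumes x: "x < boundary t"
  shows "expected_payoff M X (tau_star X t) = ennreal (self_similar profile t x)"
proof -
  let ?\<tau> = "tau_star X t"
  note \<tau> = tau_star_stopping_time
  obtain m :: nat where m: "x \<le> real m" using real_arch_simple by blast
  define l where "l n = localizer ?\<tau> (n + m)" for n
  have xn: "x \<le> real (n + m)" for n using m by simp
  have l_range: "l n \<omega> \<in> {t..?\<tau> \<omega>}" "l n \<omega> < 1" "l n \<omega> \<in> {t..1}" if "\<omega> \<in> space M" for n \<omega>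
    using localizer_range[OF \<tau> that, of "n + m"] localizer_le[OF \<tau>, of "n + m" \<omega>] horizon_bounds[of "n + m"]
    by (auto simp: l_def)
  define u where "u n \<omega> = stopped_profile (l n) \<omega>" for n \<omega>
  have u: "integrable M (u n)" "expectation (u n) = self_similar profile t x" for n
    using expectation_profile_localizer[OF \<tau> xn] by (auto simp: u_def[abs_def] l_def)
  have start: "AE \<omega> in M. X t \<omega> < boundary t \<and> \<omega> \<in> space M"
    using X_start AE_space by eventually_elim (use x in simp)
  have u_bounds: "0 \<le> u n \<omega>" "u n \<omega> \<le> boundary (l n \<omega>)" if "X t \<omega> < boundary t" "\<omega> \<in> space M" for n \<omega>
    unfolding u_def
    using profile_pos[THEN less_imp_le] l_range[OF that(2), of n] X_le_boundary_tau_star[OF that(2,1) l_range(1)[OF that(2)]]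
      X_nonneg[OF that(2) l_range(3)[OF that(2)]]
    by (auto simp: self_similar_def[abs_def] intro!: self_similar_le_boundary[unfolded self_similar_def])
  have boundary_le: "boundary s \<le> excursion_C" if "t \<le> s" "s \<le> 1" for s
    unfolding boundary_def using that t_range excursion_C_ge_1 by (intro mult_left_le) auto
  have lim: "(\<lambda>n. u n \<omega>) \<longlonglongrightarrow> X (?\<tau> \<omega>) \<omega>" if \<omega>: "X t \<omega> < boundary t" "\<omega> \<in> space M" for \<omega>
  proof -
    have \<tau>r: "?\<tau> \<omega> \<in> {t..1}" by (rule stopping_times_range[OF \<tau> \<omega>(2)])
    have l_lim: "(\<lambda>n. l n \<omega>) \<longlonglongrightarrow> ?\<tau> \<omega>"
      unfolding l_def using localizer_tendsto[OF \<tau> \<omega>(2)] by (rule LIMSEQ_ignore_initial_segment)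
    have X_le: "X (?\<tau> \<omega>) \<omega> \<le> boundary (?\<tau> \<omega>)"
      by (rule X_le_boundary_tau_star[OF \<omega>(2,1)]) (use \<tau>r in simp)
    show ?thesis
    proof (cases "?\<tau> \<omega> < 1")
      case True
      have "continuous_on {t..1} (\<lambda>s. X s \<omega> - boundary s)"
        by (intro continuous_on_diff X_continuous[OF \<omega>(2)] continuous_boundary)
      then have "boundary (?\<tau> \<omega>) \<le> X (?\<tau> \<omega>) \<omega>"
        using at_hitting_time[of t "\<lambda>s \<omega>. X s \<omega> - boundary s" \<omega>] True t_range \<omega>(2)
        unfolding tau_star_eq_hitting_time[OF \<omega>(2)] by simp
      then have X_eq: "X (?\<tau> \<omega>) \<omega> = boundary (?\<tau> \<omega>)" using X_le by simp
      have "eventually (\<lambda>n. ?\<tau> \<omega> < horizon n) sequentially"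
        by (rule order_tendstoD(1)[OF horizon_tendsto True])
      with eventually_localizer[OF \<tau> \<omega>(2)]
      have "eventually (\<lambda>n. localizer ?\<tau> n \<omega> = ?\<tau> \<omega>) sequentially"
        by eventually_elim simp
      then have "eventually (\<lambda>n. l n \<omega> = ?\<tau> \<omega>) sequentially"
        unfolding l_def by (rule sequentially_offset)
      then have "eventually (\<lambda>n. u n \<omega> = X (?\<tau> \<omega>) \<omega>) sequentially"
        by eventually_elim (use X_eq self_similar_boundary[OF True] in \<open>simp add: u_def\<close>)
      then show ?thesis by (rule tendsto_eventually)
    next
      case False
      then have one: "?\<tau> \<omega> = 1" using \<tau>r by simp
      have "(\<lambda>n. boundary (l n \<omega>)) \<longlonglongrightarrow> boundary (?\<tau> \<omega>)"
        by (rule continuous_on_tendsto_compose[OF continuous_boundary[of UNIV] l_lim]) auto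
      then have "(\<lambda>n. boundary (l n \<omega>)) \<longlonglongrightarrow> 0" by (simp add: one)
      then have "(\<lambda>n. u n \<omega>) \<longlonglongrightarrow> 0"
        using u_bounds[OF \<omega>] by (intro tendsto_sandwich[of "\<lambda>_. 0" "\<lambda>n. u n \<omega>" _ "\<lambda>n. boundary (l n \<omega>)"]) auto
      moreover have "X (?\<tau> \<omega>) \<omega> = 0" using X_le X_nonneg[OF \<omega>(2), of 1] one t_range by simp
      ultimately show ?thesis by simp
    qed
  qed
  have AE_lim: "AE \<omega> in M. (\<lambda>n. u n \<omega>) \<longlonglongrightarrow> X (?\<tau> \<omega>) \<omega>"
    using start by eventually_elim (blast intro: lim)
  have AE_bound: "AE \<omega> in M. norm (u n \<omega>) \<le> excursion_C" for n
    using start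
  proof eventually_elim
    case (elim \<omega>)
    then show ?case
      using u_bounds[of \<omega> n] boundary_le[of "l n \<omega>"] l_range[of \<omega> n] by auto
  qed
  have meas: "(\<lambda>\<omega>. X (?\<tau> \<omega>) \<omega>) \<in> borel_measurable M" by (rule X_stopped_measurable[OF \<tau>])
  have u_meas: "u n \<in> borel_measurable M" for n using u(1) by (rule borel_measurable_integrable)
  have const: "integrable M (\<lambda>_. excursion_C)" by simp
  have int: "integrable M (\<lambda>\<omega>. X (?\<tau> \<omega>) \<omega>)"
    by (rule integrable_dominated_convergence[OF meas u_meas const AE_lim AE_bound])
  have "(\<lambda>n. expectation (u n)) \<longlonglongrightarrow> expectation (\<lambda>\<omega>. X (?\<tau> \<omega>) \<omega>)"
    by (rule integral_dominated_convergence[OF meas u_meas const AE_lim AE_bound])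
  then have "expectation (\<lambda>\<omega>. X (?\<tau> \<omega>) \<omega>) = self_similar profile t x"
    unfolding u(2) by (simp add: LIMSEQ_const_iff)
  then show ?thesis
    unfolding expected_payoff_def using X_nonneg stopping_times_range[OF \<tau>]
    by (subst nn_integral_eq_integral[OF int]) auto
qed

lemma expected_payoff_tau_star_above:
  assumes x: "boundary t \<le> x"
  shows "expected_payoff M X (tau_star X t) = ennreal x"
proof -
  have "AE \<omega> in M. ennreal (X (tau_star X t \<omega>) \<omega>) = ennreal x"
    using X_start
  proof eventually_elim
    case (elim \<omega>)
    have "tau_star X t \<omega> = t"
      unfolding tau_star_def by (rule cInf_eq_minimum) (use elim x t_range in auto)
    then show ?case using elim by simp
  qed
  then have "expected_payoff M X (tau_star X t) = (\<integral>\<^sup>+\<omega>. ennreal x \<partial>M)"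
    unfolding expected_payoff_def by (rule nn_integral_cong_AE)
  then show ?thesis by (simp add: emeasure_space_1)
qed

lemma expected_payoff_tau_star: "expected_payoff M X (tau_star X t) = ennreal (V_star t x)"
  using expected_payoff_tau_star_below expected_payoff_tau_star_above t_range x_nonneg
  by (cases "x < boundary t") (simp_all add: V_star_eq self_similar_def)

lemma expected_payoff_le_V_star:
  assumes "\<tau> \<in> stopping_times M F t" shows "expected_payoff M X \<tau> \<le> ennreal (V_star t x)"
  using expected_payoff_le_profile[OF assms] expected_payoff_le_start[OF assms] t_range x_nonneg
  by (cases "x < boundary t") (simp_all add: V_star_eq self_similar_def)

lemma value_fun_eq: "value_fun M F X t = ennreal (V_star t x)"
  unfolding value_fun_def
proof (rule antisym)
  show "(SUP \<tau>\<in>stopping_times M F t. expected_payoff M X \<tau>) \<le> ennreal (V_star t x)"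
    by (rule SUP_least) (rule expected_payoff_le_V_star)
  show "ennreal (V_star t x) \<le> (SUP \<tau>\<in>stopping_times M F t. expected_payoff M X \<tau>)"
    unfolding expected_payoff_tau_star[symmetric] by (rule SUP_upper[OF tau_star_stopping_time])
qed

end

theorem theorem2p3:
  fixes M :: "'a measure" and F :: "real \<Rightarrow> 'a measure"
    and W X :: "real \<Rightarrow> 'a \<Rightarrow> real" and t x :: real
  assumes "0 \<le> t" "t < 1" and "0 \<le> x"
    and "brownian_excursion M F W t x X"
  shows "value_fun M F X t = ennreal (V_star t x) \<and>
    tau_star X t \<in> stopping_times M F t \<and>
    expected_payoff M X (tau_star X t) = value_fun M F X t"
proof -
  interpret brownian_excursion M F W t x X by fact
  show ?thesis
    using value_fun_eq tau_star_stopping_time expected_payoff_tau_star by simp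
qed

end
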